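(* Let $\mu,\nu\in\mathcal P(\mathbb{R}^N)$ and let $c:\mathbb{R}^N\times\mathbb{R}^N\to\mathbb{R}$ be lower semicontinuous, bounded from below and separable: $c(x,y)=\sum_{t\le N}c_t(x_t,y_t)$. Suppose $\mu$ is the product of its marginals, $\mu(dx_1,\dots,dx_N)=\mu_1(dx_1)\cdots\mu_N(dx_N)$. Then $$\inf_{\gamma\in\Pi_c(\mu,\nu)}\int c\,d\gamma=\inf_{\gamma\in\Pi_{bc}(\mu,\nu)}\int c\,d\gamma .$$ If moreover for each $t$ one has $c_t(x_t,y_t)=h_t(x_t-y_t)$ with $h_t:\mathbb{R}\to\mathbb{R}$ convex, then a solution of the causal problem $\inf_{\gamma\in\Pi_c(\mu,\nu)}\int c\,d\gamma$ is given by the Knothe-Rosenblatt rearrangement of $\mu$ and $\nu$. If additionally each $\mu_i$ is atomless, then this rearrangement is induced by the Knothe-Rosenblatt map $T$, i.e. it equals $(\mathrm{id}\times T)_*\mu$.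
   Context: $\Pi(\mu,\nu)$ is the set of couplings of $\mu,\nu$ on $\mathbb{R}^N\times\mathbb{R}^N$ (coordinates $x_1,\dots,x_N,y_1,\dots,y_N$). $\gamma\in\Pi(\mu,\nu)$ is causal, $\gamma\in\Pi_c(\mu,\nu)$, if for every $t\in\{1,\dots,N\}$ and $B\in\sigma(y_1,\dots,y_t)$ the map $x\mapsto\gamma^x(B)$ (with $\gamma^x$ the conditional law of $y$ given $x$) is $\sigma(x_1,\dots,x_t)$-measurable up to a $\mu$-null set. $\Pi_{bc}(\mu,\nu)$ is the set of $\gamma\in\Pi_c(\mu,\nu)$ whose image under $(x,y)\mapsto(y,x)$ belongs to $\Pi_c(\nu,\mu)$. For a probability $\eta$ on $\mathbb{R}$: $F_\eta(y)=\eta((-\infty,y])$ and $F_\eta^{-1}(u)=\inf\{y:F_\eta(y)\ge u\}$. For $\eta\in\mathcal P(\mathbb{R}^N)$, $\eta_1$ is its first-coordinate marginal and $\eta^{x_1,\dots,x_{t-1}}$ the conditional law of the $t$-th coordinate given the first $t-1$. Knothe-Rosenblatt rearrangement of $\mu,\nu$: the law of $(X_1^*,\dots,X_N^*,Y_1^*,\dots,Y_N^* )$ with $X_1^*=F_{\mu_1}^{-1}(U_1)$, $Y_1^*=F_{\nu_1}^{-1}(U_1)$ and, for $t=2,\dots,N$, $X_t^*=F^{-1}_{\mu^{X_1^*,\dots,X_{t-1}^*}}(U_t)$, $Y_t^*=F^{-1}_{\nu^{Y_1^*,\dots,Y_{t-1}^*}}(U_t)$, where $U_1,\dots,U_N$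 are independent and uniform on $[0,1]$. Knothe-Rosenblatt map: $T(x)=(T^1(x_1),T^2(x_2;x_1),\dots,T^N(x_N;x_1,\dots,x_{N-1}))$ with $T^1=F_{\nu_1}^{-1}\circ F_{\mu_1}$ and, for $t\ge2$, $T^t(x_t;x_1,\dots,x_{t-1})=F^{-1}_{\nu^{T^1(x_1),\dots,T^{t-1}(x_{t-1};x_1,\dots,x_{t-2})}}\circ F_{\mu^{x_1,\dots,x_{t-1}}}(x_t)$. *)

theory Defs
  imports "HOL-Probability.Probability"
begin

text \<open>
  \<open>\<real>\<^sup>N\<close> is rendered as the product measurable space of \<open>N\<close> copies of the Borel line with index
  set \<open>{1..N}\<close>; its points are the functions in \<open>{1..N} \<rightarrow>\<^sub>E UNIV\<close> (equal to \<open>undefined\<close> outside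
  \<open>{1..N}\<close>), so that \<open>restrict x {1..t}\<close> is the vector \<open>(x\<^sub>1,\<dots>,x\<^sub>t)\<close>.
\<close>

abbreviation RN :: "nat \<Rightarrow> (nat \<Rightarrow> real) measure" where
  "RN N \<equiv> PiM {1..N} (\<lambda>_. borel)"

abbreviation RN_top :: "nat \<Rightarrow> (nat \<Rightarrow> real) topology" where
  "RN_top N \<equiv> product_topology (\<lambda>_. euclidean) {1..N}"

definition lower_semicontinuous_map :: "'a topology \<Rightarrow> ('a \<Rightarrow> real) \<Rightarrow> bool" where
  "lower_semicontinuous_map T f \<longleftrightarrow> (\<forall>a. openin T {p \<in> topspace T. a < f p})"

definition marginal :: "(nat \<Rightarrow> real) measure \<Rightarrow> nat \<Rightarrow> real measure" where
  "marginal \<eta> t = distr \<eta> borel (\<lambda>x. x t)"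

definition atomless :: "'a measure \<Rightarrow> bool" where
  "atomless M \<longleftrightarrow>
     \<not> (\<exists>A\<in>sets M. 0 < emeasure M A \<and>
          (\<forall>B\<in>sets M. B \<subseteq> A \<longrightarrow> emeasure M B = 0 \<or> emeasure M (A - B) = 0))"

text \<open>
  \<open>\<kappa>\<close> is a version of the (regular) conditional law, under \<open>P\<close>, of the \<open>L\<close>-valued variable \<open>Y\<close>
  given the \<open>M\<close>-valued variable \<open>X\<close>. For \<open>L\<close> standard Borel, as in all uses below, a version exists
  and is unique up to null sets of the law of \<open>X\<close>.
\<close>

definition is_cond_law ::
  "'a measure \<Rightarrow> ('a \<Rightarrow> 'b) \<Rightarrow> 'b measure \<Rightarrow> ('a \<Rightarrow> 'c) \<Rightarrow> 'c measure \<Rightarrow> ('b \<Rightarrow> 'c measure) \<Rightarrow> bool"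
where
  "is_cond_law P X M Y L \<kappa> \<longleftrightarrow>
     \<kappa> \<in> M \<rightarrow>\<^sub>M prob_algebra L \<and>
     (\<forall>A\<in>sets M. \<forall>B\<in>sets L.
        emeasure P {\<omega> \<in> space P. X \<omega> \<in> A \<and> Y \<omega> \<in> B} = (\<integral>\<^sup>+ x\<in>A. emeasure (\<kappa> x) B \<partial>distr P M X))"

definition couplings :: "'a measure \<Rightarrow> 'b measure \<Rightarrow> ('a \<times> 'b) measure set" where
  "couplings \<mu> \<nu> =
     {\<gamma>. sets \<gamma> = sets (\<mu> \<Otimes>\<^sub>M \<nu>) \<and> distr \<gamma> \<mu> fst = \<mu> \<and> distr \<gamma> \<nu> snd = \<nu>}"

text \<open>The sub-\<open>\<sigma>\<close>-algebra \<open>\<sigma>(x\<^sub>1,\<dots>,x\<^sub>t)\<close> on \<open>\<real>\<^sup>N\<close>.\<close>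

definition hist_algebra :: "nat \<Rightarrow> nat \<Rightarrow> (nat \<Rightarrow> real) measure" where
  "hist_algebra N t = vimage_algebra (space (RN N)) (\<lambda>x. restrict x {1..t}) (RN t)"

text \<open>
  The condition does not depend on the version \<open>\<kappa>\<close> of \<open>x \<mapsto> \<gamma>\<^sup>x\<close>: for fixed \<open>B\<close> two versions
  agree \<open>\<mu>\<close>-almost everywhere.
\<close>

definition causal_couplings ::
  "nat \<Rightarrow> (nat \<Rightarrow> real) measure \<Rightarrow> (nat \<Rightarrow> real) measure
     \<Rightarrow> ((nat \<Rightarrow> real) \<times> (nat \<Rightarrow> real)) measure set"
where
  "causal_couplings N \<mu> \<nu> =
     {\<gamma> \<in> couplings \<mu> \<nu>.
        \<exists>\<kappa>. is_cond_law \<gamma> fst (RN N) snd (RN N) \<kappa> \<and>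
          (\<forall>t\<in>{1..N}. \<forall>B\<in>sets (hist_algebra N t).
             \<exists>g\<in>borel_measurable (hist_algebra N t). AE x in \<mu>. measure (\<kappa> x) B = g x)}"

definition bicausal_couplings ::
  "nat \<Rightarrow> (nat \<Rightarrow> real) measure \<Rightarrow> (nat \<Rightarrow> real) measure
     \<Rightarrow> ((nat \<Rightarrow> real) \<times> (nat \<Rightarrow> real)) measure set"
where
  "bicausal_couplings N \<mu> \<nu> =
     {\<gamma> \<in> causal_couplings N \<mu> \<nu>.
        distr \<gamma> (\<nu> \<Otimes>\<^sub>M \<mu>) (\<lambda>(x, y). (y, x)) \<in> causal_couplings N \<nu> \<mu>}"

text \<open>
  The integral of a function that is bounded from below, with values in \<open>(-\<infinity>, \<infinity>]\<close>: integral of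
  the positive part minus integral of the negative part.
\<close>

definition ext_integral :: "'a measure \<Rightarrow> ('a \<Rightarrow> real) \<Rightarrow> ereal" where
  "ext_integral M f =
     enn2ereal (\<integral>\<^sup>+ p. ennreal (f p) \<partial>M) - enn2ereal (\<integral>\<^sup>+ p. ennreal (- f p) \<partial>M)"

text \<open>
  \<open>F\<^sub>\<eta>\<close> is the library's \<^const>\<open>cdf\<close>. The generalised inverse below is real-valued, so at levels
  \<open>u\<close> where the infimum would be infinite (possible only for \<open>u \<le> 0\<close> or \<open>u \<ge> 1\<close>) its value is
  arbitrary; it is only used at such levels on null sets.
\<close>

definition quantile :: "real measure \<Rightarrow> real \<Rightarrow> real" where
  "quantile \<eta> u = Inf {y. u \<le> cdf \<eta> y}"

text \<open>
  \<open>cond_coord \<eta> t (x\<^sub>1,\<dots>,x\<^bsub>t-1\<^esub>)\<close> is the conditional law of the \<open>t\<close>-th coordinate given the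
  first \<open>t - 1\<close>, in a version fixed once and for all, and \<open>\<eta>\<^sub>1\<close> for \<open>t = 1\<close>.
\<close>

definition cond_coord ::
  "(nat \<Rightarrow> real) measure \<Rightarrow> nat \<Rightarrow> (nat \<Rightarrow> real) \<Rightarrow> real measure"
where
  "cond_coord \<eta> t =
     (if t = 1 then (\<lambda>_. marginal \<eta> 1)
      else (SOME \<kappa>. is_cond_law \<eta> (\<lambda>x. restrict x {1..t - 1}) (RN (t - 1)) (\<lambda>x. x t) borel \<kappa>))"

text \<open>
  \<open>KR_path \<eta> u t\<close> is \<open>(X\<^sub>1\<^sup>*,\<dots>,X\<^sub>t\<^sup>*)\<close> as a function of the realisation \<open>u\<close> of the uniforms, and
  \<open>KR_map_upto \<mu> \<nu> x t\<close> is \<open>(T\<^sup>1(x\<^sub>1),\<dots>,T\<^sup>t(x\<^sub>t; x\<^sub>1,\<dots>,x\<^bsub>t-1\<^esub>))\<close>.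
\<close>

primrec KR_path :: "(nat \<Rightarrow> real) measure \<Rightarrow> (nat \<Rightarrow> real) \<Rightarrow> nat \<Rightarrow> (nat \<Rightarrow> real)" where
  "KR_path \<eta> u 0 = (\<lambda>_. undefined)"
| "KR_path \<eta> u (Suc t) =
     (KR_path \<eta> u t)(Suc t := quantile (cond_coord \<eta> (Suc t) (KR_path \<eta> u t)) (u (Suc t)))"

definition KR_rearrangement ::
  "nat \<Rightarrow> (nat \<Rightarrow> real) measure \<Rightarrow> (nat \<Rightarrow> real) measure
     \<Rightarrow> ((nat \<Rightarrow> real) \<times> (nat \<Rightarrow> real)) measure"
where
  "KR_rearrangement N \<mu> \<nu> =
     distr (PiM {1..N} (\<lambda>_. uniform_measure lborel {0..1})) (RN N \<Otimes>\<^sub>M RN N)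
       (\<lambda>u. (KR_path \<mu> u N, KR_path \<nu> u N))"

primrec KR_map_upto ::
  "(nat \<Rightarrow> real) measure \<Rightarrow> (nat \<Rightarrow> real) measure \<Rightarrow> (nat \<Rightarrow> real) \<Rightarrow> nat \<Rightarrow> (nat \<Rightarrow> real)"
where
  "KR_map_upto \<mu> \<nu> x 0 = (\<lambda>_. undefined)"
| "KR_map_upto \<mu> \<nu> x (Suc t) =
     (KR_map_upto \<mu> \<nu> x t)(Suc t :=
        quantile (cond_coord \<nu> (Suc t) (KR_map_upto \<mu> \<nu> x t))
          (cdf (cond_coord \<mu> (Suc t) (restrict x {1..t})) (x (Suc t))))"

definition KR_map ::
  "nat \<Rightarrow> (nat \<Rightarrow> real) measure \<Rightarrow> (nat \<Rightarrow> real) measure \<Rightarrow> (nat \<Rightarrow> real) \<Rightarrow> (nat \<Rightarrow> real)"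
where
  "KR_map N \<mu> \<nu> x = KR_map_upto \<mu> \<nu> x N"

end

theory Submission
  imports Defs
begin

text \<open>
  If \<open>\<mu>\<close> is a product and \<open>\<gamma>\<close> is causal, then under \<open>\<gamma>\<close> the coordinate \<open>x\<^sub>t\<close> is independent of
  \<open>y\<^sub>1, \<dots>, y\<^bsub>t-1\<^esub>\<close>; this is the only consequence of causality that is needed. Hence the conditional law of
  \<open>(x\<^sub>t, y\<^sub>t)\<close> given \<open>y\<^sub>1, \<dots>, y\<^bsub>t-1\<^esub>\<close> couples \<open>\<mu>\<^sub>t\<close> with the conditional law of \<open>y\<^sub>t\<close>. Drawing \<open>(x\<^sub>t, y\<^sub>t)\<close> successively
  from these conditional laws gives a bicausal coupling under which \<open>(x\<^sub>t, y\<^sub>1, \<dots>, y\<^sub>t)\<close> has the same law as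
  under \<open>\<gamma>\<close> for each \<open>t\<close>, and a separable cost sees nothing else. For convex costs of \<open>x\<^sub>t - y\<^sub>t\<close> the one-dimensional
  couplings can in addition be replaced by monotone ones, which turns the construction into the
  Knothe-Rosenblatt rearrangement. Conditional laws are realised by randomised maps driven by uniform
  variables, so that both directions of causality become adaptedness of such maps.
\<close>

section \<open>Quantile functions and kernels\<close>

text \<open>The successive drawing is bicausal because a step looks at no earlier source coordinate:
  y_t is produced from x_t, a fresh uniform and y_1, ..., y_{t-1}. Hence y is adapted to x, and
  given all of y the x_t are independent, each with a law depending on y_1, ..., y_t alone. A
  general causal coupling may let y_t depend on x_1, ..., x_{t-1} as well, which can destroy the
  second property. Two obstacles shape the details. No moments are assumed and costs may integrate
  to \<infinity>; separability bounds each summand from below, and after a shift all comparisons are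
  between nonnegative integrals. Conditional laws are determined only up to null sets, while the
  rearrangement is defined through one arbitrary version; identities between that version and a
  constructed law hold almost everywhere under the law of the history, and the null sets have to be
  carried back to the uniforms.\<close>

abbreviation U01 :: "real measure" where
  "U01 \<equiv> uniform_measure lborel {0..1}"

lemma prob_space_U01: "prob_space U01"
  by (rule prob_space_uniform_measure) auto

text \<open>The levels 0 and 1 are where \<open>quantile\<close> may take an arbitrary value;
  statements about quantiles of uniforms are made off this null set.\<close>

lemma AE_U01: "AE u in U01. 0 < u \<and> u < 1"
proof -
  have "AE u in lborel. u \<noteq> (0::real)" "AE u in lborel. u \<noteq> (1::real)"
    by (rule AE_lborel_singleton)+
  then show ?thesis
    by (subst AE_uniform_measure) (auto simp: less_le)
qed

lemma emeasure_U01_atMost: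
  assumes "0 \<le> a" "a \<le> 1"
  shows "emeasure U01 {..a} = ennreal a"
proof -
  have "{0..1} \<inter> {..a} = {0..a}" using assms by auto
  then show ?thesis using assms by (subst emeasure_uniform_measure) (auto simp: divide_ennreal_def)
qed

lemma emeasure_U01_ennreal_le:
  "emeasure U01 {u. ennreal u \<le> r} = min 1 r"
proof (cases r)
  case (real r')
  interpret U: prob_space U01 by (rule prob_space_U01)
  have *: "{u. ennreal u \<le> r} = {..r'}"
    using real by (auto simp: ennreal_le_iff ennreal_le_iff2)
  show ?thesis
  proof (cases "r' \<le> 1")
    case True
    then show ?thesis using real emeasure_U01_atMost[of r'] unfolding * by (simp add: min_def)
  next
    case False
    have "emeasure U01 {..r'} \<ge> emeasure U01 {..1}"
      by (rule emeasure_mono) (use False in auto)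
    moreover have "emeasure U01 {..r'} \<le> 1" by (rule U.emeasure_le_1)
    ultimately have "emeasure U01 {..r'} = 1"
      by (simp add: emeasure_U01_atMost)
    then show ?thesis using False real unfolding * by (simp add: min_def ennreal_le_1)
  qed
next
  case top
  interpret U: prob_space U01 by (rule prob_space_U01)
  show ?thesis using top U.emeasure_space_1 by (simp add: min_def)
qed

section \<open>Generalised inverses of a distribution function\<close>

context real_distribution
begin

text \<open>Right-continuity puts the infimum itself into the level set. The hypothesis
  \<open>u \<le> cdf M b\<close> takes the place of u < 1 so that every positive level reached by
  the distribution function is covered, possibly 1 included; joint measurability of the quantile
  over all levels rests on this.\<close>

lemma quantile_le_iff_general:
  assumes "0 < u" "u \<le> cdf M b"
  shows "quantile M u \<le> a \<longleftrightarrow> u \<le> cdf M a"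
proof
  let ?F = "{y. u \<le> cdf M y}"
  have mono: "mono (cdf M)" by (intro monoI cdf_nondecreasing)
  obtain y where "cdf M y < u"
    by (metis eventually_happens' trivial_limit_at_bot_linorder order_tendstoD(2) cdf_lim_at_bot \<open>0 < u\<close>)
  with mono have bdd: "bdd_below ?F"
    by (auto intro!: bdd_belowI[of _ y] elim: mono_invE[OF _ less_le_trans])
  have ne: "?F \<noteq> {}" using assms by auto
  show "quantile M u \<le> a" if "u \<le> cdf M a"
    using that unfolding quantile_def by (auto intro!: cInf_lower bdd)
  assume *: "quantile M u \<le> a"
  have "u \<le> (INF s\<in>?F. cdf M s)"
    by (rule cINF_greatest[OF ne]) auto
  also have "\<dots> = cdf M (quantile M u)"
    using continuous_at_Inf_mono[OF mono cdf_is_right_cont ne bdd] by (simp add: quantile_def)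
  also have "\<dots> \<le> cdf M a"
    using * by (rule cdf_nondecreasing)
  finally show "u \<le> cdf M a" .
qed

lemma quantile_le_iff:
  assumes "0 < u" "u < 1"
  shows "quantile M u \<le> a \<longleftrightarrow> u \<le> cdf M a"
proof -
  obtain b where "u < cdf M b"
    by (metis eventually_happens' trivial_limit_at_top_linorder order_tendstoD(1) cdf_lim_at_top_prob \<open>u < 1\<close>)
  then show ?thesis using quantile_le_iff_general[of u b a] assms by auto
qed

lemma quantile_gt_iff:
  "0 < u \<Longrightarrow> u < 1 \<Longrightarrow> a < quantile M u \<longleftrightarrow> cdf M a < u"
  using quantile_le_iff[of u a] by auto

text \<open>To the left of the quantile the distribution function stays below u, so its left limit
  is at most u, and without an atom this limit is the value. It lets the Knothe-Rosenblatt map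
  recover the level from the point.\<close>

lemma cdf_quantile:
  assumes "0 < u" "u < 1" "measure M {quantile M u} = 0"
  shows "cdf M (quantile M u) = u"
proof (rule antisym)
  let ?q = "quantile M u"
  have "isCont (cdf M) ?q" using assms isCont_cdf by simp
  then have lim: "(cdf M \<longlongrightarrow> cdf M ?q) (at_left ?q)"
    unfolding isCont_def by (rule tendsto_mono[OF at_le[OF subset_UNIV]])
  have "eventually (\<lambda>a. cdf M a \<le> u) (at_left ?q)"
  proof (rule eventually_at_leftI[of "?q - 1"])
    fix a assume "a \<in> {?q - 1<..<?q}"
    then have "\<not> u \<le> cdf M a" using quantile_le_iff[of u a] assms(1,2) by auto
    then show "cdf M a \<le> u" by simp
  qed simp
  then show "cdf M ?q \<le> u"
    by (intro tendsto_upperbound[OF lim]) auto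
  show "u \<le> cdf M ?q" using quantile_le_iff[of u ?q] assms by auto
qed

end

section \<open>Measurable dependence on a kernel\<close>

lemma real_distribution_kernel:
  "\<kappa> \<in> M \<rightarrow>\<^sub>M prob_algebra borel \<Longrightarrow> x \<in> space M \<Longrightarrow> real_distribution (\<kappa> x)"
  by (drule measurable_space) (auto simp: space_prob_algebra real_distribution_def real_distribution_axioms_def)

lemma measurable_cdf_kernel:
  assumes \<kappa>: "\<kappa> \<in> M \<rightarrow>\<^sub>M prob_algebra borel"
  shows "(\<lambda>(x, a). cdf (\<kappa> x) a) \<in> borel_measurable (M \<Otimes>\<^sub>M borel)"
proof -
  have "(\<lambda>z. \<kappa> (fst z)) \<in> M \<Otimes>\<^sub>M borel \<rightarrow>\<^sub>M prob_algebra borel" using \<kappa> by measurable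
  then have 1: "(\<lambda>z. \<kappa> (fst z)) \<in> M \<Otimes>\<^sub>M borel \<rightarrow>\<^sub>M subprob_algebra borel"
    by (rule measurable_prob_algebraD)
  have "(\<lambda>z. measure (\<kappa> (fst z)) {.. snd z}) \<in> borel_measurable (M \<Otimes>\<^sub>M (borel::real measure))"
  proof (rule measure_measurable_subprob_algebra2[OF _ 1])
    have "{p \<in> space ((M \<Otimes>\<^sub>M (borel::real measure)) \<Otimes>\<^sub>M (borel::real measure)). snd p \<le> snd (fst p)}
        \<in> sets ((M \<Otimes>\<^sub>M borel) \<Otimes>\<^sub>M borel)"
      by (rule borel_measurable_le[OF measurable_snd])
         (rule measurable_compose[OF measurable_fst measurable_snd])
    also have "{p \<in> space ((M \<Otimes>\<^sub>M (borel::real measure)) \<Otimes>\<^sub>M (borel::real measure)). snd p \<le> snd (fst p)}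
        = (SIGMA z:space (M \<Otimes>\<^sub>M borel). {..snd z})"
      by (rule set_eqI) (simp add: space_pair_measure mem_Times_iff mem_Sigma_iff split_paired_all)
    finally show "(SIGMA z:space (M \<Otimes>\<^sub>M (borel::real measure)). {..snd z}) \<in> sets ((M \<Otimes>\<^sub>M borel) \<Otimes>\<^sub>M borel)" .
  qed
  then show ?thesis by (simp add: cdf_def split_beta')
qed

lemma measurable_quantile_kernel:
  assumes \<kappa>: "\<kappa> \<in> M \<rightarrow>\<^sub>M prob_algebra borel"
  shows "(\<lambda>(x, u). quantile (\<kappa> x) u) \<in> borel_measurable (M \<Otimes>\<^sub>M borel)"
proof (subst borel_measurable_iff_le, intro allI)
  fix a :: real
  have cdf_m: "(\<lambda>z. cdf (\<kappa> (fst z)) b) \<in> borel_measurable (M \<Otimes>\<^sub>M (borel::real measure))" for b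
  proof -
    have "(\<lambda>z. (fst z, b)) \<in> M \<Otimes>\<^sub>M (borel::real measure) \<rightarrow>\<^sub>M M \<Otimes>\<^sub>M (borel::real measure)" by measurable
    from measurable_compose[OF this measurable_cdf_kernel[OF \<kappa>]] show ?thesis by simp
  qed
  \<comment> \<open>The level set is the whole line, an up-set described by the distribution
    function, or empty. \<open>Inf UNIV\<close> and \<open>Inf {}\<close> are unspecified but
    constant, and the middle case becomes measurable by testing natural numbers only.\<close>
  have eq: "quantile (\<kappa> (fst z)) (snd z) \<le> a \<longleftrightarrow>
     (if snd z \<le> 0 then Inf (UNIV::real set) \<le> a
      else if \<exists>n::nat. snd z \<le> cdf (\<kappa> (fst z)) (real n) then snd z \<le> cdf (\<kappa> (fst z)) a
      else Inf ({}::real set) \<le> a)" if z: "z \<in> space (M \<Otimes>\<^sub>M borel)" for z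
  proof -
    interpret real_distribution "\<kappa> (fst z)"
      by (rule real_distribution_kernel[OF \<kappa>]) (use z in \<open>auto simp: space_pair_measure\<close>)
    consider "snd z \<le> 0" | "snd z > 0" "\<exists>n::nat. snd z \<le> cdf (\<kappa> (fst z)) (real n)"
      | "snd z > 0" "\<not> (\<exists>n::nat. snd z \<le> cdf (\<kappa> (fst z)) (real n))" by fastforce
    then show ?thesis
    proof cases
      case 1
      then have "{y. snd z \<le> cdf (\<kappa> (fst z)) y} = UNIV"
        by (auto intro: order_trans[OF _ cdf_nonneg])
      then show ?thesis using 1 by (simp add: quantile_def)
    next
      case 2
      then show ?thesis using quantile_le_iff_general by auto
    next
      case 3
      have "{y. snd z \<le> cdf (\<kappa> (fst z)) y} = {}"
        using 3(2) real_arch_simple cdf_nondecreasing order_trans by blast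
      then show ?thesis using 3 by (simp add: quantile_def)
    qed
  qed
  have "{z \<in> space (M \<Otimes>\<^sub>M borel). (if snd z \<le> 0 then Inf (UNIV::real set) \<le> a
      else if \<exists>n::nat. snd z \<le> cdf (\<kappa> (fst z)) (real n) then snd z \<le> cdf (\<kappa> (fst z)) a
      else Inf ({}::real set) \<le> a)} \<in> sets (M \<Otimes>\<^sub>M (borel::real measure))"
    using cdf_m by measurable
  also have "{z \<in> space (M \<Otimes>\<^sub>M borel). (if snd z \<le> 0 then Inf (UNIV::real set) \<le> a
      else if \<exists>n::nat. snd z \<le> cdf (\<kappa> (fst z)) (real n) then snd z \<le> cdf (\<kappa> (fst z)) a
      else Inf ({}::real set) \<le> a)} =
      {z \<in> space (M \<Otimes>\<^sub>M borel). (case z of (x, u) \<Rightarrow> quantile (\<kappa> x) u) \<le> a}"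
    by (intro Collect_cong conj_cong refl, unfold split_beta', erule eq[symmetric])
  finally show "{w \<in> space (M \<Otimes>\<^sub>M borel). (case w of (x, u) \<Rightarrow> quantile (\<kappa> x) u) \<le> a}
       \<in> sets (M \<Otimes>\<^sub>M borel)" .
qed

lemma (in real_distribution) measurable_quantile [measurable]: "quantile M \<in> borel_measurable borel"
proof -
  have "(\<lambda>_::unit. M) \<in> count_space UNIV \<rightarrow>\<^sub>M prob_algebra borel"
    using events_eq_borel prob_space_axioms by (auto simp: space_prob_algebra)
  from measurable_quantile_kernel[OF this]
  have "(\<lambda>(_::unit, u). quantile M u) \<in> borel_measurable (count_space UNIV \<Otimes>\<^sub>M borel)" .
  from measurable_Pair2[OF this, of "()"] show ?thesis by simp
qed

lemma (in real_distribution) distr_quantile: "distr U01 borel (quantile M) = M"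
proof (rule cdf_unique)
  interpret U: prob_space U01 by (rule prob_space_U01)
  have m: "quantile M \<in> borel_measurable U01" by simp
  show "real_distribution (distr U01 borel (quantile M))" using m by simp
  show "real_distribution M" by (rule real_distribution_axioms)
  show "cdf (distr U01 borel (quantile M)) = cdf M"
  proof
    fix a
    have "emeasure (distr U01 borel (quantile M)) {..a} = emeasure U01 {u. quantile M u \<le> a}"
      using m by (subst emeasure_distr) (auto simp: vimage_def)
    also have "\<dots> = emeasure U01 {.. cdf M a}"
      by (rule emeasure_eq_AE) (use AE_U01 quantile_le_iff in auto)
    also have "\<dots> = ennreal (cdf M a)"
      by (rule emeasure_U01_atMost) (auto simp: cdf_nonneg cdf_bounded_prob)
    finally show "cdf (distr U01 borel (quantile M)) a = cdf M a"
      unfolding cdf_def[of "distr U01 borel (quantile M)"] measure_def by (simp add: cdf_nonneg)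
  qed
qed

section \<open>Transfer and conditional laws\<close>

text \<open>The second side of the rectangles ranges over a generator only, so that for a real
  variable half-lines suffice.\<close>

lemma distr_pair_eqI:
  fixes S :: "nat \<Rightarrow> 'b set"
  assumes "finite_measure P" "finite_measure Q" "sets P = sets (M \<Otimes>\<^sub>M L)" "sets Q = sets (M \<Otimes>\<^sub>M L)"
    and "Int_stable E" "E \<subseteq> Pow (space L)" "sets L = sigma_sets (space L) E" 
    and S: "range S \<subseteq> E" "(\<Union>i. S i) = space L"
    and eq: "\<And>A B. A \<in> sets M \<Longrightarrow> B \<in> E \<Longrightarrow> emeasure P (A \<times> B) = emeasure Q (A \<times> B)"
  shows "P = Q"
proof (rule measure_eqI_generator_eq[where \<Omega>="space M \<times> space L" and A="\<lambda>i. space M \<times> S i"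
      and E="{A \<times> B | A B. A \<in> sets M \<and> B \<in> E}"])
  interpret P: finite_measure P by fact
  show "Int_stable {A \<times> B | A B. A \<in> sets M \<and> B \<in> E}"
  proof (rule Int_stableI, safe)
    fix A B A' B' assume *: "A \<in> sets M" "A' \<in> sets M" "B \<in> E" "B' \<in> E"
    then have "B \<inter> B' \<in> E" using \<open>Int_stable E\<close> by (auto simp: Int_stable_def)
    then show "\<exists>C D. A \<times> B \<inter> A' \<times> B' = C \<times> D \<and> C \<in> sets M \<and> D \<in> E"
      using * by (intro exI[of _ "A \<inter> A'"] exI[of _ "B \<inter> B'"]) auto
  qed
  show "{A \<times> B | A B. A \<in> sets M \<and> B \<in> E} \<subseteq> Pow (space M \<times> space L)"
    using assms(6) sets.sets_into_space by fastforce
  show "range (\<lambda>i. space M \<times> S i) \<subseteq> {A \<times> B | A B. A \<in> sets M \<and> B \<in> E}"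
    using S(1) by auto
  show "(\<Union>i. space M \<times> S i) = space M \<times> space L" using S(2) by auto
  have "sets (M \<Otimes>\<^sub>M L) = sets (sigma (space M) (sets M) \<Otimes>\<^sub>M sigma (space L) E)"
    by (rule sets_pair_measure_cong) (use assms in auto)
  also have "\<dots> = sets (sigma (space M \<times> space L) {A \<times> B | A B. A \<in> sets M \<and> B \<in> E})"
    by (subst sigma_prod[OF _ sets.space_closed _ assms(6)])
       (use S in \<open>auto intro!: exI[of _ "{space M}"] exI[of _ "range S"]\<close>)
  also have "\<dots> = sigma_sets (space M \<times> space L) {A \<times> B | A B. A \<in> sets M \<and> B \<in> E}"
    by (rule sets_measure_of) fact
  finally show "sets P = sigma_sets (space M \<times> space L) {A \<times> B | A B. A \<in> sets M \<and> B \<in> E}"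
    "sets Q = sigma_sets (space M \<times> space L) {A \<times> B | A B. A \<in> sets M \<and> B \<in> E}"
    using assms by auto
  show "emeasure P (space M \<times> S i) \<noteq> \<infinity>" for i by simp
  show "emeasure P X = emeasure Q X" if "X \<in> {A \<times> B | A B. A \<in> sets M \<and> B \<in> E}" for X
    using that eq by auto
qed

text \<open>Test on the set where g < f: there the nonnegative difference f - g has integral 0. The
  finite integral of g makes the subtraction legitimate.\<close>

lemma AE_le_of_set_nn_integral_le:
  assumes "finite_measure D" and [measurable]: "f \<in> borel_measurable D" "g \<in> borel_measurable D"
    and le: "\<And>A. A \<in> sets D \<Longrightarrow> (\<integral>\<^sup>+x\<in>A. f x \<partial>D) \<le> (\<integral>\<^sup>+x\<in>A. g x \<partial>D)"
    and fin: "(\<integral>\<^sup>+x. g x \<partial>D) < \<infinity>"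
  shows "AE x in D. f x \<le> g x"
proof -
  define A where "A = {x\<in>space D. g x < f x}"
  have [measurable]: "A \<in> sets D" unfolding A_def by measurable
  have fin': "(\<integral>\<^sup>+x. g x * indicator A x \<partial>D) \<noteq> \<infinity>"
  proof -
    have "(\<integral>\<^sup>+x. g x * indicator A x \<partial>D) \<le> (\<integral>\<^sup>+x. g x \<partial>D)"
      by (rule nn_integral_mono) (simp add: indicator_def)
    then show ?thesis using fin by (simp add: less_top[symmetric] neq_top_trans)
  qed
  have "(\<integral>\<^sup>+x. f x * indicator A x - g x * indicator A x \<partial>D)
      = (\<integral>\<^sup>+x\<in>A. f x \<partial>D) - (\<integral>\<^sup>+x\<in>A. g x \<partial>D)"
    by (rule nn_integral_diff) (use fin' in \<open>auto simp: A_def indicator_def split: if_splits\<close>)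
  also have "\<dots> = 0" using le[of A] fin' by (simp add: diff_eq_0_iff_ennreal less_top[symmetric] neq_top_trans)
  finally have "AE x in D. f x * indicator A x - g x * indicator A x = 0"
    by (subst (asm) nn_integral_0_iff_AE) auto
  moreover have "AE x in D. g x < \<infinity>"
    using nn_integral_PInf_AE[of g D] fin by (auto simp: less_top)
  ultimately show ?thesis
    using AE_space
  proof eventually_elim
    case (elim x)
    show ?case
    proof (rule ccontr)
      assume "\<not> f x \<le> g x"
      then have "x \<in> A" "g x < f x" using elim by (auto simp: A_def)
      then show False using elim by (auto simp: diff_eq_0_iff_ennreal)
    qed
  qed
qed

text \<open>The sets \<open>E q = {(x, u). u \<le> P(Y \<le> q | X = x)}\<close> for rational \<open>q\<close> generate \<open>\<psi>\<close> as a generalised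
  inverse, without passing through the regularity of a conditional distribution function.\<close>

lemma transfer_real:
  assumes "prob_space P" and X[measurable]: "X \<in> P \<rightarrow>\<^sub>M M" and Y[measurable]: "Y \<in> borel_measurable P"
  obtains \<psi> :: "'c \<times> real \<Rightarrow> real" where "\<psi> \<in> borel_measurable (M \<Otimes>\<^sub>M borel)"
    "distr P (M \<Otimes>\<^sub>M borel) (\<lambda>\<omega>. (X \<omega>, Y \<omega>))
      = distr (distr P M X \<Otimes>\<^sub>M U01) (M \<Otimes>\<^sub>M borel) (\<lambda>z. (fst z, \<psi> z))"
proof -
  interpret P: prob_space P by fact
  interpret U: prob_space U01 by (rule prob_space_U01)
  define D where "D = distr P M X"
  have [simp]: "sets D = sets M" "space D = space M" by (simp_all add: D_def)
  interpret D: prob_space D unfolding D_def by (rule P.prob_space_distr) simp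
  interpret DU: pair_prob_space D U01 ..
  define W where "W = D \<Otimes>\<^sub>M U01"
  have sW[measurable_cong]: "sets W = sets (M \<Otimes>\<^sub>M borel)"
    unfolding W_def by (rule sets_pair_measure_cong) auto
  interpret W: prob_space W unfolding W_def by (rule DU.prob_space_axioms)
  have WD: "distr W D fst = D" unfolding W_def by (rule U.distr_pair_fst)
  have spW: "space W = space M \<times> UNIV" by (simp add: W_def space_pair_measure)
  define Np where "Np q = distr (density P (indicator {\<omega>\<in>space P. Y \<omega> \<le> q})) M X" for q
  have Np: "emeasure (Np q) A = emeasure P {\<omega>\<in>space P. X \<omega> \<in> A \<and> Y \<omega> \<le> q}" if [measurable]: "A \<in> sets M" for A q
  proof -
    have "emeasure (Np q) A = emeasure (density P (indicator {\<omega>\<in>space P. Y \<omega> \<le> q})) (X -` A \<inter> space P)"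
      unfolding Np_def by (subst emeasure_distr) auto
    also have "\<dots> = emeasure P ({\<omega>\<in>space P. Y \<omega> \<le> q} \<inter> (X -` A \<inter> space P))"
      by (subst emeasure_density) (auto simp: indicator_inter_arith[symmetric] nn_integral_indicator[symmetric] simp del: nn_integral_indicator)
    also have "{\<omega>\<in>space P. Y \<omega> \<le> q} \<inter> (X -` A \<inter> space P) = {\<omega>\<in>space P. X \<omega> \<in> A \<and> Y \<omega> \<le> q}" by auto
    finally show ?thesis .
  qed
  define f where "f q = RN_deriv D (Np q)" for q
  have fm[measurable]: "f q \<in> borel_measurable M" for q
    using borel_measurable_RN_deriv[of D "Np q"]
    by (subst measurable_cong_sets[of M D borel borel]) (simp_all add: f_def)
  have fm'[measurable]: "f q \<in> borel_measurable D" for q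
    using fm by (subst measurable_cong_sets[of D M borel borel]) simp_all
  have f: "(\<integral>\<^sup>+x\<in>A. f q x \<partial>D) = emeasure P {\<omega>\<in>space P. X \<omega> \<in> A \<and> Y \<omega> \<le> q}" if [measurable]: "A \<in> sets M" for A q
  proof -
    have ac: "absolutely_continuous D (Np q)"
      unfolding absolutely_continuous_def
    proof
      fix A assume "A \<in> null_sets D"
      then have [measurable]: "A \<in> sets M" and "emeasure D A = 0" by (auto simp: null_sets_def)
      then have "emeasure P (X -` A \<inter> space P) = 0" by (simp add: D_def emeasure_distr)
      moreover have "emeasure P {\<omega>\<in>space P. X \<omega> \<in> A \<and> Y \<omega> \<le> q} \<le> emeasure P (X -` A \<inter> space P)"
        by (rule emeasure_mono) auto
      ultimately show "A \<in> null_sets (Np q)" using Np[of A q] by (auto simp: null_sets_def Np_def)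
    qed
    have "density D (f q) = Np q"
      unfolding f_def by (rule D.density_RN_deriv[OF ac]) (simp add: Np_def)
    then have "emeasure (Np q) A = emeasure (density D (f q)) A" by simp
    also have "\<dots> = (\<integral>\<^sup>+x\<in>A. f q x \<partial>D)" by (subst emeasure_density) auto
    finally show ?thesis using Np[of A q] by simp
  qed
  have f_int: "(\<integral>\<^sup>+x. f q x \<partial>D) < \<infinity>" for q
  proof -
    have "(\<integral>\<^sup>+x. f q x \<partial>D) = (\<integral>\<^sup>+x\<in>space M. f q x \<partial>D)"
      by (rule nn_integral_cong) (simp add: indicator_def)
    then show ?thesis using f[of "space M" q] by (simp add: less_top[symmetric])
  qed
  have fmono: "AE x in D. f q x \<le> f r x" if "q \<le> r" for q r
  proof (rule AE_le_of_set_nn_integral_le[OF D.finite_measure_axioms])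
    fix A assume "A \<in> sets D"
    then have [measurable]: "A \<in> sets M" by simp
    show "(\<integral>\<^sup>+x\<in>A. f q x \<partial>D) \<le> (\<integral>\<^sup>+x\<in>A. f r x \<partial>D)"
      unfolding f[OF \<open>A \<in> sets M\<close>] by (rule emeasure_mono) (use that in auto)
  qed (use f_int in auto)
  have f1: "AE x in D. f q x \<le> 1" for q
  proof (rule AE_le_of_set_nn_integral_le[OF D.finite_measure_axioms])
    fix A assume "A \<in> sets D"
    then have [measurable]: "A \<in> sets M" by simp
    have "(\<integral>\<^sup>+x\<in>A. f q x \<partial>D) \<le> emeasure P (X -` A \<inter> space P)"
      unfolding f[OF \<open>A \<in> sets M\<close>] by (rule emeasure_mono) auto
    then show "(\<integral>\<^sup>+x\<in>A. f q x \<partial>D) \<le> (\<integral>\<^sup>+x\<in>A. 1 \<partial>D)"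
      by (simp add: D_def emeasure_distr)
  qed (use D.emeasure_space_1 in auto)
  define E0 where "E0 q = {z\<in>space W. ennreal (snd z) \<le> f q (fst z)}" for q :: real
  have E0m[measurable]: "E0 q \<in> sets W" for q unfolding E0_def by measurable
  \<comment> \<open>The union over rationals below q forces the sets to be nested everywhere, while
    at a rational q it changes \<open>E0 q\<close> by a null set only.\<close>
  define E where "E q = (\<Union>p\<in>{p::rat. of_rat p \<le> (q::real)}. E0 (of_rat p))" for q
  have Em[measurable]: "E q \<in> sets W" for q unfolding E_def by measurable
  have E_mono: "q \<le> r \<Longrightarrow> E q \<subseteq> E r" for q r unfolding E_def by force
  have E: "emeasure W (E (of_rat q) \<inter> A \<times> UNIV) = emeasure P {\<omega>\<in>space P. X \<omega> \<in> A \<and> Y \<omega> \<le> of_rat q}"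
    if A[measurable]: "A \<in> sets M" for A q
  proof -
    have "AE x in D. \<forall>p::rat. of_rat p \<le> (of_rat q::real) \<longrightarrow> f (of_rat p) x \<le> f (of_rat q) x"
      unfolding AE_all_countable using fmono by auto
    then have "AE z in W. \<forall>p::rat. of_rat p \<le> (of_rat q::real) \<longrightarrow> f (of_rat p) (fst z) \<le> f (of_rat q) (fst z)"
      by (intro AE_distrD[of fst W D], simp add: W_def, subst WD)
    then have "AE z in W. z \<in> E (of_rat q) \<inter> A \<times> UNIV \<longleftrightarrow> z \<in> E0 (of_rat q) \<inter> A \<times> UNIV"
      by eventually_elim (auto simp: E_def E0_def intro: order_trans)
    moreover have AU: "A \<times> (UNIV::real set) \<in> sets W" unfolding sW by measurable
    ultimately have "emeasure W (E (of_rat q) \<inter> A \<times> UNIV) = emeasure W (E0 (of_rat q) \<inter> A \<times> UNIV)"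
      by (intro emeasure_eq_AE) auto
    also have "\<dots> = (\<integral>\<^sup>+x. emeasure U01 (Pair x -` (E0 (of_rat q) \<inter> A \<times> UNIV)) \<partial>D)"
      unfolding W_def by (rule U.emeasure_pair_measure_alt) (unfold W_def[symmetric], intro sets.Int AU E0m)
    also have "\<dots> = (\<integral>\<^sup>+x. min 1 (f (of_rat q) x) * indicator A x \<partial>D)"
    proof (rule nn_integral_cong)
      fix x assume "x \<in> space D"
      then have "Pair x -` (E0 (of_rat q) \<inter> A \<times> UNIV)
          = (if x \<in> A then {u. ennreal u \<le> f (of_rat q) x} else {})"
        by (auto simp: E0_def spW)
      then show "emeasure U01 (Pair x -` (E0 (of_rat q) \<inter> A \<times> UNIV)) = min 1 (f (of_rat q) x) * indicator A x"
        by (simp add: emeasure_U01_ennreal_le del: emeasure_uniform_measure)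
    qed
    also have "\<dots> = (\<integral>\<^sup>+x\<in>A. f (of_rat q) x \<partial>D)"
      by (rule nn_integral_cong_AE) (use f1[of "of_rat q"] in \<open>eventually_elim, auto simp: min_def\<close>)
    finally show ?thesis using f[OF A] by simp
  qed
  \<comment> \<open>The inverse is taken in the extended reals, since z may lie in no
    \<open>E q\<close> or in all of them; both have probability 0, as shown below.\<close>
  define Z where "Z z = (INF q\<in>(UNIV::rat set). if z \<in> E (of_rat q) then ereal (of_rat q) else \<infinity>)" for z
  have Zm[measurable]: "Z \<in> borel_measurable W"
    unfolding Z_def by measurable
  define \<psi> where "\<psi> z = real_of_ereal (Z z)" for z
  have \<psi>m: "\<psi> \<in> borel_measurable W" unfolding \<psi>_def by measurable
  \<comment> \<open>Strict inequality is the one that passes through an infimum, hence open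
    half-lines take the place of the distribution function.\<close>
  have Z_less: "{z\<in>space W. Z z < ereal a} = (\<Union>q\<in>{q::rat. of_rat q < a}. E (of_rat q))" for a
  proof -
    have "E q \<subseteq> space W" for q using sets.sets_into_space[OF Em] .
    moreover have "Z z < ereal a \<longleftrightarrow> (\<exists>q::rat. of_rat q < a \<and> z \<in> E (of_rat q))" for z
      unfolding Z_def INF_less_iff by (auto split: if_splits)
    ultimately show ?thesis by auto
  qed
  have Zlaw: "emeasure W ({z\<in>space W. Z z < ereal a} \<inter> A \<times> UNIV) = emeasure P {\<omega>\<in>space P. X \<omega> \<in> A \<and> Y \<omega> < a}"
    if A[measurable]: "A \<in> sets M" for A a
  proof -
    \<comment> \<open>Dyadic numbers strictly below \<open>a\<close>: subtracting 1 from the ceiling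
      keeps them below even when a is dyadic itself, and halving the mesh never decreases them. They
      must be rational because \<open>E\<close> is controlled at rational levels only.\<close>
    obtain r :: "nat \<Rightarrow> real" where r: "incseq r" "\<And>n. r n < a" "r \<longlonglongrightarrow> a" "\<And>n. r n \<in> \<rat>"
    proof (rule that[of "\<lambda>n. of_int (\<lceil>a * 2^n\<rceil> - 1) / 2^n"])
      show "incseq (\<lambda>n. of_int (\<lceil>a * 2^n\<rceil> - 1) / 2^n :: real)"
      proof (rule incseq_SucI)
        fix n
        have "2 * (\<lceil>x\<rceil> - 1) \<le> \<lceil>2 * x\<rceil> - 1" for x :: real
        proof -
          have "real_of_int (2 * \<lceil>x\<rceil> - 2) < real_of_int \<lceil>2 * x\<rceil>"
            using ceiling_correct[of x] le_of_int_ceiling[of "2 * x"] by (simp del: le_of_int_ceiling)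
          then show ?thesis unfolding of_int_less_iff by simp
        qed
        from this[of "a * 2^n"] have "2 * (\<lceil>a * 2^n\<rceil> - 1) \<le> \<lceil>a * 2^Suc n\<rceil> - 1" by (simp add: ac_simps)
        then have "real_of_int (2 * (\<lceil>a * 2^n\<rceil> - 1)) \<le> real_of_int (\<lceil>a * 2^Suc n\<rceil> - 1)"
          by (rule of_int_le_iff[THEN iffD2])
        then have "real_of_int (2 * (\<lceil>a * 2^n\<rceil> - 1)) / 2^Suc n \<le> of_int (\<lceil>a * 2^Suc n\<rceil> - 1) / 2^Suc n"
          by (rule divide_right_mono) simp
        also have "real_of_int (2 * (\<lceil>a * 2^n\<rceil> - 1)) / 2^Suc n = of_int (\<lceil>a * 2^n\<rceil> - 1) / 2^n"
          by (simp add: field_simps)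
        finally show "of_int (\<lceil>a * 2^n\<rceil> - 1) / 2^n \<le> (of_int (\<lceil>a * 2^Suc n\<rceil> - 1) / 2^Suc n :: real)" .
      qed
      show less: "of_int (\<lceil>a * 2^n\<rceil> - 1) / 2^n < a" for n
        using ceiling_correct[of "a * 2^n"] by (simp add: field_simps)
      show "(\<lambda>n. of_int (\<lceil>a * 2^n\<rceil> - 1) / 2^n) \<longlonglongrightarrow> a"
      proof (rule tendsto_sandwich[where f="\<lambda>n. a - (1/2)^n" and h="\<lambda>_. a"])
        have "a - (1/2)^n \<le> of_int (\<lceil>a * 2^n\<rceil> - 1) / 2^n" for n
          using le_of_int_ceiling[of "a * 2^n"] by (simp add: field_simps power_divide del: le_of_int_ceiling)
        then show "\<forall>\<^sub>F n in sequentially. a - (1/2)^n \<le> of_int (\<lceil>a * 2^n\<rceil> - 1) / 2^n" by simp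
        show "\<forall>\<^sub>F n in sequentially. of_int (\<lceil>a * 2^n\<rceil> - 1) / 2^n \<le> a"
          using less by (simp add: less_imp_le)
        show "(\<lambda>n. a - (1/2)^n) \<longlonglongrightarrow> a"
          using tendsto_diff[OF tendsto_const LIMSEQ_power_zero[of "1/2::real"], of a] by simp
      qed simp
      show "of_int (\<lceil>a * 2^n\<rceil> - 1) / 2^n \<in> (\<rat> :: real set)" for n by simp
    qed
    have "\<forall>n. \<exists>p. r n = of_rat p" using r(4) unfolding Rats_def by blast
    then obtain q where q: "\<And>n. r n = of_rat (q n)" by (auto dest!: choice)
    have 1: "(\<Union>q\<in>{q::rat. of_rat q < a}. E (of_rat q)) = (\<Union>n. E (r n))"
    proof safe
      fix p :: rat and x assume "of_rat p < a" "x \<in> E (of_rat p)"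
      then obtain n where "of_rat p < r n"
        using order_tendstoD(1)[OF r(3), of "of_rat p"] by (auto simp: eventually_sequentially)
      then show "x \<in> (\<Union>n. E (r n))" using E_mono[of "of_rat p" "r n"] \<open>x \<in> _\<close> by auto
    next
      fix x n assume "x \<in> E (r n)"
      then show "x \<in> (\<Union>q\<in>{q::rat. of_rat q < a}. E (of_rat q))"
        using q[of n] r(2)[of n] by (auto intro!: bexI[of _ "q n"])
    qed
    have [measurable]: "A \<times> (UNIV::real set) \<in> sets W" unfolding sW by measurable
    have "emeasure W ({z\<in>space W. Z z < ereal a} \<inter> A \<times> UNIV) = emeasure W (\<Union>n. E (r n) \<inter> A \<times> UNIV)"
      unfolding Z_less 1 by (rule arg_cong[where f="emeasure W"]) auto
    also have "\<dots> = (SUP n. emeasure W (E (r n) \<inter> A \<times> UNIV))"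
    proof (rule SUP_emeasure_incseq[symmetric])
      show "incseq (\<lambda>n. E (r n) \<inter> A \<times> UNIV)"
        by (intro incseq_SucI Int_mono E_mono incseq_SucD[OF r(1)] subset_refl)
    qed auto
    also have "\<dots> = (SUP n. emeasure P {\<omega>\<in>space P. X \<omega> \<in> A \<and> Y \<omega> \<le> r n})"
      using E[OF A] q by simp
    also have "\<dots> = emeasure P (\<Union>n. {\<omega>\<in>space P. X \<omega> \<in> A \<and> Y \<omega> \<le> r n})"
      by (rule SUP_emeasure_incseq) (use r(1) in \<open>auto simp: incseq_def intro: order_trans\<close>)
    also have "(\<Union>n. {\<omega>\<in>space P. X \<omega> \<in> A \<and> Y \<omega> \<le> r n}) = {\<omega>\<in>space P. X \<omega> \<in> A \<and> Y \<omega> < a}"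
    proof safe
      fix \<omega> assume "\<omega> \<in> space P" "X \<omega> \<in> A" "Y \<omega> < a"
      then obtain n where "Y \<omega> < r n"
        using order_tendstoD(1)[OF r(3), of "Y \<omega>"] by (auto simp: eventually_sequentially)
      then show "\<omega> \<in> (\<Union>n. {\<omega>\<in>space P. X \<omega> \<in> A \<and> Y \<omega> \<le> r n})"
        using \<open>\<omega> \<in> space P\<close> \<open>X \<omega> \<in> A\<close> by (auto intro!: exI[of _ n])
    qed (use r(2) in \<open>auto intro: le_less_trans\<close>)
    finally show ?thesis .
  qed
  have Zlaw': "emeasure W {z\<in>space W. Z z < ereal a} = emeasure P {\<omega>\<in>space P. Y \<omega> < a}" for a
  proof -
    have 1: "{z\<in>space W. Z z < ereal a} \<inter> space M \<times> UNIV = {z\<in>space W. Z z < ereal a}"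
      by (auto simp: spW)
    have 2: "{\<omega>\<in>space P. X \<omega> \<in> space M \<and> Y \<omega> < a} = {\<omega>\<in>space P. Y \<omega> < a}"
      using measurable_space[OF X] by auto
    show ?thesis using Zlaw[of "space M" a] unfolding 1 2 by simp
  qed
  \<comment> \<open>Z and Y give the same mass to every open half-line; letting the end point tend
    to \<infinity> and to -\<infinity> transfers the finiteness of Y to Z.\<close>
  have "AE z in W. Z z < \<infinity>"
  proof -
    have "emeasure W {z\<in>space W. Z z < \<infinity>} = emeasure W (\<Union>n. {z\<in>space W. Z z < ereal (real n)})"
    proof (rule arg_cong[where f="emeasure W"], safe)
      fix z assume z: "z \<in> space W" "Z z < \<infinity>"
      obtain n where "Z z < ereal (real n)" using z(2) by (cases "Z z") (use reals_Archimedean2 in auto)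
      then show "z \<in> (\<Union>n. {z\<in>space W. Z z < ereal (real n)})" using z by auto
    qed (auto elim: less_trans)
    also have "\<dots> = (SUP n. emeasure W {z\<in>space W. Z z < ereal (real n)})"
      by (rule SUP_emeasure_incseq[symmetric]) (auto simp: incseq_def intro: less_le_trans)
    also have "\<dots> = (SUP n. emeasure P {\<omega>\<in>space P. Y \<omega> < real n})" by (simp add: Zlaw')
    also have "\<dots> = emeasure P (\<Union>n. {\<omega>\<in>space P. Y \<omega> < real n})"
      by (rule SUP_emeasure_incseq) (auto simp: incseq_def intro: less_le_trans)
    also have "(\<Union>n. {\<omega>\<in>space P. Y \<omega> < real n}) = space P"
      using reals_Archimedean2 by auto
    finally show ?thesis using P.emeasure_space_1
      by (subst W.AE_iff_emeasure_eq_1) auto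
  qed
  moreover have "AE z in W. Z z \<noteq> -\<infinity>"
  proof -
    have "emeasure W {z\<in>space W. Z z = -\<infinity>} \<le> (INF n. emeasure W {z\<in>space W. Z z < ereal (- real n)})"
      by (rule INF_greatest, rule emeasure_mono) auto
    also have "\<dots> = (INF n. emeasure P {\<omega>\<in>space P. Y \<omega> < - real n})" by (simp add: Zlaw')
    also have "\<dots> = emeasure P (\<Inter>n. {\<omega>\<in>space P. Y \<omega> < - real n})"
      by (rule INF_emeasure_decseq) (auto simp: decseq_def intro: less_le_trans)
    also have "(\<Inter>n. {\<omega>\<in>space P. Y \<omega> < - real n}) = {}"
    proof (safe)
      fix \<omega> assume *: "\<omega> \<in> (\<Inter>n. {\<omega>\<in>space P. Y \<omega> < - real n})"
      obtain n where "- Y \<omega> < real n" using reals_Archimedean2 by blast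
      moreover have "Y \<omega> < - real n" using * by auto
      ultimately show "\<omega> \<in> {}" by simp
    qed
    finally show ?thesis by (subst AE_iff_measurable[OF _ refl]) auto
  qed
  ultimately have Zfin: "AE z in W. \<bar>Z z\<bar> \<noteq> \<infinity>" by eventually_elim auto
  show thesis
  proof (rule that)
    show "\<psi> \<in> borel_measurable (M \<Otimes>\<^sub>M borel)" using \<psi>m by (simp cong: measurable_cong_sets)
    then have \<psi>m'[measurable]: "\<psi> \<in> borel_measurable (D \<Otimes>\<^sub>M U01)" by (simp cong: measurable_cong_sets add: sW[symmetric] W_def)
    have pm[measurable]: "(\<lambda>z. (fst z, \<psi> z)) \<in> W \<rightarrow>\<^sub>M M \<Otimes>\<^sub>M borel"
      by (rule measurable_Pair[OF _ \<psi>m]) measurable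
    show "distr P (M \<Otimes>\<^sub>M borel) (\<lambda>\<omega>. (X \<omega>, Y \<omega>))
      = distr (distr P M X \<Otimes>\<^sub>M U01) (M \<Otimes>\<^sub>M borel) (\<lambda>z. (fst z, \<psi> z))"
      unfolding D_def[symmetric] W_def[symmetric]
    proof (rule distr_pair_eqI[where E="range lessThan" and S="\<lambda>n. {..<real n}"])
      show "finite_measure (distr P (M \<Otimes>\<^sub>M borel) (\<lambda>\<omega>. (X \<omega>, Y \<omega>)))"
        by (intro P.finite_measure_distr) measurable
      show "finite_measure (distr W (M \<Otimes>\<^sub>M borel) (\<lambda>z. (fst z, \<psi> z)))"
        by (intro W.finite_measure_distr pm)
      show "Int_stable (range lessThan :: real set set)"
      proof (rule Int_stableI, safe)
        fix x y :: real
        have "{..<x} \<inter> {..<y} = {..<min x y}" by auto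
        then show "{..<x} \<inter> {..<y} \<in> range lessThan" by simp
      qed
      show "sets (borel :: real measure) = sigma_sets (space borel) (range lessThan)"
        unfolding borel_Iio by (simp add: sets_measure_of)
      fix A B assume A[measurable]: "A \<in> sets M" and "B \<in> range (lessThan :: real \<Rightarrow> _)"
      then obtain a where B: "B = {..<a}" by auto
      have "emeasure (distr P (M \<Otimes>\<^sub>M borel) (\<lambda>\<omega>. (X \<omega>, Y \<omega>))) (A \<times> B)
         = emeasure P {\<omega>\<in>space P. X \<omega> \<in> A \<and> Y \<omega> < a}"
        unfolding B by (subst emeasure_distr) (auto intro!: arg_cong[where f="emeasure P"])
      also have "\<dots> = emeasure W ({z\<in>space W. Z z < ereal a} \<inter> A \<times> UNIV)"
        by (rule Zlaw[OF A, symmetric])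
      also have "\<dots> = emeasure W ((\<lambda>z. (fst z, \<psi> z)) -` (A \<times> B) \<inter> space W)"
      proof (rule emeasure_eq_AE)
        show "AE z in W. z \<in> {z\<in>space W. Z z < ereal a} \<inter> A \<times> UNIV \<longleftrightarrow> z \<in> (\<lambda>z. (fst z, \<psi> z)) -` (A \<times> B) \<inter> space W"
          using Zfin by eventually_elim (auto simp: B \<psi>_def)
        show "(\<lambda>z. (fst z, \<psi> z)) -` (A \<times> B) \<inter> space W \<in> sets W"
          using pm by (rule measurable_sets) (simp add: B)
        have [measurable]: "A \<times> (UNIV::real set) \<in> sets W" unfolding sW by measurable
        show "{z\<in>space W. Z z < ereal a} \<inter> A \<times> UNIV \<in> sets W" by measurable
      qed
      also have "\<dots> = emeasure (distr W (M \<Otimes>\<^sub>M borel) (\<lambda>z. (fst z, \<psi> z))) (A \<times> B)"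
        using pm by (subst emeasure_distr) (auto simp: B)
      finally show "emeasure (distr P (M \<Otimes>\<^sub>M borel) (\<lambda>\<omega>. (X \<omega>, Y \<omega>))) (A \<times> B)
        = emeasure (distr W (M \<Otimes>\<^sub>M borel) (\<lambda>z. (fst z, \<psi> z))) (A \<times> B)" .
    qed (auto intro: reals_Archimedean2)
  qed
qed

section \<open>Integrals against joint laws, and regular conditional laws\<close>

lemma nn_integral_pair_law:
  assumes "prob_space P" and X[measurable]: "X \<in> P \<rightarrow>\<^sub>M M" and Y[measurable]: "Y \<in> P \<rightarrow>\<^sub>M L"
    and "sigma_finite_measure Q" and \<psi>: "(\<lambda>z. (fst z, \<psi> z)) \<in> M \<Otimes>\<^sub>M Q \<rightarrow>\<^sub>M M \<Otimes>\<^sub>M L"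
    and eq: "distr P (M \<Otimes>\<^sub>M L) (\<lambda>\<omega>. (X \<omega>, Y \<omega>))
        = distr (distr P M X \<Otimes>\<^sub>M Q) (M \<Otimes>\<^sub>M L) (\<lambda>z. (fst z, \<psi> z))"
    and f[measurable]: "f \<in> borel_measurable (M \<Otimes>\<^sub>M L)"
  shows "(\<integral>\<^sup>+\<omega>. f (X \<omega>, Y \<omega>) \<partial>P) = (\<integral>\<^sup>+x. \<integral>\<^sup>+u. f (x, \<psi> (x, u)) \<partial>Q \<partial>distr P M X)"
proof -
  interpret Q: sigma_finite_measure Q by fact
  have s: "sets (distr P M X \<Otimes>\<^sub>M Q) = sets (M \<Otimes>\<^sub>M Q)" by (rule sets_pair_measure_cong) auto
  have \<psi>'[measurable]: "(\<lambda>z. (fst z, \<psi> z)) \<in> distr P M X \<Otimes>\<^sub>M Q \<rightarrow>\<^sub>M M \<Otimes>\<^sub>M L"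
    using \<psi> by (subst measurable_cong_sets[OF s refl])
  have "(\<integral>\<^sup>+\<omega>. f (X \<omega>, Y \<omega>) \<partial>P) = integral\<^sup>N (distr P (M \<Otimes>\<^sub>M L) (\<lambda>\<omega>. (X \<omega>, Y \<omega>))) f"
    by (subst nn_integral_distr) auto
  also have "\<dots> = (\<integral>\<^sup>+z. f (fst z, \<psi> z) \<partial>(distr P M X \<Otimes>\<^sub>M Q))"
    unfolding eq by (subst nn_integral_distr[OF \<psi>']) simp_all
  also have "\<dots> = (\<integral>\<^sup>+x. \<integral>\<^sup>+u. f (x, \<psi> (x, u)) \<partial>Q \<partial>distr P M X)"
    by (subst Q.nn_integral_fst[symmetric]) (use measurable_compose[OF \<psi>' f] in simp_all)
  finally show ?thesis .
qed

lemma nn_integral_transfer_real: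
  assumes P: "prob_space P" and X[measurable]: "X \<in> P \<rightarrow>\<^sub>M M" and Y[measurable]: "Y \<in> borel_measurable P"
  obtains \<psi> :: "'c \<times> real \<Rightarrow> real" where "\<psi> \<in> borel_measurable (M \<Otimes>\<^sub>M borel)"
    "\<And>f. f \<in> borel_measurable (M \<Otimes>\<^sub>M borel) \<Longrightarrow>
      (\<integral>\<^sup>+\<omega>. f (X \<omega>, Y \<omega>) \<partial>P) = (\<integral>\<^sup>+x. \<integral>\<^sup>+u. f (x, \<psi> (x, u)) \<partial>U01 \<partial>distr P M X)"
proof -
  obtain \<psi> where \<psi>: "\<psi> \<in> borel_measurable (M \<Otimes>\<^sub>M borel)"
    and eq: "distr P (M \<Otimes>\<^sub>M borel) (\<lambda>\<omega>. (X \<omega>, Y \<omega>))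
      = distr (distr P M X \<Otimes>\<^sub>M U01) (M \<Otimes>\<^sub>M borel) (\<lambda>z. (fst z, \<psi> z))"
    by (rule transfer_real[OF P X Y])
  have s: "sets (M \<Otimes>\<^sub>M U01) = sets (M \<Otimes>\<^sub>M borel)" by (rule sets_pair_measure_cong) auto
  have "(\<lambda>z. (fst z, \<psi> z)) \<in> M \<Otimes>\<^sub>M U01 \<rightarrow>\<^sub>M M \<Otimes>\<^sub>M borel"
    unfolding measurable_cong_sets[OF s refl] by (rule measurable_Pair[OF measurable_fst \<psi>])
  from nn_integral_pair_law[OF P X Y prob_space_imp_sigma_finite[OF prob_space_U01] this eq] \<psi> that
  show thesis by blast
qed

text \<open>Pushing the uniform law forward under \<psi>(x, .) gives a probability measure for every
  x, so the kernel is regular without an exceptional set.\<close>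

lemma cond_law_exists:
  fixes Y :: "'a \<Rightarrow> real"
  assumes P: "prob_space P" and X[measurable]: "X \<in> P \<rightarrow>\<^sub>M M" and Y[measurable]: "Y \<in> borel_measurable P"
  shows "\<exists>\<kappa>. is_cond_law P X M Y borel \<kappa>"
proof -
  obtain \<psi> where \<psi>[measurable]: "\<psi> \<in> borel_measurable (M \<Otimes>\<^sub>M borel)"
    and eq: "\<And>f. f \<in> borel_measurable (M \<Otimes>\<^sub>M borel) \<Longrightarrow>
      (\<integral>\<^sup>+\<omega>. f (X \<omega>, Y \<omega>) \<partial>P) = (\<integral>\<^sup>+x. \<integral>\<^sup>+u. f (x, \<psi> (x, u)) \<partial>U01 \<partial>distr P M X)"
    using nn_integral_transfer_real[OF P X Y] by blast
  have \<psi>': "(\<lambda>(x, u). \<psi> (x, u)) \<in> M \<Otimes>\<^sub>M U01 \<rightarrow>\<^sub>M borel"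
    using \<psi> by (simp cong: measurable_cong_sets sets_pair_measure_cong)
  define \<kappa> where "\<kappa> x = distr U01 borel (\<lambda>u. \<psi> (x, u))" for x
  have \<kappa>: "\<kappa> \<in> M \<rightarrow>\<^sub>M prob_algebra borel"
    unfolding \<kappa>_def
    by (rule measurable_distr_prob_space2[OF _ \<psi>']) (simp add: space_prob_algebra prob_space_U01)
  have "emeasure P {\<omega> \<in> space P. X \<omega> \<in> A \<and> Y \<omega> \<in> B} = (\<integral>\<^sup>+ x\<in>A. emeasure (\<kappa> x) B \<partial>distr P M X)"
    if [measurable]: "A \<in> sets M" "B \<in> sets borel" for A B
  proof -
    have "emeasure P {\<omega> \<in> space P. X \<omega> \<in> A \<and> Y \<omega> \<in> B} = (\<integral>\<^sup>+\<omega>. indicator (A \<times> B) (X \<omega>, Y \<omega>) \<partial>P)"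
    proof -
      have "(\<integral>\<^sup>+\<omega>. indicator (A \<times> B) (X \<omega>, Y \<omega>) \<partial>P) = (\<integral>\<^sup>+\<omega>. indicator {\<omega> \<in> space P. X \<omega> \<in> A \<and> Y \<omega> \<in> B} \<omega> \<partial>P)"
        by (rule nn_integral_cong) (simp add: indicator_def)
      also have "\<dots> = emeasure P {\<omega> \<in> space P. X \<omega> \<in> A \<and> Y \<omega> \<in> B}"
        by (rule nn_integral_indicator) measurable
      finally show ?thesis by simp
    qed
    also have "\<dots> = (\<integral>\<^sup>+x. \<integral>\<^sup>+u. indicator (A \<times> B) (x, \<psi> (x, u)) \<partial>U01 \<partial>distr P M X)"
      by (rule eq) measurable
    also have "\<dots> = (\<integral>\<^sup>+ x\<in>A. emeasure (\<kappa> x) B \<partial>distr P M X)"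
    proof (rule nn_integral_cong)
      fix x assume "x \<in> space (distr P M X)"
      then have [measurable]: "(\<lambda>u. \<psi> (x, u)) \<in> borel_measurable U01"
        using measurable_Pair2[OF \<psi>] by simp
      have "(\<integral>\<^sup>+u. indicator (A \<times> B) (x, \<psi> (x, u)) \<partial>U01) = (\<integral>\<^sup>+u. indicator B (\<psi> (x, u)) * indicator A x \<partial>U01)"
        by (rule nn_integral_cong) (auto simp: indicator_def)
      also have "\<dots> = (\<integral>\<^sup>+u. indicator B (\<psi> (x, u)) \<partial>U01) * indicator A x"
        by (rule nn_integral_multc) measurable
      also have "(\<integral>\<^sup>+u. indicator B (\<psi> (x, u)) \<partial>U01) = (\<integral>\<^sup>+y. indicator B y \<partial>\<kappa> x)"
        unfolding \<kappa>_def by (rule nn_integral_distr[symmetric]) measurable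
      also have "\<dots> = emeasure (\<kappa> x) B"
        by (rule nn_integral_indicator) (simp add: \<kappa>_def)
      finally show "(\<integral>\<^sup>+u. indicator (A \<times> B) (x, \<psi> (x, u)) \<partial>U01) = emeasure (\<kappa> x) B * indicator A x" .
    qed
    finally show ?thesis .
  qed
  then have "is_cond_law P X M Y borel \<kappa>" using \<kappa> by (simp add: is_cond_law_def)
  then show ?thesis by blast
qed

text \<open>The defining identity concerns rectangles only. It identifies the joint law with the
  composition of the law of X and the kernel \<open>K\<close>, and composition integrates arbitrary
  nonnegative functions iteratedly.\<close>

lemma nn_integral_cond_law:
  assumes P: "prob_space P" and X[measurable]: "X \<in> P \<rightarrow>\<^sub>M M" and Y[measurable]: "Y \<in> P \<rightarrow>\<^sub>M L"
    and \<kappa>: "is_cond_law P X M Y L \<kappa>" and f[measurable]: "f \<in> borel_measurable (M \<Otimes>\<^sub>M L)"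
  shows "(\<integral>\<^sup>+\<omega>. f (X \<omega>, Y \<omega>) \<partial>P) = (\<integral>\<^sup>+x. \<integral>\<^sup>+y. f (x, y) \<partial>\<kappa> x \<partial>distr P M X)"
proof -
  interpret P: prob_space P by fact
  define D where "D = distr P M X"
  interpret D: prob_space D unfolding D_def by (rule P.prob_space_distr) simp
  have \<kappa>m: "\<kappa> \<in> M \<rightarrow>\<^sub>M prob_algebra L" and \<kappa>law: "\<And>A B. A \<in> sets M \<Longrightarrow> B \<in> sets L \<Longrightarrow>
     emeasure P {\<omega> \<in> space P. X \<omega> \<in> A \<and> Y \<omega> \<in> B} = (\<integral>\<^sup>+ x\<in>A. emeasure (\<kappa> x) B \<partial>D)"
    using \<kappa> by (auto simp: is_cond_law_def D_def)
  define K where "K x = distr (\<kappa> x) (M \<Otimes>\<^sub>M L) (\<lambda>y. (x, y))" for x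
  have K: "K \<in> M \<rightarrow>\<^sub>M prob_algebra (M \<Otimes>\<^sub>M L)"
    unfolding K_def by (rule measurable_distr_prob_space2[OF \<kappa>m]) simp
  have K': "K \<in> D \<rightarrow>\<^sub>M subprob_algebra (M \<Otimes>\<^sub>M L)"
    using measurable_prob_algebraD[OF K] by (simp add: D_def)
  have Kf: "(\<integral>\<^sup>+z. g z \<partial>K x) = (\<integral>\<^sup>+y. g (x, y) \<partial>\<kappa> x)" if "x \<in> space D" "g \<in> borel_measurable (M \<Otimes>\<^sub>M L)" for x and g :: "_ \<Rightarrow> ennreal"
  proof -
    have s: "sets (\<kappa> x) = sets L"
      using measurable_space[OF \<kappa>m, of x] that by (simp add: space_prob_algebra D_def)
    have "(\<lambda>y. (x, y)) \<in> \<kappa> x \<rightarrow>\<^sub>M M \<Otimes>\<^sub>M L"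
      using that(1) by (subst measurable_cong_sets[OF s refl]) (simp add: D_def)
    from nn_integral_distr[OF this, of g] that(2) show ?thesis by (simp add: K_def)
  qed
  have "distr P (M \<Otimes>\<^sub>M L) (\<lambda>\<omega>. (X \<omega>, Y \<omega>)) = D \<bind> K"
  proof (rule distr_pair_eqI[where E="sets L" and S="\<lambda>_. space L"])
    show "finite_measure (distr P (M \<Otimes>\<^sub>M L) (\<lambda>\<omega>. (X \<omega>, Y \<omega>)))"
      by (intro P.finite_measure_distr) measurable
    have "prob_space (D \<bind> K)"
      by (rule D.prob_space_bind[OF _ K'], rule AE_I2)
         (use measurable_space[OF K] in \<open>auto simp: space_prob_algebra D_def\<close>)
    then show "finite_measure (D \<bind> K)" by (simp add: prob_space_def)
    show "sets (D \<bind> K) = sets (M \<Otimes>\<^sub>M L)"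
      by (rule sets_bind) (use subprob_measurableD(2)[OF K'] D.not_empty in auto)
    show "Int_stable (sets L)" by (rule sets.Int_stable)
    show "sets L \<subseteq> Pow (space L)" by (rule sets.space_closed)
    show "sets L = sigma_sets (space L) (sets L)" by (rule sets.sigma_sets_eq[symmetric])
    fix A B assume [measurable]: "A \<in> sets M" "B \<in> sets L"
    have "emeasure (distr P (M \<Otimes>\<^sub>M L) (\<lambda>\<omega>. (X \<omega>, Y \<omega>))) (A \<times> B) = emeasure P {\<omega> \<in> space P. X \<omega> \<in> A \<and> Y \<omega> \<in> B}"
      by (subst emeasure_distr) (auto intro!: arg_cong[where f="emeasure P"])
    also have "\<dots> = (\<integral>\<^sup>+ x\<in>A. emeasure (\<kappa> x) B \<partial>D)" by (rule \<kappa>law) fact+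
    also have "\<dots> = (\<integral>\<^sup>+x. emeasure (K x) (A \<times> B) \<partial>D)"
    proof (rule nn_integral_cong)
      fix x assume x: "x \<in> space D"
      have s: "sets (\<kappa> x) = sets L"
        using measurable_space[OF \<kappa>m, of x] x by (simp add: space_prob_algebra D_def)
      have "emeasure (K x) (A \<times> B) = (\<integral>\<^sup>+z. indicator (A \<times> B) z \<partial>K x)"
        by (rule nn_integral_indicator[symmetric]) (simp add: K_def)
      also have "\<dots> = (\<integral>\<^sup>+y. indicator (A \<times> B) (x, y) \<partial>\<kappa> x)"
        by (rule Kf[OF x]) measurable
      also have "\<dots> = (\<integral>\<^sup>+y. indicator A x * indicator B y \<partial>\<kappa> x)"
        by (rule nn_integral_cong) (simp add: indicator_def)
      also have "\<dots> = indicator A x * emeasure (\<kappa> x) B"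
        using s by (simp add: nn_integral_cmult)
      finally show "emeasure (\<kappa> x) B * indicator A x = emeasure (K x) (A \<times> B)" by (simp add: mult.commute)
    qed
    also have "\<dots> = emeasure (D \<bind> K) (A \<times> B)"
      by (rule emeasure_bind[OF D.not_empty K', symmetric]) measurable
    finally show "emeasure (distr P (M \<Otimes>\<^sub>M L) (\<lambda>\<omega>. (X \<omega>, Y \<omega>))) (A \<times> B) = emeasure (D \<bind> K) (A \<times> B)" .
  qed auto
  moreover have "(\<integral>\<^sup>+\<omega>. f (X \<omega>, Y \<omega>) \<partial>P) = integral\<^sup>N (distr P (M \<Otimes>\<^sub>M L) (\<lambda>\<omega>. (X \<omega>, Y \<omega>))) f"
    by (subst nn_integral_distr) auto
  ultimately have "(\<integral>\<^sup>+\<omega>. f (X \<omega>, Y \<omega>) \<partial>P) = integral\<^sup>N (D \<bind> K) f" by simp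
  also have "\<dots> = (\<integral>\<^sup>+x. \<integral>\<^sup>+z. f z \<partial>K x \<partial>D)"
    by (rule nn_integral_bind[OF f K'])
  also have "\<dots> = (\<integral>\<^sup>+x. \<integral>\<^sup>+y. f (x, y) \<partial>\<kappa> x \<partial>D)"
    by (rule nn_integral_cong) (rule Kf[OF _ f])
  finally show ?thesis unfolding D_def .
qed

text \<open>Right-continuity fills in the irrational points. A countable family of tests allows the
  null sets of the next lemma to be united.\<close>

lemma real_distribution_eqI_rat:
  assumes "real_distribution M1" "real_distribution M2"
    and eq: "\<And>q::rat. cdf M1 (of_rat q) = cdf M2 (of_rat q)"
  shows "M1 = M2"
proof -
  have *: "cdf M a \<le> cdf M' a" if "real_distribution M" "real_distribution M'"
    and eq: "\<And>q::rat. cdf M (of_rat q) = cdf M' (of_rat q)" for M M' a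
  proof -
    interpret M: real_distribution M by fact
    interpret M': real_distribution M' by fact
    have "(cdf M' \<longlongrightarrow> cdf M' a) (at_right a)"
      using M'.cdf_is_right_cont[of a] by (simp add: continuous_within)
    moreover have "eventually (\<lambda>b. cdf M a \<le> cdf M' b) (at_right a)"
    proof (rule eventually_at_rightI[of a "a + 1"])
      fix b assume "b \<in> {a<..<a+1}"
      then obtain q where "a < of_rat q" "of_rat q < b" using of_rat_dense[of a b] by auto
      then show "cdf M a \<le> cdf M' b"
        using M.cdf_nondecreasing[of a "of_rat q"] M'.cdf_nondecreasing[of "of_rat q" b] eq[of q] by simp
    qed simp
    ultimately show ?thesis by (rule tendsto_lowerbound) simp
  qed
  show ?thesis
    by (rule cdf_unique[OF assms(1,2)], rule ext)
       (rule antisym[OF *[OF assms] *[OF assms(2,1) eq[symmetric]]])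
qed

text \<open>\<open>cond_coord\<close> is an arbitrary version, while the constructions below produce
  kernels of their own; this is the bridge between them.\<close>

lemma cond_law_unique:
  assumes P: "prob_space P" and X[measurable]: "X \<in> P \<rightarrow>\<^sub>M M"
    and 1: "is_cond_law P X M Y borel \<kappa>" and 2: "is_cond_law P X M Y borel \<kappa>'"
  shows "AE x in distr P M X. (\<kappa> x :: real measure) = \<kappa>' x"
proof -
  interpret P: prob_space P by fact
  define D where "D = distr P M X"
  interpret D: prob_space D unfolding D_def by (rule P.prob_space_distr) simp
  have m: "\<kappa> \<in> M \<rightarrow>\<^sub>M prob_algebra borel" "\<kappa>' \<in> M \<rightarrow>\<^sub>M prob_algebra borel"
    using 1 2 by (auto simp: is_cond_law_def)
  have le: "AE x in D. emeasure (\<kappa> x) {..q} \<le> emeasure (\<kappa>' x) {..q}"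
    if "is_cond_law P X M Y borel \<kappa>" "is_cond_law P X M Y borel \<kappa>'" for \<kappa> \<kappa>' and q :: real
  proof -
    have m: "\<kappa> \<in> D \<rightarrow>\<^sub>M subprob_algebra borel" "\<kappa>' \<in> D \<rightarrow>\<^sub>M subprob_algebra borel"
      using that measurable_prob_algebraD[of _ M borel] by (auto simp: is_cond_law_def D_def)
    show ?thesis
    proof (rule AE_le_of_set_nn_integral_le[OF D.finite_measure_axioms])
      show "(\<lambda>x. emeasure (\<kappa> x) {..q}) \<in> borel_measurable D" "(\<lambda>x. emeasure (\<kappa>' x) {..q}) \<in> borel_measurable D"
        using measurable_emeasure_kernel[OF m(1), of "{..q}"] measurable_emeasure_kernel[OF m(2), of "{..q}"] by auto
      show "(\<integral>\<^sup>+x\<in>A. emeasure (\<kappa> x) {..q} \<partial>D) \<le> (\<integral>\<^sup>+x\<in>A. emeasure (\<kappa>' x) {..q} \<partial>D)" if "A \<in> sets D" for A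
        using \<open>is_cond_law P X M Y borel \<kappa>\<close> \<open>is_cond_law P X M Y borel \<kappa>'\<close> that by (simp add: is_cond_law_def D_def)
      have "(\<integral>\<^sup>+x. emeasure (\<kappa>' x) {..q} \<partial>D) \<le> (\<integral>\<^sup>+x. 1 \<partial>D)"
        by (rule nn_integral_mono) (intro subprob_space.subprob_emeasure_le_1 subprob_space_kernel[OF m(2)])
      then show "(\<integral>\<^sup>+x. emeasure (\<kappa>' x) {..q} \<partial>D) < \<infinity>"
        using D.emeasure_space_1 by (simp add: order_le_less_trans)
    qed
  qed
  have "AE x in D. \<forall>q::rat. emeasure (\<kappa> x) {..of_rat q} = emeasure (\<kappa>' x) {..of_rat q}"
    unfolding AE_all_countable
  proof
    fix q :: rat
    show "AE x in D. emeasure (\<kappa> x) {..of_rat q} = emeasure (\<kappa>' x) {..of_rat q}"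
      using le[OF 1 2, of "of_rat q"] le[OF 2 1, of "of_rat q"] by eventually_elim (rule antisym)
  qed
  then show ?thesis
    unfolding D_def[symmetric] using AE_space
  proof eventually_elim
    case (elim x)
    then have "x \<in> space M" by (simp add: D_def)
    then show ?case
      by (intro real_distribution_eqI_rat real_distribution_kernel[OF m(1)] real_distribution_kernel[OF m(2)])
         (use elim(1) in \<open>simp_all add: cdf_def measure_def\<close>)
  qed
qed

lemma nn_integral_quantile:
  assumes "real_distribution M" "f \<in> borel_measurable borel"
  shows "(\<integral>\<^sup>+u. f (quantile M u) \<partial>U01) = integral\<^sup>N M f"
proof -
  interpret real_distribution M by fact
  have "integral\<^sup>N (distr U01 borel (quantile M)) f = (\<integral>\<^sup>+u. f (quantile M u) \<partial>U01)"
    by (rule nn_integral_distr) (use assms in auto)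
  then show ?thesis by (simp add: distr_quantile)
qed

lemma distr_PiM_coordinatewise:
  assumes I: "finite I" and M: "\<And>i. i \<in> I \<Longrightarrow> prob_space (M i)"
    and f[measurable]: "\<And>i. i \<in> I \<Longrightarrow> f i \<in> M i \<rightarrow>\<^sub>M L i"
  shows "distr (PiM I M) (PiM I L) (\<lambda>x. \<lambda>i\<in>I. f i (x i)) = PiM I (\<lambda>i. distr (M i) (L i) (f i))"
proof -
  \<comment> \<open>The product locale asks for a probability measure at every index, so both
    families are padded by a point mass outside I.\<close>
  define M' where "M' i = (if i \<in> I then M i else return (count_space UNIV) undefined)" for i
  define L' where "L' i = (if i \<in> I then distr (M i) (L i) (f i) else return (count_space UNIV) undefined)" for i
  have M': "prob_space (M' i)" and L': "prob_space (L' i)" for i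
    using M f by (auto simp: M'_def L'_def intro: prob_space_return prob_space.prob_space_distr)
  interpret M': product_prob_space M' using M' by (simp add: product_prob_space_def product_prob_space_axioms_def product_sigma_finite_def prob_space_imp_sigma_finite)
  interpret L': product_prob_space L' using L' by (simp add: product_prob_space_def product_prob_space_axioms_def product_sigma_finite_def prob_space_imp_sigma_finite)
  have eM: "PiM I M = PiM I M'" by (rule PiM_cong) (auto simp: M'_def)
  have eL: "PiM I (\<lambda>i. distr (M i) (L i) (f i)) = PiM I L'" by (rule PiM_cong) (auto simp: L'_def)
  have m: "(\<lambda>x. \<lambda>i\<in>I. f i (x i)) \<in> PiM I M \<rightarrow>\<^sub>M PiM I L" by measurable
  show ?thesis unfolding eL
  proof (rule L'.PiM_eqI[OF I])
    show "sets (distr (PiM I M) (PiM I L) (\<lambda>x. \<lambda>i\<in>I. f i (x i))) = sets (PiM I L')"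
      by (simp, rule sets_PiM_cong) (auto simp: L'_def)
    fix A assume A: "\<And>i. i \<in> I \<Longrightarrow> A i \<in> sets (L' i)"
    have A': "A i \<in> sets (L i)" if "i \<in> I" for i using A[OF that] that by (simp add: L'_def)
    have pre: "f i -` A i \<inter> space (M i) \<in> sets (M i)" if "i \<in> I" for i
      using f[OF that] A'[OF that] by (rule measurable_sets)
    have "emeasure (distr (PiM I M) (PiM I L) (\<lambda>x. \<lambda>i\<in>I. f i (x i))) (Pi\<^sub>E I A)
      = emeasure (PiM I M) ((\<lambda>x. \<lambda>i\<in>I. f i (x i)) -` Pi\<^sub>E I A \<inter> space (PiM I M))"
      by (rule emeasure_distr[OF m sets_PiM_I_finite[OF I A']])
    also have "(\<lambda>x. \<lambda>i\<in>I. f i (x i)) -` Pi\<^sub>E I A \<inter> space (PiM I M) = (\<Pi>\<^sub>E i\<in>I. f i -` A i \<inter> space (M i))"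
      by (auto simp: space_PiM PiE_iff)
    also have "emeasure (PiM I M) \<dots> = (\<Prod>i\<in>I. emeasure (M' i) (f i -` A i \<inter> space (M i)))"
      unfolding eM by (rule M'.emeasure_PiM[OF I]) (use pre in \<open>auto simp: M'_def\<close>)
    also have "\<dots> = (\<Prod>i\<in>I. emeasure (L' i) (A i))"
      by (rule prod.cong[OF refl]) (auto simp: M'_def L'_def emeasure_distr[OF f A'])
    finally show "emeasure (distr (PiM I M) (PiM I L) (\<lambda>x. \<lambda>i\<in>I. f i (x i))) (Pi\<^sub>E I A) = (\<Prod>i\<in>I. emeasure (L' i) (A i))" .
  qed
qed

section \<open>Optimality of the monotone coupling on the line\<close>

text \<open>\<open>max 0 (x - y - k)\<close> is the length of the set of \<open>s\<close> with \<open>y < s - k\<close> and \<open>s < x\<close>. Integrating over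
  \<open>s\<close> reduces hinge costs to the bound \<open>P(Y < b, X > a) \<ge> P(Y < b) - P(X \<le> a)\<close>, which the monotone
  coupling attains; no moments are needed.\<close>

lemma nn_integral_hinge:
  assumes "sigma_finite_measure P" and X[measurable]: "X \<in> borel_measurable P" and Y[measurable]: "Y \<in> borel_measurable P"
  shows "(\<integral>\<^sup>+\<omega>. ennreal (max 0 (X \<omega> - Y \<omega> - k)) \<partial>P)
    = (\<integral>\<^sup>+s. emeasure P {\<omega>\<in>space P. Y \<omega> < s - k \<and> s < X \<omega>} \<partial>lborel)"
proof -
  interpret P: sigma_finite_measure P by fact
  interpret PL: pair_sigma_finite P "lborel :: real measure" ..
  have "(\<integral>\<^sup>+\<omega>. ennreal (max 0 (X \<omega> - Y \<omega> - k)) \<partial>P)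
    = (\<integral>\<^sup>+\<omega>. \<integral>\<^sup>+s. indicator {Y \<omega> + k<..<X \<omega>} s \<partial>lborel \<partial>P)"
  proof (rule nn_integral_cong)
    fix \<omega>
    show "ennreal (max 0 (X \<omega> - Y \<omega> - k)) = (\<integral>\<^sup>+s. indicator {Y \<omega> + k<..<X \<omega>} s \<partial>lborel)"
      by (cases "Y \<omega> + k \<le> X \<omega>") (simp_all add: max_def algebra_simps)
  qed
  also have "\<dots> = (\<integral>\<^sup>+\<omega>. \<integral>\<^sup>+s. indicator {z. Y (fst z) < snd z - k \<and> snd z < X (fst z)} (\<omega>, s) \<partial>lborel \<partial>P)"
    by (intro nn_integral_cong) (auto simp: indicator_def)
  also have "\<dots> = (\<integral>\<^sup>+\<omega>. \<integral>\<^sup>+s. indicator {z\<in>space (P \<Otimes>\<^sub>M lborel). Y (fst z) < snd z - k \<and> snd z < X (fst z)} (\<omega>, s) \<partial>lborel \<partial>P)"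
    by (intro nn_integral_cong) (auto simp: indicator_def space_pair_measure)
  also have "\<dots> = (\<integral>\<^sup>+s. \<integral>\<^sup>+\<omega>. indicator {z\<in>space (P \<Otimes>\<^sub>M lborel). Y (fst z) < snd z - k \<and> snd z < X (fst z)} (\<omega>, s) \<partial>P \<partial>lborel)"
    by (rule PL.Fubini'[symmetric]) measurable
  also have "\<dots> = (\<integral>\<^sup>+s. \<integral>\<^sup>+\<omega>. indicator {\<omega>\<in>space P. Y \<omega> < s - k \<and> s < X \<omega>} \<omega> \<partial>P \<partial>lborel)"
    by (intro nn_integral_cong) (auto simp: indicator_def space_pair_measure)
  also have "\<dots> = (\<integral>\<^sup>+s. emeasure P {\<omega>\<in>space P. Y \<omega> < s - k \<and> s < X \<omega>} \<partial>lborel)"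
    by (intro nn_integral_cong nn_integral_indicator) measurable
  finally show ?thesis .
qed

lemma emeasure_U01_Ioc_le:
  assumes "0 \<le> a" "b \<le> 1"
  shows "emeasure U01 {a<..b} \<le> ennreal (b - a)"
proof (cases "a \<le> b")
  case True
  then have "{0..1} \<inter> {a<..b} = {a<..b}" using assms by auto
  then show ?thesis using True by (subst emeasure_uniform_measure) (auto simp: divide_ennreal_def)
qed simp

lemma hinge_monotone_coupling_le:
  assumes P: "prob_space P" and X[measurable]: "X \<in> borel_measurable P" and Y[measurable]: "Y \<in> borel_measurable P"
  shows "(\<integral>\<^sup>+u. ennreal (max 0 (quantile (distr P borel X) u - quantile (distr P borel Y) u - k)) \<partial>U01)
    \<le> (\<integral>\<^sup>+\<omega>. ennreal (max 0 (X \<omega> - Y \<omega> - k)) \<partial>P)"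
proof -
  interpret P: prob_space P by fact
  interpret U: prob_space U01 by (rule prob_space_U01)
  interpret A: real_distribution "distr P borel X" by simp
  interpret B: real_distribution "distr P borel Y" by simp
  let ?qX = "quantile (distr P borel X)" and ?qY = "quantile (distr P borel Y)"
  have [measurable]: "?qX \<in> borel_measurable U01" "?qY \<in> borel_measurable U01"
    using A.measurable_quantile B.measurable_quantile by simp_all
  have key: "emeasure U01 {u\<in>space U01. ?qY u < s - k \<and> s < ?qX u} \<le> emeasure P {\<omega>\<in>space P. Y \<omega> < s - k \<and> s < X \<omega>}" for s
  proof -
    define a where "a = measure P {\<omega>\<in>space P. X \<omega> \<le> s}"
    define b where "b = measure P {\<omega>\<in>space P. Y \<omega> < s - k}"
    have a: "cdf (distr P borel X) s = a"
      unfolding cdf_def a_def by (subst measure_distr) (auto intro!: arg_cong[where f="measure P"])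
    have b: "cdf (distr P borel Y) y \<le> b" if "y < s - k" for y
    proof -
      have "cdf (distr P borel Y) y = measure P {\<omega>\<in>space P. Y \<omega> \<le> y}"
        unfolding cdf_def by (subst measure_distr) (auto intro!: arg_cong[where f="measure P"])
      also have "\<dots> \<le> b" unfolding b_def by (rule P.finite_measure_mono) (use that in auto)
      finally show ?thesis .
    qed
    \<comment> \<open>For the monotone coupling the event is contained in an interval of levels: s <
      \<open>?qX u\<close> means that u exceeds P(X \<le> s), and \<open>?qY u\<close> < s - k
      forces u \<le> P(Y < s - k).\<close>
    have "AE u in U01. u \<in> {u\<in>space U01. ?qY u < s - k \<and> s < ?qX u} \<longrightarrow> u \<in> {a<..b}"
      using AE_U01
    proof eventually_elim
      case (elim u)
      show ?case
      proof
        assume *: "u \<in> {u\<in>space U01. ?qY u < s - k \<and> s < ?qX u}"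
        then have "a < u" using A.quantile_gt_iff[of u s] a elim by auto
        moreover have "u \<le> cdf (distr P borel Y) (?qY u)" using B.quantile_le_iff[of u "?qY u"] elim by auto
        ultimately show "u \<in> {a<..b}" using b[of "?qY u"] * by auto
      qed
    qed
    then have "emeasure U01 {u\<in>space U01. ?qY u < s - k \<and> s < ?qX u} \<le> emeasure U01 {a<..b}"
      by (rule emeasure_mono_AE) simp
    also have "\<dots> \<le> ennreal (b - a)"
      by (rule emeasure_U01_Ioc_le) (simp_all add: a_def b_def)
    also have "b - a \<le> measure P {\<omega>\<in>space P. Y \<omega> < s - k \<and> s < X \<omega>}"
    proof -
      have "b \<le> measure P ({\<omega>\<in>space P. Y \<omega> < s - k \<and> s < X \<omega>} \<union> {\<omega>\<in>space P. X \<omega> \<le> s})"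
        unfolding b_def by (rule P.finite_measure_mono) auto
      also have "\<dots> \<le> measure P {\<omega>\<in>space P. Y \<omega> < s - k \<and> s < X \<omega>} + a"
        unfolding a_def by (rule measure_Un_le) auto
      finally show ?thesis by simp
    qed
    finally show ?thesis by (simp add: P.emeasure_eq_measure ennreal_leI)
  qed
  have "(\<integral>\<^sup>+u. ennreal (max 0 (?qX u - ?qY u - k)) \<partial>U01)
     = (\<integral>\<^sup>+s. emeasure U01 {u\<in>space U01. ?qY u < s - k \<and> s < ?qX u} \<partial>lborel)"
    by (rule nn_integral_hinge) (simp_all add: prob_space_imp_sigma_finite prob_space_U01)
  also have "\<dots> \<le> (\<integral>\<^sup>+s. emeasure P {\<omega>\<in>space P. Y \<omega> < s - k \<and> s < X \<omega>} \<partial>lborel)"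
    by (rule nn_integral_mono) (rule key)
  also have "\<dots> = (\<integral>\<^sup>+\<omega>. ennreal (max 0 (X \<omega> - Y \<omega> - k)) \<partial>P)"
    by (rule nn_integral_hinge[symmetric]) (simp_all add: P.sigma_finite_measure_axioms)
  finally show ?thesis .
qed

text \<open>Measurability and nonnegativity belong to the predicate because the costs having it are
  to be added up and passed to limits: constants and hinges generate the convex costs needed later,
  and integrals of nonnegative functions add without finiteness conditions.\<close>

definition monotone_optimal :: "'a measure \<Rightarrow> ('a \<Rightarrow> real) \<Rightarrow> ('a \<Rightarrow> real) \<Rightarrow> (real \<Rightarrow> real) \<Rightarrow> bool" where
  "monotone_optimal P X Y h \<longleftrightarrow> h \<in> borel_measurable borel \<and> (\<forall>z. 0 \<le> h z) \<and>
     (\<integral>\<^sup>+u. ennreal (h (quantile (distr P borel X) u - quantile (distr P borel Y) u)) \<partial>U01)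
       \<le> (\<integral>\<^sup>+\<omega>. ennreal (h (X \<omega> - Y \<omega>)) \<partial>P)"

text \<open>Convexity at the point b of [a, z], solved for the value at z.\<close>

lemma convex_extrapolation:
  fixes f :: "real \<Rightarrow> real"
  assumes "convex_on UNIV f" "a < b" "b \<le> z"
  shows "f a + (f b - f a) / (b - a) * (z - a) \<le> f z"
proof -
  have "f b \<le> (f z - f a) / (z - a) * (b - a) + f a"
    by (rule convex_onD_Icc'[of a z]) (use assms in \<open>auto intro: convex_on_subset\<close>)
  then have "(f b - f a) * (z - a) \<le> (f z - f a) * (b - a)"
    using assms by (simp add: field_simps)
  then show ?thesis using assms by (simp add: field_simps)
qed

context
  fixes P :: "'a measure" and X Y :: "'a \<Rightarrow> real"
  assumes P: "prob_space P" and X: "X \<in> borel_measurable P" and Y: "Y \<in> borel_measurable P"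
begin

lemma measurable_quantile_distr:
  "quantile (distr P borel X) \<in> borel_measurable U01" "quantile (distr P borel Y) \<in> borel_measurable U01"
proof -
  interpret P: prob_space P by (rule P)
  interpret A: real_distribution "distr P borel X" using X by simp
  interpret B: real_distribution "distr P borel Y" using Y by simp
  show "quantile (distr P borel X) \<in> borel_measurable U01" "quantile (distr P borel Y) \<in> borel_measurable U01"
    using A.measurable_quantile B.measurable_quantile by simp_all
qed

lemma monotone_optimal_add:
  assumes "monotone_optimal P X Y g" "monotone_optimal P X Y h"
  shows "monotone_optimal P X Y (\<lambda>z. g z + h z)"
proof -
  note [measurable] = X Y measurable_quantile_distr
  have [measurable]: "g \<in> borel_measurable borel" "h \<in> borel_measurable borel"
    using assms by (auto simp: monotone_optimal_def)
  show ?thesis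
    using assms by (auto simp: monotone_optimal_def nn_integral_add intro!: add_mono)
qed

lemma monotone_optimal_const: "0 \<le> c \<Longrightarrow> monotone_optimal P X Y (\<lambda>_. c)"
  using prob_space.emeasure_space_1[OF P] prob_space.emeasure_space_1[OF prob_space_U01]
  by (simp add: monotone_optimal_def)

lemma monotone_optimal_hinge:
  assumes "0 \<le> c"
  shows "monotone_optimal P X Y (\<lambda>z. c * max 0 (z - k))"
proof -
  note [measurable] = X Y measurable_quantile_distr
  show ?thesis
    using assms hinge_monotone_coupling_le[OF P X Y, of k]
    by (auto simp: monotone_optimal_def ennreal_mult nn_integral_cmult intro!: mult_left_mono)
qed

text \<open>\<open>f p + G\<close> is the piecewise linear interpolation of \<open>f\<close> on the grid \<open>p + j * \<delta>\<close>, \<open>j \<le> J + 1\<close>, constant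
  to the left of the grid and with its last slope to the right; each step adds one hinge.\<close>

lemma interpolation_monotone_optimal:
  assumes f: "convex_on UNIV f" "mono f" and "0 < \<delta>"
  shows "\<exists>G. monotone_optimal P X Y G \<and> (\<forall>z\<le>p. G z = 0)
    \<and> (\<forall>z\<ge>p + real J * \<delta>. f p + G z = f (p + real J * \<delta>) + (f (p + real (Suc J) * \<delta>) - f (p + real J * \<delta>)) / \<delta> * (z - (p + real J * \<delta>)))
    \<and> (\<forall>z\<ge>p. f p + G z \<le> f (z + \<delta>))
    \<and> (\<forall>z. p \<le> z \<and> z \<le> p + real (Suc J) * \<delta> \<longrightarrow> f (z - \<delta>) \<le> f p + G z)"
proof (induction J)
  define q where "q j = p + real j * \<delta>" for j
  define D where "D j = (f (q (Suc j)) - f (q j)) / \<delta>" for j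
  have q_Suc: "q (Suc j) = q j + \<delta>" for j by (simp add: q_def algebra_simps)
  have D0: "0 \<le> D j" for j
    using f(2) \<open>0 < \<delta>\<close> by (simp add: D_def q_Suc mono_def)
  have Dmono: "D j \<le> D (Suc j)" for j
    using convex_extrapolation[OF f(1), of "q j" "q (Suc j)" "q (Suc (Suc j))"] \<open>0 < \<delta>\<close>
    by (simp add: D_def q_Suc field_simps)
  \<comment> \<open>Shifting by one mesh width puts \<open>z + \<delta>\<close> beyond the right end
    of the chord, so a single inequality serves inside the cell and to the right of it.\<close>
  have step: "f (q j) + D j * (z - q j) \<le> f (z + \<delta>)" if "q j \<le> z" for j z
  proof -
    have "f (q j) + (f (q (Suc j)) - f (q j)) / (q (Suc j) - q j) * (z + \<delta> - q j) \<le> f (z + \<delta>)"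
      by (rule convex_extrapolation[OF f(1)]) (use that \<open>0 < \<delta>\<close> in \<open>auto simp: q_Suc\<close>)
    then have "f (q j) + D j * (z + \<delta> - q j) \<le> f (z + \<delta>)" by (simp add: D_def q_Suc)
    moreover have "D j * (z - q j) \<le> D j * (z + \<delta> - q j)"
      using D0 \<open>0 < \<delta>\<close> by (intro mult_left_mono) auto
    ultimately show ?thesis by simp
  qed
  have step2: "f (z - \<delta>) \<le> f (q j) + D j * (z - q j)" if "q j \<le> z" "z \<le> q (Suc j)" for j z
  proof -
    have "f (z - \<delta>) \<le> f (q j)" using f(2) that by (simp add: mono_def q_Suc)
    moreover have "0 \<le> D j * (z - q j)" using D0 that by simp
    ultimately show ?thesis by simp
  qed
  note eqs = q_def[symmetric] D_def[symmetric]
  {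
    case 0
    have "q 0 = p" by (simp add: q_def)
    let ?G = "\<lambda>z. D 0 * max 0 (z - p)"
    have "monotone_optimal P X Y ?G" by (rule monotone_optimal_hinge[OF D0])
    then show ?case
      unfolding eqs using step[of 0] step2[of 0] \<open>q 0 = p\<close>
      by (intro exI[of _ ?G]) (auto simp: max_def)
  next
    case (Suc J)
    then obtain G where G: "monotone_optimal P X Y G" "\<And>z. z \<le> p \<Longrightarrow> G z = 0"
      "\<And>z. q J \<le> z \<Longrightarrow> f p + G z = f (q J) + D J * (z - q J)"
      "\<And>z. p \<le> z \<Longrightarrow> f p + G z \<le> f (z + \<delta>)"
      "\<And>z. p \<le> z \<Longrightarrow> z \<le> q (Suc J) \<Longrightarrow> f (z - \<delta>) \<le> f p + G z"
      unfolding eqs by blast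
    \<comment> \<open>The weight of the new hinge is the increase of slope, nonnegative by
      convexity. The hinge vanishes up to \<open>q (Suc J)\<close>, so the earlier estimates survive
      there.\<close>
    let ?G = "\<lambda>z. G z + (D (Suc J) - D J) * max 0 (z - q (Suc J))"
    have pq: "p \<le> q (Suc J)" "q J \<le> q (Suc J)" using \<open>0 < \<delta>\<close> by (auto simp: q_def)
    have 1: "monotone_optimal P X Y ?G"
      using Dmono by (intro monotone_optimal_add G(1) monotone_optimal_hinge) simp
    have 2: "f p + ?G z = f (q (Suc J)) + D (Suc J) * (z - q (Suc J))" if "q (Suc J) \<le> z" for z
    proof -
      have "f (q (Suc J)) = f (q J) + D J * (q (Suc J) - q J)"
        using \<open>0 < \<delta>\<close> by (simp add: D_def q_Suc)
      then show ?thesis using G(3)[of z] that pq by (simp add: algebra_simps)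
    qed
    have 3: "?G z = G z" if "z \<le> q (Suc J)" for z using that by simp
    have 4: "f p + ?G z \<le> f (z + \<delta>)" if "p \<le> z" for z
    proof (cases "z \<le> q (Suc J)")
      case True then show ?thesis using G(4)[OF that] 3 by simp
    next
      case False then show ?thesis using step[of "Suc J" z] 2[of z] by simp
    qed
    have 5: "f (z - \<delta>) \<le> f p + ?G z" if "p \<le> z" "z \<le> q (Suc (Suc J))" for z
    proof (cases "z \<le> q (Suc J)")
      case True then show ?thesis using G(5)[OF that(1)] 3 by simp
    next
      case False then show ?thesis using step2[of "Suc J" z] 2[of z] that by simp
    qed
    have 6: "?G z = 0" if "z \<le> p" for z using G(2)[OF that] that pq by simp
    show ?case
      unfolding eqs using 1 2 4 5 6 by (intro exI[of _ ?G]) blast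
  }
qed

text \<open>Interpolating \<open>z \<mapsto> f (z - \<delta>)\<close> instead of \<open>f\<close> gives approximations below \<open>f\<close>, so that Fatou's lemma
  applies on the side of the quantiles and monotonicity on the side of the coupling.\<close>

lemma monotone_optimal_mono_convex:
  assumes f: "convex_on UNIV f" "mono f" and f0: "\<And>z. 0 \<le> f z"
  shows "monotone_optimal P X Y f"
proof -
  note [measurable] = X Y measurable_quantile_distr
  have fc: "continuous_on UNIV f" using f(1) by (intro convex_on_continuous) auto
  then have [measurable]: "f \<in> borel_measurable borel" by (rule borel_measurable_continuous_onI)
  define m where "m = Inf (range f)"
  have bdd: "bdd_below (range f)" using f0 by (auto intro!: bdd_belowI[of _ 0])
  have m: "m \<le> f z" for z unfolding m_def by (rule cINF_lower[OF bdd]) simp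
  have m0: "0 \<le> m" unfolding m_def by (rule cINF_greatest) (use f0 in auto)
  define \<delta> where "\<delta> n = 1 / real (Suc n)" for n
  have \<delta>: "0 < \<delta> n" for n by (simp add: \<delta>_def)
  have "\<exists>G. monotone_optimal P X Y G \<and> (\<forall>z\<le>- real n. G z = 0)
    \<and> (\<forall>z\<ge>- real n. f (- real n - \<delta> n) + G z \<le> f z)
    \<and> (\<forall>z. - real n \<le> z \<and> z \<le> real n \<longrightarrow> f (z - 2 * \<delta> n) \<le> f (- real n - \<delta> n) + G z)" for n
  proof -
    let ?f = "\<lambda>z. f (z - \<delta> n)"
    have c: "convex_on UNIV ?f"
    proof (rule convex_onI)
      fix t x y :: real assume "0 < t" "t < 1"
      have "(1 - t) *\<^sub>R x + t *\<^sub>R y - \<delta> n = (1 - t) *\<^sub>R (x - \<delta> n) + t *\<^sub>R (y - \<delta> n)"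
        by (simp add: algebra_simps)
      then show "f ((1 - t) *\<^sub>R x + t *\<^sub>R y - \<delta> n) \<le> (1 - t) * f (x - \<delta> n) + t * f (y - \<delta> n)"
        using convex_onD[OF f(1), of t "x - \<delta> n" "y - \<delta> n"] \<open>0 < t\<close> \<open>t < 1\<close> by simp
    qed simp
    have mo: "mono ?f" using f(2) by (simp add: mono_def)
    \<comment> \<open>The grid starts at -n with mesh 1/(n+1); 2n(n+1) + 1 cells take it beyond
      n.\<close>
    obtain J :: nat where J: "2 * real n \<le> real (Suc J) * \<delta> n"
    proof
      show "2 * real n \<le> real (Suc (2 * n * Suc n)) * \<delta> n" by (simp add: \<delta>_def field_simps)
    qed
    obtain G where G: "monotone_optimal P X Y G" "\<And>z. z \<le> - real n \<Longrightarrow> G z = 0"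
      "\<And>z. - real n \<le> z \<Longrightarrow> ?f (- real n) + G z \<le> ?f (z + \<delta> n)"
      "\<And>z. - real n \<le> z \<Longrightarrow> z \<le> - real n + real (Suc J) * \<delta> n \<Longrightarrow> ?f (z - \<delta> n) \<le> ?f (- real n) + G z"
      using interpolation_monotone_optimal[OF c mo \<delta>, of "- real n" J] by blast
    show ?thesis
    proof (intro exI[of _ G] conjI allI impI)
      fix z assume "- real n \<le> z \<and> z \<le> real n"
      then show "f (z - 2 * \<delta> n) \<le> f (- real n - \<delta> n) + G z" using G(4)[of z] J by simp
    qed (use G in auto)
  qed
  then obtain G where G: "\<And>n. monotone_optimal P X Y (G n)" "\<And>n z. z \<le> - real n \<Longrightarrow> G n z = 0"
      "\<And>n z. - real n \<le> z \<Longrightarrow> f (- real n - \<delta> n) + G n z \<le> f z"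
      "\<And>n z. - real n \<le> z \<Longrightarrow> z \<le> real n \<Longrightarrow> f (z - 2 * \<delta> n) \<le> f (- real n - \<delta> n) + G n z"
    by metis
  \<comment> \<open>On the grid, \<open>G n\<close> approximates f minus its shifted value at the
    left end. Adding the infimum m instead of that value keeps \<open>g n\<close> below f also to
    the left of -n, where \<open>G n\<close> vanishes; the discrepancy disappears in the limit,
    since a monotone f tends to its infimum at -\<infinity>.\<close>
  define g where "g n z = m + G n z" for n z
  have g: "monotone_optimal P X Y (g n)" for n
    unfolding g_def by (intro monotone_optimal_add monotone_optimal_const m0 G(1))
  have [measurable]: "g n \<in> borel_measurable borel" for n using g by (simp add: monotone_optimal_def)
  have gle: "g n z \<le> f z" for n z
    using m[of z] m[of "- real n - \<delta> n"] G(2)[of z n] G(3)[of n z] by (cases "z \<le> - real n") (auto simp: g_def)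
  have lim: "(\<lambda>n. g n z) \<longlonglongrightarrow> f z" for z
  proof (rule tendsto_sandwich[where f="\<lambda>n. m + f (z - 2 * \<delta> n) - f (- real n - \<delta> n)" and h="\<lambda>_. f z"])
    obtain N where N: "\<bar>z\<bar> \<le> real N" using real_arch_simple by blast
    show "\<forall>\<^sub>F n in sequentially. m + f (z - 2 * \<delta> n) - f (- real n - \<delta> n) \<le> g n z"
      unfolding eventually_sequentially
    proof (intro exI[of _ N] allI impI)
      fix n assume "N \<le> n"
      then have "- real n \<le> z" "z \<le> real n" using N by linarith+
      from G(4)[OF this] show "m + f (z - 2 * \<delta> n) - f (- real n - \<delta> n) \<le> g n z" by (simp add: g_def)
    qed
    show "\<forall>\<^sub>F n in sequentially. g n z \<le> f z" using gle by simp
    have \<delta>0: "\<delta> \<longlonglongrightarrow> 0" unfolding \<delta>_def using lim_1_over_n[where 'a=real] by (rule LIMSEQ_Suc)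
    have fm: "(\<lambda>n. f (- real n - \<delta> n)) \<longlonglongrightarrow> m"
    proof (rule order_tendstoI)
      fix a assume "a < m"
      then show "\<forall>\<^sub>F n in sequentially. a < f (- real n - \<delta> n)" by (intro always_eventually allI less_le_trans[OF _ m])
    next
      fix a assume "m < a"
      then obtain x where x: "f x < a" unfolding m_def using cINF_less_iff[OF _ bdd, of a] by auto
      obtain N where N: "- x \<le> real N" using real_arch_simple by blast
      show "\<forall>\<^sub>F n in sequentially. f (- real n - \<delta> n) < a"
        unfolding eventually_sequentially
      proof (intro exI[of _ N] allI impI)
        fix n assume "N \<le> n"
        then have "- real n - \<delta> n \<le> x" using N \<delta>[of n] by linarith
        then show "f (- real n - \<delta> n) < a" using x f(2) by (meson le_less_trans monoD)
      qed
    qed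
    have "(\<lambda>n. f (z - 2 * \<delta> n)) \<longlonglongrightarrow> f (z - 2 * 0)"
      by (rule continuous_on_tendsto_compose[OF fc]) (intro tendsto_intros \<delta>0, auto)
    then have "(\<lambda>n. m + f (z - 2 * \<delta> n) - f (- real n - \<delta> n)) \<longlonglongrightarrow> m + f (z - 2 * 0) - m"
      by (intro tendsto_intros fm)
    then show "(\<lambda>n. m + f (z - 2 * \<delta> n) - f (- real n - \<delta> n)) \<longlonglongrightarrow> f z" by simp
  qed simp
  let ?q = "\<lambda>u. quantile (distr P borel X) u - quantile (distr P borel Y) u"
  have "(\<integral>\<^sup>+u. ennreal (f (?q u)) \<partial>U01) = (\<integral>\<^sup>+u. liminf (\<lambda>n. ennreal (g n (?q u))) \<partial>U01)"
    by (intro nn_integral_cong lim_imp_Liminf[symmetric] tendsto_ennrealI lim) simp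
  also have "\<dots> \<le> liminf (\<lambda>n. \<integral>\<^sup>+u. ennreal (g n (?q u)) \<partial>U01)"
    by (rule nn_integral_liminf) measurable
  also have "\<dots> \<le> liminf (\<lambda>n. \<integral>\<^sup>+\<omega>. ennreal (f (X \<omega> - Y \<omega>)) \<partial>P)"
  proof (rule Liminf_mono, rule always_eventually, rule allI)
    fix n
    have "(\<integral>\<^sup>+u. ennreal (g n (?q u)) \<partial>U01) \<le> (\<integral>\<^sup>+\<omega>. ennreal (g n (X \<omega> - Y \<omega>)) \<partial>P)"
      using g[of n] by (simp add: monotone_optimal_def)
    also have "\<dots> \<le> (\<integral>\<^sup>+\<omega>. ennreal (f (X \<omega> - Y \<omega>)) \<partial>P)"
      by (intro nn_integral_mono ennreal_leI gle)
    finally show "(\<integral>\<^sup>+u. ennreal (g n (?q u)) \<partial>U01) \<le> (\<integral>\<^sup>+\<omega>. ennreal (f (X \<omega> - Y \<omega>)) \<partial>P)" .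
  qed
  also have "\<dots> = (\<integral>\<^sup>+\<omega>. ennreal (f (X \<omega> - Y \<omega>)) \<partial>P)" by (simp add: Liminf_const)
  finally show ?thesis using f0 by (simp add: monotone_optimal_def)
qed

end

text \<open>The monotone coupling is symmetric in the two laws, so exchanging X and Y only changes
  the sign of the argument of the cost.\<close>

lemma monotone_optimal_reflect:
  "monotone_optimal P Y X (\<lambda>z. h (- z)) \<Longrightarrow> h \<in> borel_measurable borel \<Longrightarrow> monotone_optimal P X Y h"
  unfolding monotone_optimal_def by (simp, metis add.inverse_inverse)

text \<open>To the right of a minimiser a convex function is nondecreasing, and a nondecreasing
  convex function composed with the convex map \<open>\<lambda>z. max z m\<close> is convex.\<close>

lemma convex_on_max_at_minimum:
  fixes h :: "real \<Rightarrow> real"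
  assumes h: "convex_on UNIV h" and m: "\<And>z. h m \<le> h z"
  shows "convex_on UNIV (\<lambda>z. h (max z m))" "mono (\<lambda>z. h (max z m))"
proof -
  have mono: "h x \<le> h y" if "m \<le> x" "x \<le> y" for x y
  proof (cases "m = x")
    case False
    then have "m < y" "m < x" using that by auto
    have "h x \<le> (h y - h m) / (y - m) * (x - m) + h m"
      by (rule convex_onD_Icc'[of m y]) (use that h \<open>m < y\<close> in \<open>auto intro: convex_on_subset\<close>)
    also have "(h y - h m) / (y - m) * (x - m) \<le> (h y - h m) / (y - m) * (y - m)"
      by (rule mult_left_mono) (use that m[of y] \<open>m < y\<close> in auto)
    finally show ?thesis using \<open>m < y\<close> by simp
  qed (use m in auto)
  show "mono (\<lambda>z. h (max z m))" by (rule monoI) (auto intro!: mono simp: max_def)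
  show "convex_on UNIV (\<lambda>z. h (max z m))"
  proof (rule convex_onI)
    fix t x y :: real assume t: "0 < t" "t < 1"
    have "max ((1 - t) *\<^sub>R x + t *\<^sub>R y) m \<le> (1 - t) *\<^sub>R max x m + t *\<^sub>R max y m"
    proof (rule max.boundedI)
      show "(1 - t) *\<^sub>R x + t *\<^sub>R y \<le> (1 - t) *\<^sub>R max x m + t *\<^sub>R max y m"
        using t by (intro add_mono) (auto intro!: mult_left_mono)
      have "m = (1 - t) *\<^sub>R m + t *\<^sub>R m" by (simp add: algebra_simps)
      also have "\<dots> \<le> (1 - t) *\<^sub>R max x m + t *\<^sub>R max y m"
        using t by (intro add_mono) (auto intro!: mult_left_mono)
      finally show "m \<le> (1 - t) *\<^sub>R max x m + t *\<^sub>R max y m" .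
    qed
    then have "h (max ((1 - t) *\<^sub>R x + t *\<^sub>R y) m) \<le> h ((1 - t) *\<^sub>R max x m + t *\<^sub>R max y m)"
      by (intro mono) auto
    also have "\<dots> \<le> (1 - t) * h (max x m) + t * h (max y m)"
      using convex_onD[OF h, of t "max x m" "max y m"] t by simp
    finally show "h (max ((1 - t) *\<^sub>R x + t *\<^sub>R y) m) \<le> (1 - t) * h (max x m) + t * h (max y m)" .
  qed simp
qed

lemma convex_on_reflect:
  fixes h :: "real \<Rightarrow> real"
  assumes h: "convex_on UNIV h"
  shows "convex_on UNIV (\<lambda>z. h (- z))"
proof (rule convex_onI)
  fix t x y :: real assume t: "0 < t" "t < 1"
  have "- ((1 - t) *\<^sub>R x + t *\<^sub>R y) = (1 - t) *\<^sub>R (- x) + t *\<^sub>R (- y)" by simp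
  then show "h (- ((1 - t) *\<^sub>R x + t *\<^sub>R y)) \<le> (1 - t) * h (- x) + t * h (- y)"
    using convex_onD[OF h, of t "- x" "- y"] t by simp
qed simp

lemma convex_between:
  fixes h :: "real \<Rightarrow> real"
  assumes h: "convex_on UNIV h" and "a < b" "b < c" "h a < h b"
  shows "h b \<le> h c"
proof -
  have "h a + (h b - h a) / (b - a) * (c - a) \<le> h c"
    by (rule convex_extrapolation[OF h]) (use assms in auto)
  moreover have "(h b - h a) / (b - a) * (b - a) \<le> (h b - h a) / (b - a) * (c - a)"
    by (rule mult_left_mono) (use assms in \<open>auto intro!: divide_nonneg_nonneg\<close>)
  ultimately show ?thesis using assms by simp
qed

text \<open>A strict descent from a to b and a strict ascent from c to d confine the minimum: left
  of l the function is at least \<open>h a\<close>, right of r at least \<open>h d\<close>, and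
  between l and r compactness provides a minimiser.\<close>

lemma convex_minimum:
  fixes h :: "real \<Rightarrow> real"
  assumes h: "convex_on UNIV h" and "\<not> mono h" "\<not> mono (\<lambda>z. h (- z))"
  obtains m where "\<And>z. h m \<le> h z"
proof -
  obtain a b where ab: "a < b" "h b < h a"
    using assms(2) by (force simp: mono_def not_le less_le)
  obtain c' d' where cd': "c' < d'" "h (- d') < h (- c')"
    using assms(3) by (force simp: mono_def not_le less_le)
  define c d where "c = - d'" and "d = - c'"
  have cd: "c < d" "h c < h d" using cd' by (auto simp: c_def d_def)
  define l r where "l = min a c" and "r = max b d"
  have fc: "continuous_on {l..r} h"
    using h by (intro continuous_on_subset[OF convex_on_continuous[OF open_UNIV h]]) auto
  have "l \<le> r" using ab(1) by (auto simp: l_def r_def)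
  then obtain m where m: "m \<in> {l..r}" "\<And>z. z \<in> {l..r} \<Longrightarrow> h m \<le> h z"
    using continuous_attains_inf[OF compact_Icc _ fc] by auto
  show thesis
  proof (rule that)
    fix z
    consider "z < l" | "z \<in> {l..r}" | "r < z" by fastforce
    then show "h m \<le> h z"
    proof cases
      case 1
      have "h (- (- a)) \<le> h (- (- z))"
        by (rule convex_between[OF convex_on_reflect[OF h], of "- b" "- a" "- z"]) (use ab 1 in \<open>auto simp: l_def\<close>)
      moreover have "h m \<le> h a" by (rule m(2)) (use ab in \<open>auto simp: l_def r_def\<close>)
      ultimately show ?thesis by simp
    next
      case 3
      have "h d \<le> h z"
        by (rule convex_between[OF h, of c d z]) (use cd 3 in \<open>auto simp: r_def\<close>)
      moreover have "h m \<le> h d" by (rule m(2)) (use cd in \<open>auto simp: l_def r_def\<close>)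
      ultimately show ?thesis by simp
    qed (rule m(2))
  qed
qed

lemma monotone_optimal_convex:
  assumes P: "prob_space P" and X: "X \<in> borel_measurable P" and Y: "Y \<in> borel_measurable P"
    and h: "convex_on UNIV h" and h0: "\<And>z. 0 \<le> h z"
  shows "monotone_optimal P X Y h"
proof -
  have "continuous_on UNIV h" using h by (intro convex_on_continuous) auto
  then have hm: "h \<in> borel_measurable borel" by (rule borel_measurable_continuous_onI)
  consider "mono h" | "mono (\<lambda>z. h (- z))" | m where "\<And>z. h m \<le> h z"
    using convex_minimum[OF h] by blast
  then show ?thesis
  proof cases
    case 1
    then show ?thesis by (rule monotone_optimal_mono_convex[OF P X Y h _ h0])
  next
    case 2
    have "monotone_optimal P Y X (\<lambda>z. h (- z))"
      by (rule monotone_optimal_mono_convex[OF P Y X convex_on_reflect[OF h] 2 h0])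
    then show ?thesis by (rule monotone_optimal_reflect) (rule hm)
  next
    case 3
    \<comment> \<open>At the minimiser h splits into the increasing part \<open>h (max z m)\<close>
      and the decreasing part \<open>h (min z m) - h m\<close>; the subtraction avoids counting the
      minimum twice and leaves a nonnegative function.\<close>
    have 1: "monotone_optimal P X Y (\<lambda>z. h (max z m))"
      by (rule monotone_optimal_mono_convex[OF P X Y convex_on_max_at_minimum[OF h 3] h0])
    let ?h = "\<lambda>z. h (- max z (- m))"
    have "\<And>z. h (- (- m)) \<le> h (- z)" using 3 by simp
    note c = convex_on_max_at_minimum[OF convex_on_reflect[OF h] this]
    have "convex_on UNIV (\<lambda>z. ?h z + - h m)"
      using c(1) by (rule convex_on_add) (simp add: convex_on_const)
    moreover have "mono (\<lambda>z. ?h z + - h m)" using c(2) by (simp add: mono_def)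
    ultimately have "monotone_optimal P Y X (\<lambda>z. ?h z + - h m)"
      by (rule monotone_optimal_mono_convex[OF P Y X]) (simp add: 3)
    moreover have "?h z = h (min (- z) m)" for z by (simp add: minus_max_eq_min)
    ultimately have "monotone_optimal P Y X (\<lambda>z. h (min (- z) m) - h m)" by simp
    moreover have "(\<lambda>z. h (min z m) - h m) \<in> borel_measurable borel" using hm by measurable
    ultimately have 2: "monotone_optimal P X Y (\<lambda>z. h (min z m) - h m)"
      by (rule monotone_optimal_reflect)
    have "(\<lambda>z. h (max z m) + (h (min z m) - h m)) = h" by (auto simp: max_def min_def)
    then show ?thesis using monotone_optimal_add[OF P X Y 1 2] by simp
  qed
qed

section \<open>Sequentially constructed laws and causal couplings\<close>

definition hist_law :: "(nat \<Rightarrow> real) measure \<Rightarrow> nat \<Rightarrow> (nat \<Rightarrow> real) measure" where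
  "hist_law \<eta> t = distr \<eta> (RN t) (\<lambda>y. restrict y {1..t})"

lemma sets_hist_law [simp, measurable_cong]: "sets (hist_law \<eta> t) = sets (RN t)"
  by (simp add: hist_law_def)

lemma space_hist_law [simp]: "space (hist_law \<eta> t) = space (RN t)"
  by (simp add: hist_law_def)

lemma measurable_restrict_RN:
  assumes "sets \<eta> = sets (RN n)" "t \<le> n"
  shows "(\<lambda>y. restrict y {1..t}) \<in> \<eta> \<rightarrow>\<^sub>M RN t"
  by (subst measurable_cong_sets[OF assms(1) refl]) (rule measurable_restrict_subset, use assms in auto)

lemma prob_space_hist_law:
  assumes "prob_space \<eta>" "sets \<eta> = sets (RN n)" "t \<le> n"
  shows "prob_space (hist_law \<eta> t)"
  unfolding hist_law_def using assms by (intro prob_space.prob_space_distr measurable_restrict_RN)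

lemma nn_integral_hist_law:
  assumes "sets \<eta> = sets (RN n)" "t \<le> n" "f \<in> borel_measurable (RN t)"
  shows "(\<integral>\<^sup>+y. f y \<partial>hist_law \<eta> t) = (\<integral>\<^sup>+y. f (restrict y {1..t}) \<partial>\<eta>)"
  unfolding hist_law_def by (rule nn_integral_distr) (use assms measurable_restrict_RN in auto)

section \<open>Paths built step by step from independent noise\<close>

lemma measurable_upd_Suc:
  assumes "f \<in> M \<rightarrow>\<^sub>M PiM {1..t} R" "g \<in> M \<rightarrow>\<^sub>M R (Suc t)"
  shows "(\<lambda>x. (f x)(Suc t := g x)) \<in> M \<rightarrow>\<^sub>M PiM {1..Suc t} R"
  by (rule measurable_fun_upd[where J="{1..t}"]) (use assms in \<open>auto simp: atLeastAtMostSuc_conv\<close>)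

lemma nn_integral_PiM_Suc:
  assumes "\<And>i. prob_space (R i)" "f \<in> borel_measurable (PiM {1..Suc t} R)"
  shows "(\<integral>\<^sup>+z. f z \<partial>PiM {1..Suc t} R) = (\<integral>\<^sup>+z. \<integral>\<^sup>+a. f (z(Suc t := a)) \<partial>R (Suc t) \<partial>PiM {1..t} R)"
proof -
  interpret product_prob_space R
    using assms(1) by (simp add: product_prob_space_def product_prob_space_axioms_def product_sigma_finite_def prob_space_imp_sigma_finite)
  have e: "{1..Suc t} = insert (Suc t) {1..t}" by auto
  show ?thesis using assms(2) unfolding e by (intro product_nn_integral_insert) auto
qed

lemma nn_integral_PiM_restrict:
  fixes t n :: nat
  assumes "\<And>i. prob_space (R i)" "t \<le> n" "f \<in> borel_measurable (PiM {1..t} R)"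
  shows "(\<integral>\<^sup>+z. f (restrict z {1..t}) \<partial>PiM {1..n} R) = (\<integral>\<^sup>+z. f z \<partial>PiM {1..t} R)"
proof -
  interpret product_prob_space R "{1..n}"
    using assms(1) by (simp add: product_prob_space_def product_prob_space_axioms_def product_sigma_finite_def prob_space_imp_sigma_finite)
  have "distr (PiM {1..n} R) (PiM {1..t} R) (\<lambda>x. restrict x {1..t}) = PiM {1..t} R"
    by (rule distr_PiM_restrict_finite) (use assms in auto)
  then have "(\<integral>\<^sup>+z. f z \<partial>PiM {1..t} R) = (\<integral>\<^sup>+z. f z \<partial>distr (PiM {1..n} R) (PiM {1..t} R) (\<lambda>x. restrict x {1..t}))"
    by simp
  also have "\<dots> = (\<integral>\<^sup>+z. f (restrict z {1..t}) \<partial>PiM {1..n} R)"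
    by (rule nn_integral_distr) (use assms in \<open>auto intro!: measurable_restrict_subset\<close>)
  finally show ?thesis by simp
qed

text \<open>The noise type is left open because one recursion serves both the rearrangement, driven
  by single uniforms, and the couplings, driven by pairs of a source coordinate and a
  uniform.\<close>

primrec seq_path :: "(nat \<Rightarrow> 'a \<Rightarrow> (nat \<Rightarrow> real) \<Rightarrow> real) \<Rightarrow> (nat \<Rightarrow> 'a) \<Rightarrow> nat \<Rightarrow> (nat \<Rightarrow> real)" where
  "seq_path G z 0 = (\<lambda>_. undefined)"
| "seq_path G z (Suc t) = (seq_path G z t)(Suc t := G (Suc t) (z (Suc t)) (seq_path G z t))"

lemma seq_path_cong:
  "(\<And>s. s \<in> {1..t} \<Longrightarrow> z s = z' s) \<Longrightarrow> seq_path G z t = seq_path G z' t"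
  by (induction t) auto

lemma seq_path_outside: "s \<notin> {1..t} \<Longrightarrow> seq_path G z t s = undefined"
  by (induction t) auto

text \<open>Later steps do not touch earlier coordinates. Together with \<open>seq_path_cong\<close>
  this is adaptedness: the first t coordinates use the first t noises only.\<close>

lemma seq_path_restrict: "t \<le> n \<Longrightarrow> restrict (seq_path G z n) {1..t} = seq_path G z t"
proof (induction n)
  case 0
  then show ?case by (auto simp: restrict_def)
next
  case (Suc n)
  show ?case
  proof (cases "t = Suc n")
    case True
    have "restrict (seq_path G z t) {1..t} s = seq_path G z t s" for s
      using seq_path_outside[of s t G z] unfolding restrict_def by (cases "s \<in> {1..t}") simp_all
    then show ?thesis using True by blast
  next
    case False
    then have "t \<le> n" using Suc by simp
    then have "restrict (seq_path G z (Suc n)) {1..t} = restrict (seq_path G z n) {1..t}"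
      by (intro restrict_ext) auto
    then show ?thesis using Suc.IH \<open>t \<le> n\<close> by metis
  qed
qed

lemma measurable_seq_path:
  assumes G: "\<And>t. t < n \<Longrightarrow> (\<lambda>z. G (Suc t) (fst z) (snd z)) \<in> borel_measurable (R (Suc t) \<Otimes>\<^sub>M RN t)"
  shows "t \<le> n \<Longrightarrow> {1..t} \<subseteq> I \<Longrightarrow> (\<lambda>z. seq_path G z t) \<in> PiM I R \<rightarrow>\<^sub>M RN t"
proof (induction t)
  case 0
  then show ?case by (simp add: space_PiM)
next
  case (Suc t)
  have 1: "(\<lambda>z. seq_path G z t) \<in> PiM I R \<rightarrow>\<^sub>M RN t" by (rule Suc.IH) (use Suc.prems in auto)
  have 2: "(\<lambda>z. z (Suc t)) \<in> PiM I R \<rightarrow>\<^sub>M R (Suc t)"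
    by (rule measurable_component_singleton) (use Suc.prems in auto)
  have "(\<lambda>z. G (Suc t) (z (Suc t)) (seq_path G z t)) \<in> borel_measurable (PiM I R)"
    using measurable_compose[OF measurable_Pair[OF 2 1] G[of t]] Suc.prems by simp
  then show ?case
    unfolding seq_path.simps by (intro measurable_upd_Suc 1)
qed

text \<open>\<open>law\<close> says that drawing \<open>y\<^sub>1, \<dots>, y\<^sub>t\<close> from \<open>\<nu>\<close> and then \<open>y\<^bsub>t+1\<^esub>\<close> by \<open>G (t + 1)\<close> with fresh noise again
  gives the law \<open>\<nu>\<close> of the first \<open>t + 1\<close> coordinates.\<close>

locale sequential_construction =
  fixes N :: nat and R :: "nat \<Rightarrow> 'a measure" and \<nu> :: "(nat \<Rightarrow> real) measure"
    and G :: "nat \<Rightarrow> 'a \<Rightarrow> (nat \<Rightarrow> real) \<Rightarrow> real"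
  assumes R: "\<And>t. prob_space (R t)"
    and \<nu>: "prob_space \<nu>" "sets \<nu> = sets (RN N)"
    and G: "\<And>t. t < N \<Longrightarrow> (\<lambda>z. G (Suc t) (fst z) (snd z)) \<in> borel_measurable (R (Suc t) \<Otimes>\<^sub>M RN t)"
    and law: "\<And>t h. t < N \<Longrightarrow> h \<in> borel_measurable (RN (Suc t)) \<Longrightarrow>
      (\<integral>\<^sup>+y. \<integral>\<^sup>+a. h (y(Suc t := G (Suc t) a y)) \<partial>R (Suc t) \<partial>hist_law \<nu> t) = (\<integral>\<^sup>+y. h y \<partial>hist_law \<nu> (Suc t))"
begin

lemma measurable_path: "t \<le> N \<Longrightarrow> {1..t} \<subseteq> I \<Longrightarrow> (\<lambda>z. seq_path G z t) \<in> PiM I R \<rightarrow>\<^sub>M RN t"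
  by (rule measurable_seq_path[OF G])

lemma measurable_step_integral:
  assumes t: "t < N" and h: "h \<in> borel_measurable (RN (Suc t))"
  shows "(\<lambda>y. \<integral>\<^sup>+a. h (y(Suc t := G (Suc t) a y)) \<partial>R (Suc t)) \<in> borel_measurable (RN t)"
proof -
  interpret R: prob_space "R (Suc t)" by (rule R)
  have "(\<lambda>z. G (Suc t) (snd z) (fst z)) \<in> borel_measurable (RN t \<Otimes>\<^sub>M R (Suc t))"
    using measurable_compose[OF measurable_pair_swap' G[OF t]] by (simp add: split_beta')
  then have "(\<lambda>z. (fst z)(Suc t := G (Suc t) (snd z) (fst z))) \<in> RN t \<Otimes>\<^sub>M R (Suc t) \<rightarrow>\<^sub>M RN (Suc t)"
    by (intro measurable_upd_Suc measurable_fst)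
  from measurable_compose[OF this h] show ?thesis
    by (intro R.borel_measurable_nn_integral) (simp add: split_beta')
qed

lemma nn_integral_path:
  "t \<le> N \<Longrightarrow> f \<in> borel_measurable (RN t) \<Longrightarrow>
    (\<integral>\<^sup>+z. f (seq_path G z t) \<partial>PiM {1..t} R) = (\<integral>\<^sup>+y. f y \<partial>hist_law \<nu> t)"
proof (induction t arbitrary: f)
  case 0
  interpret H: prob_space "hist_law \<nu> 0" by (rule prob_space_hist_law[OF \<nu>]) simp
  interpret P: prob_space "PiM {1..0} R" by (rule prob_space_PiM[OF R])
  have "(\<integral>\<^sup>+y. f y \<partial>hist_law \<nu> 0) = (\<integral>\<^sup>+y. f (\<lambda>_. undefined) \<partial>hist_law \<nu> 0)"
    by (rule nn_integral_cong) (simp add: space_PiM)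
  moreover have "(\<integral>\<^sup>+z. f (seq_path G z 0) \<partial>PiM {1..0} R) = f (\<lambda>_. undefined) * emeasure (PiM {1..0} R) (space (PiM {1..0} R))"
    by simp
  ultimately show ?case using H.emeasure_space_1 P.emeasure_space_1 by simp
next
  case (Suc t)
  have t: "t < N" "t \<le> N" using Suc.prems by auto
  have "(\<lambda>z. f (seq_path G z (Suc t))) \<in> borel_measurable (PiM {1..Suc t} R)"
    by (rule measurable_compose[OF measurable_path Suc.prems(2)]) (use Suc.prems in auto)
  then have "(\<integral>\<^sup>+z. f (seq_path G z (Suc t)) \<partial>PiM {1..Suc t} R)
    = (\<integral>\<^sup>+z. \<integral>\<^sup>+a. f (seq_path G (z(Suc t := a)) (Suc t)) \<partial>R (Suc t) \<partial>PiM {1..t} R)"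
    by (rule nn_integral_PiM_Suc[OF R])
  also have "\<dots> = (\<integral>\<^sup>+z. \<integral>\<^sup>+a. f ((seq_path G z t)(Suc t := G (Suc t) a (seq_path G z t))) \<partial>R (Suc t) \<partial>PiM {1..t} R)"
  proof -
    have "seq_path G (z(Suc t := a)) t = seq_path G z t" for z a by (rule seq_path_cong) auto
    then show ?thesis by simp
  qed
  also have "\<dots> = (\<integral>\<^sup>+y. \<integral>\<^sup>+a. f (y(Suc t := G (Suc t) a y)) \<partial>R (Suc t) \<partial>hist_law \<nu> t)"
    by (rule Suc.IH[OF t(2) measurable_step_integral[OF t(1) Suc.prems(2)]])
  also have "\<dots> = (\<integral>\<^sup>+y. f y \<partial>hist_law \<nu> (Suc t))"
    by (rule law[OF t(1) Suc.prems(2)])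
  finally show ?case .
qed

text \<open>The path up to t is a function of the first t noises, hence independent of the noise of
  the next step.\<close>

lemma nn_integral_noise_path:
  assumes t: "t < N" and f: "f \<in> borel_measurable (R (Suc t) \<Otimes>\<^sub>M RN t)"
  shows "(\<integral>\<^sup>+z. f (z (Suc t), seq_path G z t) \<partial>PiM {1..N} R) = (\<integral>\<^sup>+y. \<integral>\<^sup>+a. f (a, y) \<partial>R (Suc t) \<partial>hist_law \<nu> t)"
proof -
  interpret R: prob_space "R (Suc t)" by (rule R)
  have m: "(\<lambda>z. f (z (Suc t), seq_path G z t)) \<in> borel_measurable (PiM {1..Suc t} R)"
    by (rule measurable_compose[OF measurable_Pair f], rule measurable_component_singleton, simp,
        rule measurable_path) (use t in auto)
  have f': "(\<lambda>y. \<integral>\<^sup>+a. f (a, y) \<partial>R (Suc t)) \<in> borel_measurable (RN t)"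
    using measurable_compose[OF measurable_pair_swap' f]
    by (intro R.borel_measurable_nn_integral) (simp add: split_beta')
  have "seq_path G (restrict z {1..Suc t}) t = seq_path G z t" for z by (rule seq_path_cong) auto
  then have "(\<integral>\<^sup>+z. f (z (Suc t), seq_path G z t) \<partial>PiM {1..N} R)
      = (\<integral>\<^sup>+z. (\<lambda>z. f (z (Suc t), seq_path G z t)) (restrict z {1..Suc t}) \<partial>PiM {1..N} R)"
    by simp
  also have "\<dots> = (\<integral>\<^sup>+z. f (z (Suc t), seq_path G z t) \<partial>PiM {1..Suc t} R)"
    by (rule nn_integral_PiM_restrict[OF R _ m]) (use t in auto)
  also have "\<dots> = (\<integral>\<^sup>+z. \<integral>\<^sup>+a. f ((z(Suc t := a)) (Suc t), seq_path G (z(Suc t := a)) t) \<partial>R (Suc t) \<partial>PiM {1..t} R)"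
    by (rule nn_integral_PiM_Suc[OF R m])
  also have "\<dots> = (\<integral>\<^sup>+z. \<integral>\<^sup>+a. f (a, seq_path G z t) \<partial>R (Suc t) \<partial>PiM {1..t} R)"
  proof -
    have "seq_path G (z(Suc t := a)) t = seq_path G z t" for z a by (rule seq_path_cong) auto
    then show ?thesis by simp
  qed
  also have "\<dots> = (\<integral>\<^sup>+y. \<integral>\<^sup>+a. f (a, y) \<partial>R (Suc t) \<partial>hist_law \<nu> t)"
    by (rule nn_integral_path) (use t f' in auto)
  finally show ?thesis .
qed

lemma distr_path: "distr (PiM {1..N} R) (RN N) (\<lambda>z. seq_path G z N) = \<nu>"
proof (rule measure_eqI)
  show "sets (distr (PiM {1..N} R) (RN N) (\<lambda>z. seq_path G z N)) = sets \<nu>" using \<nu> by simp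
  have m: "(\<lambda>z. seq_path G z N) \<in> PiM {1..N} R \<rightarrow>\<^sub>M RN N" by (rule measurable_path) auto
  fix A assume "A \<in> sets (distr (PiM {1..N} R) (RN N) (\<lambda>z. seq_path G z N))"
  then have A: "A \<in> sets (RN N)" by simp
  have sp: "space \<nu> = space (RN N)" by (rule sets_eq_imp_space_eq[OF \<nu>(2)])
  have "emeasure (distr (PiM {1..N} R) (RN N) (\<lambda>z. seq_path G z N)) A
      = (\<integral>\<^sup>+z. indicator A (seq_path G z N) \<partial>PiM {1..N} R)"
  proof -
    have "(\<integral>\<^sup>+z. indicator A (seq_path G z N) \<partial>PiM {1..N} R)
      = (\<integral>\<^sup>+y. indicator A y \<partial>distr (PiM {1..N} R) (RN N) (\<lambda>z. seq_path G z N))"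
      by (rule nn_integral_distr[OF m, symmetric]) (use A in simp)
    also have "\<dots> = emeasure (distr (PiM {1..N} R) (RN N) (\<lambda>z. seq_path G z N)) A"
      by (rule nn_integral_indicator) (use A in simp)
    finally show ?thesis by simp
  qed
  also have "\<dots> = (\<integral>\<^sup>+y. indicator A y \<partial>hist_law \<nu> N)"
    by (rule nn_integral_path) (use A in auto)
  also have "\<dots> = (\<integral>\<^sup>+y. indicator A (restrict y {1..N}) \<partial>\<nu>)"
    by (rule nn_integral_hist_law[OF \<nu>(2)]) (use A in auto)
  also have "\<dots> = (\<integral>\<^sup>+y. indicator A y \<partial>\<nu>)"
    by (rule nn_integral_cong) (simp add: sp space_PiM PiE_restrict)
  also have "\<dots> = emeasure \<nu> A" using A \<nu> by simp
  finally show "emeasure (distr (PiM {1..N} R) (RN N) (\<lambda>z. seq_path G z N)) A = emeasure \<nu> A" .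
qed

end

section \<open>Adapted randomised maps give causal couplings\<close>

lemma sets_hist_algebra_iff:
  assumes "t \<le> N"
  shows "B \<in> sets (hist_algebra N t) \<longleftrightarrow> (\<exists>C\<in>sets (RN t). B = (\<lambda>x. restrict x {1..t}) -` C \<inter> space (RN N))"
  unfolding hist_algebra_def
  by (subst sets_vimage_algebra2) (use measurable_space[OF measurable_restrict_RN[OF refl assms]] in auto)

text \<open>Given x, the second component has the law of S(x, v) with v drawn from Q. When S is
  adapted for each fixed v, an event of the first t coordinates keeps its conditional probability if
  the coordinates of x after t are altered, so causality holds at every x.\<close>

lemma causal_couplingI:
  assumes \<alpha>: "prob_space \<alpha>" "sets \<alpha> = sets (RN N)" and Q: "prob_space Q" and \<beta>: "sets \<beta> = sets (RN N)"
    and S: "S \<in> RN N \<Otimes>\<^sub>M Q \<rightarrow>\<^sub>M RN N" and law: "distr (\<alpha> \<Otimes>\<^sub>M Q) (RN N) S = \<beta>"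
    and adapted: "\<And>t x x' v. t \<le> N \<Longrightarrow> (\<And>s. s \<in> {1..t} \<Longrightarrow> x s = x' s) \<Longrightarrow>
       restrict (S (x, v)) {1..t} = restrict (S (x', v)) {1..t}"
  shows "distr (\<alpha> \<Otimes>\<^sub>M Q) (RN N \<Otimes>\<^sub>M RN N) (\<lambda>z. (fst z, S z)) \<in> causal_couplings N \<alpha> \<beta>" (is "?\<gamma> \<in> _")
proof -
  interpret \<alpha>: prob_space \<alpha> by fact
  interpret Q: prob_space Q by fact
  have sp: "space \<alpha> = space (RN N)" by (rule sets_eq_imp_space_eq[OF \<alpha>(2)])
  have sQ: "sets (\<alpha> \<Otimes>\<^sub>M Q) = sets (RN N \<Otimes>\<^sub>M Q)" by (rule sets_pair_measure_cong) (use \<alpha> in auto)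
  have S': "S \<in> \<alpha> \<Otimes>\<^sub>M Q \<rightarrow>\<^sub>M RN N" using S by (subst measurable_cong_sets[OF sQ refl])
  have f': "fst \<in> \<alpha> \<Otimes>\<^sub>M Q \<rightarrow>\<^sub>M RN N" by (subst measurable_cong_sets[OF sQ refl]) simp
  have fS: "(\<lambda>z. (fst z, S z)) \<in> \<alpha> \<Otimes>\<^sub>M Q \<rightarrow>\<^sub>M RN N \<Otimes>\<^sub>M RN N" by (rule measurable_Pair[OF f' S'])
  have sets: "sets ?\<gamma> = sets (\<alpha> \<Otimes>\<^sub>M \<beta>)"
    by (simp, rule sets_pair_measure_cong) (use \<alpha> \<beta> in auto)
  have d1: "distr ?\<gamma> (RN N) fst = \<alpha>"
  proof -
    have "distr ?\<gamma> (RN N) fst = distr (\<alpha> \<Otimes>\<^sub>M Q) (RN N) fst"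
      by (subst distr_distr[OF measurable_fst fS]) (simp add: comp_def)
    also have "\<dots> = distr (\<alpha> \<Otimes>\<^sub>M Q) \<alpha> fst" by (rule distr_cong) (use \<alpha> in auto)
    also have "\<dots> = \<alpha>" by (rule Q.distr_pair_fst)
    finally show ?thesis .
  qed
  have d1': "distr ?\<gamma> \<alpha> fst = \<alpha>"
  proof -
    have "distr ?\<gamma> \<alpha> fst = distr ?\<gamma> (RN N) fst" by (rule distr_cong) (use \<alpha> in auto)
    then show ?thesis using d1 by simp
  qed
  have d2: "distr ?\<gamma> \<beta> snd = \<beta>"
  proof -
    have "distr ?\<gamma> \<beta> snd = distr ?\<gamma> (RN N) snd" by (rule distr_cong) (use \<beta> in auto)
    also have "\<dots> = distr (\<alpha> \<Otimes>\<^sub>M Q) (RN N) S"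
      by (subst distr_distr[OF measurable_snd fS]) (simp add: comp_def)
    finally show ?thesis using law by simp
  qed
  define \<kappa> where "\<kappa> x = distr Q (RN N) (\<lambda>v. S (x, v))" for x
  have Sx: "(\<lambda>v. S (x, v)) \<in> Q \<rightarrow>\<^sub>M RN N" if "x \<in> space (RN N)" for x
    using measurable_Pair2[OF S that] .
  have \<kappa>: "\<kappa> \<in> RN N \<rightarrow>\<^sub>M prob_algebra (RN N)"
    unfolding \<kappa>_def
    by (rule measurable_distr_prob_space2[where M=Q]) (use S in \<open>auto simp: space_prob_algebra Q\<close>)
  have cl: "is_cond_law ?\<gamma> fst (RN N) snd (RN N) \<kappa>"
    unfolding is_cond_law_def
  proof (intro conjI \<kappa> ballI)
    fix A B assume A: "A \<in> sets (RN N)" and B: "B \<in> sets (RN N)"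
    have AB: "A \<times> B \<in> sets (RN N \<Otimes>\<^sub>M RN N)" using A B by auto
    have "{\<omega> \<in> space ?\<gamma>. fst \<omega> \<in> A \<and> snd \<omega> \<in> B} = A \<times> B"
      using sets.sets_into_space[OF A] sets.sets_into_space[OF B] by (auto simp: space_pair_measure)
    then have "emeasure ?\<gamma> {\<omega> \<in> space ?\<gamma>. fst \<omega> \<in> A \<and> snd \<omega> \<in> B}
        = emeasure (\<alpha> \<Otimes>\<^sub>M Q) ((\<lambda>z. (fst z, S z)) -` (A \<times> B) \<inter> space (\<alpha> \<Otimes>\<^sub>M Q))"
      by (simp only: emeasure_distr[OF fS AB])
    also have "\<dots> = (\<integral>\<^sup>+x. emeasure Q (Pair x -` ((\<lambda>z. (fst z, S z)) -` (A \<times> B) \<inter> space (\<alpha> \<Otimes>\<^sub>M Q))) \<partial>\<alpha>)"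
      by (rule Q.emeasure_pair_measure_alt[OF measurable_sets[OF fS AB]])
    also have "\<dots> = (\<integral>\<^sup>+x\<in>A. emeasure (\<kappa> x) B \<partial>\<alpha>)"
    proof (rule nn_integral_cong)
      fix x assume x: "x \<in> space \<alpha>"
      have "Pair x -` ((\<lambda>z. (fst z, S z)) -` (A \<times> B) \<inter> space (\<alpha> \<Otimes>\<^sub>M Q))
         = (if x \<in> A then (\<lambda>v. S (x, v)) -` B \<inter> space Q else {})"
        using x by (auto simp: space_pair_measure)
      moreover have "emeasure (\<kappa> x) B = emeasure Q ((\<lambda>v. S (x, v)) -` B \<inter> space Q)"
        unfolding \<kappa>_def by (rule emeasure_distr[OF Sx B]) (use x sp in auto)
      ultimately show "emeasure Q (Pair x -` ((\<lambda>z. (fst z, S z)) -` (A \<times> B) \<inter> space (\<alpha> \<Otimes>\<^sub>M Q)))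
         = emeasure (\<kappa> x) B * indicator A x" by simp
    qed
    finally show "emeasure ?\<gamma> {\<omega> \<in> space ?\<gamma>. fst \<omega> \<in> A \<and> snd \<omega> \<in> B}
       = (\<integral>\<^sup>+x\<in>A. emeasure (\<kappa> x) B \<partial>distr ?\<gamma> (RN N) fst)" unfolding d1 .
  qed
  have adm: "\<exists>g\<in>borel_measurable (hist_algebra N t). AE x in \<alpha>. measure (\<kappa> x) B = g x"
    if t: "t \<in> {1..N}" and B: "B \<in> sets (hist_algebra N t)" for t B
  proof -
    have tN: "t \<le> N" using t by auto
    obtain C where C: "C \<in> sets (RN t)" "B = (\<lambda>x. restrict x {1..t}) -` C \<inter> space (RN N)"
      using B sets_hist_algebra_iff[OF tN] by auto
    have B': "B \<in> sets (RN N)"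
      unfolding C(2) by (rule measurable_sets[OF measurable_restrict_RN[OF refl tN] C(1)])
    \<comment> \<open>\<open>e\<close> overwrites the coordinates after t by 0 and factors through
      (x_1, ..., x_t); composing the kernel with it yields a history-measurable function with the
      same values on B.\<close>
    define e where "e x = (\<lambda>s\<in>{1..N}. if s \<le> t then restrict x {1..t} s else 0)" for x :: "nat \<Rightarrow> real"
    have r: "(\<lambda>x. restrict x {1..t}) \<in> hist_algebra N t \<rightarrow>\<^sub>M RN t"
      unfolding hist_algebra_def
      by (rule measurable_vimage_algebra1) (use measurable_space[OF measurable_restrict_RN[OF refl tN]] in auto)
    have "(\<lambda>y. \<lambda>s\<in>{1..N}. if s \<le> t then y s else 0) \<in> RN t \<rightarrow>\<^sub>M RN N"
    proof (rule measurable_restrict)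
      fix s assume "s \<in> {1..N}"
      then show "(\<lambda>y. if s \<le> t then y s else (0::real)) \<in> RN t \<rightarrow>\<^sub>M borel"
        by (cases "s \<le> t") auto
    qed
    from measurable_compose[OF r this] have em: "e \<in> hist_algebra N t \<rightarrow>\<^sub>M RN N"
      unfolding e_def .
    have "(\<lambda>x. measure (\<kappa> (e x)) B) \<in> borel_measurable (hist_algebra N t)"
      by (rule measurable_compose[OF measurable_compose[OF em \<kappa>] measurable_measure_prob_algebra[OF B']])
    moreover have "measure (\<kappa> x) B = measure (\<kappa> (e x)) B" if x: "x \<in> space \<alpha>" for x
    proof -
      have ex: "e x \<in> space (RN N)" by (auto simp: e_def space_PiM)
      have x': "x \<in> space (RN N)" using x sp by simp
      have "S (x, v) \<in> B \<longleftrightarrow> S (e x, v) \<in> B" if v: "v \<in> space Q" for v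
      proof -
        have "restrict (S (x, v)) {1..t} = restrict (S (e x, v)) {1..t}"
          by (rule adapted[OF tN]) (use tN in \<open>auto simp: e_def\<close>)
        moreover have "S (x, v) \<in> space (RN N)" "S (e x, v) \<in> space (RN N)"
          using measurable_space[OF Sx[OF x'] v] measurable_space[OF Sx[OF ex] v] by auto
        ultimately show ?thesis by (simp add: C(2))
      qed
      then have "(\<lambda>v. S (x, v)) -` B \<inter> space Q = (\<lambda>v. S (e x, v)) -` B \<inter> space Q" by auto
      then show ?thesis
        unfolding \<kappa>_def measure_distr[OF Sx[OF x'] B'] measure_distr[OF Sx[OF ex] B'] by simp
    qed
    ultimately show ?thesis by (intro bexI[of _ "\<lambda>x. measure (\<kappa> (e x)) B"]) auto
  qed
  show ?thesis
    unfolding causal_couplings_def couplings_def mem_Collect_eq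
    using sets d1' d2 cl adm by blast
qed

section \<open>Noise made of source coordinates and uniforms: the forward direction\<close>

lemma measurable_zip:
  "(\<lambda>z. \<lambda>i\<in>I. (fst z i, snd z i)) \<in> PiM I A \<Otimes>\<^sub>M PiM I B \<rightarrow>\<^sub>M PiM I (\<lambda>i. A i \<Otimes>\<^sub>M B i)"
  by (rule measurable_restrict) measurable

lemma measurable_zip_upd:
  fixes t :: nat
  assumes "X \<in> M \<rightarrow>\<^sub>M PiM {1..t} A" "V \<in> M \<rightarrow>\<^sub>M PiM {1..t} B" "a \<in> M \<rightarrow>\<^sub>M A (Suc t)" "b \<in> M \<rightarrow>\<^sub>M B (Suc t)"
  shows "(\<lambda>w. (\<lambda>i\<in>{1..t}. (X w i, V w i))(Suc t := (a w, b w))) \<in> M \<rightarrow>\<^sub>M PiM {1..Suc t} (\<lambda>i. A i \<Otimes>\<^sub>M B i)"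
  using measurable_compose[OF measurable_Pair[OF assms(1,2)] measurable_zip] assms(3,4)
  by (intro measurable_upd_Suc) auto

text \<open>Separates noise given as pairs step by step into one source vector and one independent
  vector of uniforms, the form in which \<open>causal_couplingI\<close> takes its
  randomness.\<close>

lemma nn_integral_PiM_zip:
  fixes t :: nat
  assumes A: "\<And>i. prob_space (A i)" and B: "\<And>i. prob_space (B i)"
  shows "f \<in> borel_measurable (PiM {1..t} (\<lambda>i. A i \<Otimes>\<^sub>M B i)) \<Longrightarrow>
    (\<integral>\<^sup>+x. \<integral>\<^sup>+v. f (\<lambda>i\<in>{1..t}. (x i, v i)) \<partial>PiM {1..t} B \<partial>PiM {1..t} A)
      = (\<integral>\<^sup>+z. f z \<partial>PiM {1..t} (\<lambda>i. A i \<Otimes>\<^sub>M B i))"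
proof (induction t arbitrary: f)
  case 0
  have e: "(\<lambda>i\<in>{1..0::nat}. (x i, v i)) = (\<lambda>_. undefined)" for x v by auto
  interpret PA: prob_space "PiM {1..0::nat} A" by (rule prob_space_PiM[OF A])
  interpret PB: prob_space "PiM {1..0::nat} B" by (rule prob_space_PiM[OF B])
  interpret PC: prob_space "PiM {1..0::nat} (\<lambda>i. A i \<Otimes>\<^sub>M B i)" by (rule prob_space_PiM[OF prob_space_pair[OF A B]])
  have "(\<integral>\<^sup>+z. f z \<partial>PiM {1..0} (\<lambda>i. A i \<Otimes>\<^sub>M B i)) = (\<integral>\<^sup>+z. f (\<lambda>_. undefined) \<partial>PiM {1..0} (\<lambda>i. A i \<Otimes>\<^sub>M B i))"
    by (rule nn_integral_cong) (simp add: space_PiM)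
  then show ?case
    unfolding e nn_integral_const PA.emeasure_space_1 PB.emeasure_space_1 PC.emeasure_space_1 by simp
next
  case (Suc t)
  let ?S = "Suc t"
  let ?C = "\<lambda>i. A i \<Otimes>\<^sub>M B i"
  interpret AS: prob_space "A ?S" by (rule A)
  interpret BS: prob_space "B ?S" by (rule B)
  interpret ABS: pair_prob_space "A ?S" "B ?S" ..
  interpret PA: prob_space "PiM {1..t} A" by (rule prob_space_PiM[OF A])
  interpret PB: prob_space "PiM {1..t} B" by (rule prob_space_PiM[OF B])
  interpret PBS: prob_space "PiM {1..?S} B" by (rule prob_space_PiM[OF B])
  interpret sw: pair_sigma_finite "A ?S" "PiM {1..t} B" ..
  have C: "prob_space (?C i)" for i by (rule prob_space_pair[OF A B])
  have z: "(\<lambda>i\<in>{1..?S}. ((x(?S := a)) i, (v(?S := b)) i)) = (\<lambda>i\<in>{1..t}. (x i, v i))(?S := (a, b))" for x v a b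
    by (auto simp: fun_eq_iff)
  have full: "(\<lambda>w. f (\<lambda>i\<in>{1..?S}. (fst w i, snd w i))) \<in> borel_measurable (PiM {1..?S} A \<Otimes>\<^sub>M PiM {1..?S} B)"
    by (rule measurable_compose[OF measurable_zip Suc.prems])
  have "(\<integral>\<^sup>+x. \<integral>\<^sup>+v. f (\<lambda>i\<in>{1..?S}. (x i, v i)) \<partial>PiM {1..?S} B \<partial>PiM {1..?S} A)
    = (\<integral>\<^sup>+x. \<integral>\<^sup>+a. \<integral>\<^sup>+v. f (\<lambda>i\<in>{1..?S}. ((x(?S := a)) i, v i)) \<partial>PiM {1..?S} B \<partial>A ?S \<partial>PiM {1..t} A)"
    by (rule nn_integral_PiM_Suc[OF A], rule PBS.borel_measurable_nn_integral) (use full in \<open>simp add: split_beta'\<close>)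
  also have "\<dots> = (\<integral>\<^sup>+x. \<integral>\<^sup>+a. \<integral>\<^sup>+v. \<integral>\<^sup>+b. f ((\<lambda>i\<in>{1..t}. (x i, v i))(?S := (a, b))) \<partial>B ?S \<partial>PiM {1..t} B \<partial>A ?S \<partial>PiM {1..t} A)"
  proof (intro nn_integral_cong)
    fix x a assume "x \<in> space (PiM {1..t} A)" "a \<in> space (A ?S)"
    then have "x(?S := a) \<in> space (PiM {1..?S} A)"
      by (auto simp: space_PiM PiE_iff extensional_def)
    from measurable_Pair2[OF full this]
    have "(\<integral>\<^sup>+v. f (\<lambda>i\<in>{1..?S}. ((x(?S := a)) i, v i)) \<partial>PiM {1..?S} B)
      = (\<integral>\<^sup>+v. \<integral>\<^sup>+b. f (\<lambda>i\<in>{1..?S}. ((x(?S := a)) i, (v(?S := b)) i)) \<partial>B ?S \<partial>PiM {1..t} B)"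
      by (intro nn_integral_PiM_Suc[OF B]) simp
    then show "(\<integral>\<^sup>+v. f (\<lambda>i\<in>{1..?S}. ((x(?S := a)) i, v i)) \<partial>PiM {1..?S} B)
      = (\<integral>\<^sup>+v. \<integral>\<^sup>+b. f ((\<lambda>i\<in>{1..t}. (x i, v i))(?S := (a, b))) \<partial>B ?S \<partial>PiM {1..t} B)"
      unfolding z .
  qed
  \<comment> \<open>The last source coordinate has to be moved past the earlier uniforms before it
    can be paired with its own uniform.\<close>
  also have "\<dots> = (\<integral>\<^sup>+x. \<integral>\<^sup>+v. \<integral>\<^sup>+a. \<integral>\<^sup>+b. f ((\<lambda>i\<in>{1..t}. (x i, v i))(?S := (a, b))) \<partial>B ?S \<partial>A ?S \<partial>PiM {1..t} B \<partial>PiM {1..t} A)"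
  proof (rule nn_integral_cong)
    fix x assume x: "x \<in> space (PiM {1..t} A)"
    show "(\<integral>\<^sup>+a. \<integral>\<^sup>+v. \<integral>\<^sup>+b. f ((\<lambda>i\<in>{1..t}. (x i, v i))(?S := (a, b))) \<partial>B ?S \<partial>PiM {1..t} B \<partial>A ?S)
       = (\<integral>\<^sup>+v. \<integral>\<^sup>+a. \<integral>\<^sup>+b. f ((\<lambda>i\<in>{1..t}. (x i, v i))(?S := (a, b))) \<partial>B ?S \<partial>A ?S \<partial>PiM {1..t} B)"
    proof (rule sw.Fubini'[symmetric])
      have "(\<lambda>w. f ((\<lambda>i\<in>{1..t}. (x i, (snd (fst w)) i))(?S := (fst (fst w), snd w)))) \<in> borel_measurable ((A ?S \<Otimes>\<^sub>M PiM {1..t} B) \<Otimes>\<^sub>M B ?S)"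
        by (rule measurable_compose[OF measurable_zip_upd[where X="\<lambda>_. x"] Suc.prems]) (use x in auto)
      then show "(\<lambda>(a, v). \<integral>\<^sup>+b. f ((\<lambda>i\<in>{1..t}. (x i, v i))(?S := (a, b))) \<partial>B ?S) \<in> borel_measurable (A ?S \<Otimes>\<^sub>M PiM {1..t} B)"
        unfolding split_beta' by (intro BS.borel_measurable_nn_integral) (simp add: split_beta')
    qed
  qed
  also have "\<dots> = (\<integral>\<^sup>+x. \<integral>\<^sup>+v. \<integral>\<^sup>+c. f ((\<lambda>i\<in>{1..t}. (x i, v i))(?S := c)) \<partial>?C ?S \<partial>PiM {1..t} B \<partial>PiM {1..t} A)"
  proof (intro nn_integral_cong)
    fix x v assume xv: "x \<in> space (PiM {1..t} A)" "v \<in> space (PiM {1..t} B)"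
    have "(\<lambda>c. f ((\<lambda>i\<in>{1..t}. (x i, v i))(?S := (fst c, snd c)))) \<in> borel_measurable (?C ?S)"
      by (rule measurable_compose[OF measurable_zip_upd[where X="\<lambda>_. x" and V="\<lambda>_. v"] Suc.prems]) (use xv in auto)
    then show "(\<integral>\<^sup>+a. \<integral>\<^sup>+b. f ((\<lambda>i\<in>{1..t}. (x i, v i))(?S := (a, b))) \<partial>B ?S \<partial>A ?S)
       = (\<integral>\<^sup>+c. f ((\<lambda>i\<in>{1..t}. (x i, v i))(?S := c)) \<partial>?C ?S)"
      by (intro BS.nn_integral_fst) simp
  qed
  also have "\<dots> = (\<integral>\<^sup>+z. \<integral>\<^sup>+c. f (z(?S := c)) \<partial>?C ?S \<partial>PiM {1..t} ?C)"
  proof (rule Suc.IH)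
    have "(\<lambda>w. f ((fst w)(?S := snd w))) \<in> borel_measurable (PiM {1..t} ?C \<Otimes>\<^sub>M ?C ?S)"
      by (rule measurable_compose[OF measurable_upd_Suc[OF measurable_fst measurable_snd] Suc.prems])
    then show "(\<lambda>z. \<integral>\<^sup>+c. f (z(?S := c)) \<partial>?C ?S) \<in> borel_measurable (PiM {1..t} ?C)"
      by (intro ABS.borel_measurable_nn_integral) (simp add: split_beta')
  qed
  also have "\<dots> = (\<integral>\<^sup>+z. f z \<partial>PiM {1..?S} ?C)"
    by (rule nn_integral_PiM_Suc[OF C Suc.prems, symmetric])
  finally show ?case .
qed

lemma emeasure_distr_nn_integral:
  assumes "f \<in> M \<rightarrow>\<^sub>M L" "A \<in> sets L"
  shows "emeasure (distr M L f) A = (\<integral>\<^sup>+x. indicator A (f x) \<partial>M)"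
proof -
  have "(\<integral>\<^sup>+x. indicator A (f x) \<partial>M) = (\<integral>\<^sup>+y. indicator A y \<partial>distr M L f)"
    by (rule nn_integral_distr[symmetric]) (use assms in auto)
  then show ?thesis using assms by simp
qed

text \<open>The noise of step \<open>t\<close> is a pair: the source coordinate \<open>x\<^sub>t\<close>, drawn from \<open>m t\<close>, and an independent uniform.\<close>

locale forward_construction = sequential_construction N "\<lambda>t. m t \<Otimes>\<^sub>M U01" \<nu> G
  for N :: nat and m :: "nat \<Rightarrow> real measure" and \<nu> G +
  assumes m: "\<And>t. real_distribution (m t)"
begin

abbreviation "noise t \<equiv> PiM {1..t} (\<lambda>t. m t \<Otimes>\<^sub>M U01)"

definition joint_path :: "nat \<Rightarrow> (nat \<Rightarrow> real \<times> real) \<Rightarrow> (nat \<Rightarrow> real) \<times> (nat \<Rightarrow> real)" where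
  "joint_path t z = (\<lambda>s\<in>{1..t}. fst (z s), seq_path G z t)"

definition coupling :: "((nat \<Rightarrow> real) \<times> (nat \<Rightarrow> real)) measure" where
  "coupling = distr (noise N) (RN N \<Otimes>\<^sub>M RN N) (joint_path N)"

lemma prob_space_m: "prob_space (m t)" and sets_m: "sets (m t) = sets borel"
  using m[of t] by (auto simp: real_distribution_def real_distribution_axioms_def)

lemma measurable_first_path: "t \<le> n \<Longrightarrow> (\<lambda>z. \<lambda>s\<in>{1..t}. fst (z s)) \<in> noise n \<rightarrow>\<^sub>M RN t"
proof (rule measurable_restrict)
  fix s assume "t \<le> n" "s \<in> {1..t}"
  then have "(\<lambda>z. z s) \<in> noise n \<rightarrow>\<^sub>M m s \<Otimes>\<^sub>M U01" by (intro measurable_component_singleton) auto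
  from measurable_compose[OF this measurable_fst] show "(\<lambda>z. fst (z s)) \<in> noise n \<rightarrow>\<^sub>M borel"
    by (simp add: measurable_cong_sets[OF refl sets_m])
qed

lemma measurable_joint_path: "t \<le> N \<Longrightarrow> joint_path t \<in> noise t \<rightarrow>\<^sub>M RN t \<Otimes>\<^sub>M RN t"
  unfolding joint_path_def by (intro measurable_Pair measurable_first_path measurable_path) auto

lemma sets_PiM_m: "sets (PiM {1..N} m) = sets (RN N)"
  by (rule sets_PiM_cong) (simp_all add: sets_m)

text \<open>The path at time t uses only the pairs (x_s, v_s) with s \<le> t, so it is an adapted
  function of x with the uniforms as external randomness.\<close>

lemma coupling_causal: "coupling \<in> causal_couplings N (PiM {1..N} m) \<nu>"
proof -
  let ?Q = "PiM {1..N} (\<lambda>_. U01)" and ?\<alpha> = "PiM {1..N} m"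
  interpret Q: prob_space ?Q by (rule prob_space_PiM[OF prob_space_U01])
  interpret \<alpha>: prob_space ?\<alpha> by (rule prob_space_PiM[OF prob_space_m])
  define S where "S z = seq_path G (\<lambda>i\<in>{1..N}. (fst z i, snd z i)) N" for z
  have sQ: "sets (?\<alpha> \<Otimes>\<^sub>M ?Q) = sets (RN N \<Otimes>\<^sub>M ?Q)"
    by (rule sets_pair_measure_cong[OF sets_PiM_m refl])
  have path: "(\<lambda>z. seq_path G z N) \<in> noise N \<rightarrow>\<^sub>M RN N" by (rule measurable_path) auto
  have S': "S \<in> ?\<alpha> \<Otimes>\<^sub>M ?Q \<rightarrow>\<^sub>M RN N"
    unfolding S_def by (rule measurable_compose[OF measurable_zip path])
  then have S: "S \<in> RN N \<Otimes>\<^sub>M ?Q \<rightarrow>\<^sub>M RN N" by (subst (asm) measurable_cong_sets[OF sQ refl])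
  have f': "fst \<in> ?\<alpha> \<Otimes>\<^sub>M ?Q \<rightarrow>\<^sub>M RN N" by (subst measurable_cong_sets[OF sQ refl]) simp
  have fS: "(\<lambda>z. (fst z, S z)) \<in> ?\<alpha> \<Otimes>\<^sub>M ?Q \<rightarrow>\<^sub>M RN N \<Otimes>\<^sub>M RN N" by (rule measurable_Pair[OF f' S'])
  have jm: "joint_path N \<in> noise N \<rightarrow>\<^sub>M RN N \<Otimes>\<^sub>M RN N" by (rule measurable_joint_path) simp
  have eq: "coupling = distr (?\<alpha> \<Otimes>\<^sub>M ?Q) (RN N \<Otimes>\<^sub>M RN N) (\<lambda>z. (fst z, S z))"
    unfolding coupling_def
  proof (rule measure_eqI)
    fix A assume "A \<in> sets (distr (noise N) (RN N \<Otimes>\<^sub>M RN N) (joint_path N))"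
    then have A: "A \<in> sets (RN N \<Otimes>\<^sub>M RN N)" by simp
    have "emeasure (distr (noise N) (RN N \<Otimes>\<^sub>M RN N) (joint_path N)) A = (\<integral>\<^sup>+z. indicator A (joint_path N z) \<partial>noise N)"
      by (rule emeasure_distr_nn_integral[OF jm A])
    also have "\<dots> = (\<integral>\<^sup>+x. \<integral>\<^sup>+v. indicator A (joint_path N (\<lambda>i\<in>{1..N}. (x i, v i))) \<partial>?Q \<partial>?\<alpha>)"
      by (rule nn_integral_PiM_zip[symmetric, OF prob_space_m prob_space_U01])
         (rule measurable_compose[OF jm borel_measurable_indicator[OF A]])
    also have "\<dots> = (\<integral>\<^sup>+x. \<integral>\<^sup>+v. indicator A (x, S (x, v)) \<partial>?Q \<partial>?\<alpha>)"
    proof (intro nn_integral_cong)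
      fix x and v :: "nat \<Rightarrow> real" assume "x \<in> space ?\<alpha>"
      then have "(\<lambda>s\<in>{1..N}. fst ((\<lambda>i\<in>{1..N}. (x i, v i)) s)) = x"
        by (auto simp: space_PiM PiE_iff extensional_def fun_eq_iff)
      then show "indicator A (joint_path N (\<lambda>i\<in>{1..N}. (x i, v i))) = (indicator A (x, S (x, v)) :: ennreal)"
        unfolding joint_path_def S_def fst_conv snd_conv by metis
    qed
    also have "\<dots> = (\<integral>\<^sup>+z. indicator A (fst z, S z) \<partial>(?\<alpha> \<Otimes>\<^sub>M ?Q))"
      by (subst Q.nn_integral_fst[symmetric])
         (use measurable_compose[OF fS borel_measurable_indicator[OF A]] in simp_all)
    also have "\<dots> = emeasure (distr (?\<alpha> \<Otimes>\<^sub>M ?Q) (RN N \<Otimes>\<^sub>M RN N) (\<lambda>z. (fst z, S z))) A"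
      by (rule emeasure_distr_nn_integral[OF fS A, symmetric])
    finally show "emeasure (distr (noise N) (RN N \<Otimes>\<^sub>M RN N) (joint_path N)) A
      = emeasure (distr (?\<alpha> \<Otimes>\<^sub>M ?Q) (RN N \<Otimes>\<^sub>M RN N) (\<lambda>z. (fst z, S z))) A" .
  qed simp
  have "distr (?\<alpha> \<Otimes>\<^sub>M ?Q) (RN N) S = distr coupling (RN N) snd"
    unfolding eq by (subst distr_distr[OF measurable_snd fS]) (simp add: comp_def)
  also have "\<dots> = distr (noise N) (RN N) (\<lambda>z. seq_path G z N)"
    unfolding coupling_def by (subst distr_distr[OF measurable_snd jm]) (simp add: comp_def joint_path_def)
  also have "\<dots> = \<nu>" by (rule distr_path)
  finally have law: "distr (?\<alpha> \<Otimes>\<^sub>M ?Q) (RN N) S = \<nu>" .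
  show ?thesis unfolding eq
  proof (rule causal_couplingI[OF _ sets_PiM_m _ \<nu>(2) S law])
    show "prob_space ?\<alpha>" "prob_space ?Q" by unfold_locales
    fix t x x' v assume t: "t \<le> N" and x: "\<And>s. s \<in> {1..t} \<Longrightarrow> x s = (x' s :: real)"
    show "restrict (S (x, v)) {1..t} = restrict (S (x', v)) {1..t}"
      unfolding S_def seq_path_restrict[OF t] by (rule seq_path_cong) (use x t in auto)
  qed
qed

text \<open>The noise of step t + 1 is independent of y_1, ..., y_t, which makes the law of
  (x_{t+1}, y_1, ..., y_{t+1}) explicit; each summand of a separable cost is integrated against such
  a law.\<close>

lemma nn_integral_coupling_step:
  assumes t: "t < N" and f: "f \<in> borel_measurable ((borel \<Otimes>\<^sub>M RN t) \<Otimes>\<^sub>M borel)"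
  shows "(\<integral>\<^sup>+p. f ((fst p (Suc t), restrict (snd p) {1..t}), snd p (Suc t)) \<partial>coupling)
    = (\<integral>\<^sup>+y. \<integral>\<^sup>+a. f ((fst a, y), G (Suc t) a y) \<partial>(m (Suc t) \<Otimes>\<^sub>M U01) \<partial>hist_law \<nu> t)"
proof -
  have jm: "joint_path N \<in> noise N \<rightarrow>\<^sub>M RN N \<Otimes>\<^sub>M RN N" by (rule measurable_joint_path) simp
  have c: "(\<lambda>x. x (Suc t)) \<in> borel_measurable (RN N)" by (rule measurable_component_singleton) (use t in auto)
  have r: "(\<lambda>x. restrict x {1..t}) \<in> RN N \<rightarrow>\<^sub>M RN t" by (rule measurable_restrict_RN) (use t in auto)
  have fp: "(\<lambda>p. f ((fst p (Suc t), restrict (snd p) {1..t}), snd p (Suc t))) \<in> borel_measurable (RN N \<Otimes>\<^sub>M RN N)"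
    by (intro measurable_compose[OF _ f] measurable_Pair measurable_compose[OF measurable_fst c]
        measurable_compose[OF measurable_snd c] measurable_compose[OF measurable_snd r])
  have "(\<integral>\<^sup>+p. f ((fst p (Suc t), restrict (snd p) {1..t}), snd p (Suc t)) \<partial>coupling)
    = (\<integral>\<^sup>+z. (\<lambda>p. f ((fst p (Suc t), restrict (snd p) {1..t}), snd p (Suc t))) (joint_path N z) \<partial>noise N)"
    unfolding coupling_def by (rule nn_integral_distr[OF jm]) (use fp in simp)
  also have "\<dots> = (\<integral>\<^sup>+z. (\<lambda>(a, y). f ((fst a, y), G (Suc t) a y)) (z (Suc t), seq_path G z t) \<partial>noise N)"
  proof (rule nn_integral_cong)
    fix z
    have "seq_path G z N (Suc t) = restrict (seq_path G z N) {1..Suc t} (Suc t)" by simp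
    also have "\<dots> = G (Suc t) (z (Suc t)) (seq_path G z t)"
      using t by (subst seq_path_restrict) simp_all
    finally show "(\<lambda>p. f ((fst p (Suc t), restrict (snd p) {1..t}), snd p (Suc t))) (joint_path N z)
      = (\<lambda>(a, y). f ((fst a, y), G (Suc t) a y)) (z (Suc t), seq_path G z t)"
      unfolding joint_path_def using t seq_path_restrict[of t N G z] by simp
  qed
  also have "\<dots> = (\<integral>\<^sup>+y. \<integral>\<^sup>+a. (\<lambda>(a, y). f ((fst a, y), G (Suc t) a y)) (a, y) \<partial>(m (Suc t) \<Otimes>\<^sub>M U01) \<partial>hist_law \<nu> t)"
  proof (rule nn_integral_noise_path[OF t])
    have f1: "(\<lambda>w. fst (fst w)) \<in> borel_measurable ((m (Suc t) \<Otimes>\<^sub>M U01) \<Otimes>\<^sub>M RN t)"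
    proof -
      have "fst \<in> m (Suc t) \<Otimes>\<^sub>M U01 \<rightarrow>\<^sub>M borel"
        using measurable_fst[of "m (Suc t)" U01] by (simp add: measurable_cong_sets[OF refl sets_m])
      from measurable_compose[OF measurable_fst this] show ?thesis .
    qed
    show "(\<lambda>(a, y). f ((fst a, y), G (Suc t) a y)) \<in> borel_measurable ((m (Suc t) \<Otimes>\<^sub>M U01) \<Otimes>\<^sub>M RN t)"
      unfolding split_beta' by (intro measurable_compose[OF _ f] measurable_Pair f1 measurable_snd G[OF t])
  qed
  finally show ?thesis by simp
qed

end

lemma restrict_space_RN: "y \<in> space (RN t) \<Longrightarrow> restrict y {1..t} = y"
  by (simp add: space_PiM PiE_restrict)

lemma restrict_upd_Suc: "y \<in> space (PiM {1..t} R) \<Longrightarrow> restrict (y(Suc t := b)) {1..t} = y"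
  by (auto simp: space_PiM PiE_iff extensional_def fun_eq_iff)

lemma measurable_coordinate:
  assumes "sets \<eta> = sets (RN N)"
  shows "(\<lambda>x. x t) \<in> borel_measurable \<eta>"
proof (cases "t \<in> {1..N}")
  case True
  then show ?thesis by (subst measurable_cong_sets[OF assms refl]) (rule measurable_component_singleton)
next
  case False
  have "x t = undefined" if "x \<in> space \<eta>" for x
    using that False sets_eq_imp_space_eq[OF assms] by (auto simp: space_PiM PiE_iff extensional_def)
  then show ?thesis by (subst measurable_cong[of _ _ "\<lambda>_. undefined"]) auto
qed

lemma real_distribution_marginal:
  assumes "prob_space \<eta>" "sets \<eta> = sets (RN N)"
  shows "real_distribution (marginal \<eta> t)"
  unfolding marginal_def
  by (rule prob_space.real_distribution_distr[OF assms(1) measurable_coordinate[OF assms(2)]])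

section \<open>The reverse direction\<close>

context forward_construction
begin

context
  fixes \<xi> :: "nat \<Rightarrow> (nat \<Rightarrow> real) \<times> real \<Rightarrow> real"
  assumes \<xi>: "\<And>t. t < N \<Longrightarrow> \<xi> (Suc t) \<in> borel_measurable (RN (Suc t) \<Otimes>\<^sub>M borel)"
    and back_law: "\<And>t f. t < N \<Longrightarrow> f \<in> borel_measurable (RN (Suc t) \<Otimes>\<^sub>M borel) \<Longrightarrow>
      (\<integral>\<^sup>+y. \<integral>\<^sup>+a. f (y(Suc t := G (Suc t) a y), fst a) \<partial>(m (Suc t) \<Otimes>\<^sub>M U01) \<partial>hist_law \<nu> t)
        = (\<integral>\<^sup>+y. \<integral>\<^sup>+w. f (y, \<xi> (Suc t) (y, w)) \<partial>U01 \<partial>hist_law \<nu> (Suc t))"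
begin

text \<open>\<open>back_law\<close> makes \<open>\<xi> (t + 1)\<close> a randomised rule for \<open>x\<^bsub>t+1\<^esub>\<close> given \<open>y\<^sub>1, \<dots>, y\<^bsub>t+1\<^esub>\<close>; drawing the \<open>x\<^sub>s\<close> from these
  rules with independent uniforms is an adapted description of the same coupling in the reverse direction.\<close>

definition back_path :: "nat \<Rightarrow> (nat \<Rightarrow> real) \<Rightarrow> (nat \<Rightarrow> real) \<Rightarrow> (nat \<Rightarrow> real)" where
  "back_path t y w = (\<lambda>s\<in>{1..t}. \<xi> s (restrict y {1..s}, w s))"

lemma measurable_back_path:
  assumes "t \<le> N" shows "(\<lambda>p. back_path t (fst p) (snd p)) \<in> RN t \<Otimes>\<^sub>M PiM {1..t} (\<lambda>_. U01) \<rightarrow>\<^sub>M RN t"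
  unfolding back_path_def
proof (rule measurable_restrict)
  fix s assume s: "s \<in> {1..t}"
  then obtain s' where s': "s = Suc s'" "s' < N" using assms by (cases s) auto
  have 1: "(\<lambda>p. restrict (fst p) {1..s}) \<in> RN t \<Otimes>\<^sub>M PiM {1..t} (\<lambda>_. U01) \<rightarrow>\<^sub>M RN s"
    by (rule measurable_compose[OF measurable_fst measurable_restrict_RN[OF refl]]) (use s in auto)
  have "(\<lambda>p. snd p s) \<in> RN t \<Otimes>\<^sub>M PiM {1..t} (\<lambda>_. U01) \<rightarrow>\<^sub>M U01"
    by (rule measurable_compose[OF measurable_snd measurable_component_singleton]) (use s in auto)
  then have 2: "(\<lambda>p. snd p s) \<in> borel_measurable (RN t \<Otimes>\<^sub>M PiM {1..t} (\<lambda>_. U01))"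
    by (subst (asm) measurable_cong_sets[of _ _ U01 borel]) simp_all
  show "(\<lambda>p. \<xi> s (restrict (fst p) {1..s}, snd p s)) \<in> borel_measurable (RN t \<Otimes>\<^sub>M PiM {1..t} (\<lambda>_. U01))"
    using measurable_compose[OF measurable_Pair[OF 1 2]] \<xi>[OF s'(2)] unfolding s'(1) by blast
qed

lemma back_path_Suc:
  "y \<in> space (RN (Suc t)) \<Longrightarrow> back_path (Suc t) y (w(Suc t := b)) = (back_path t (restrict y {1..t}) w)(Suc t := \<xi> (Suc t) (y, b))"
  unfolding back_path_def
  by (rule ext) (auto simp: restrict_space_RN[of y "Suc t", unfolded One_nat_def] min_def)

lemma joint_path_Suc:
  "joint_path (Suc t) (z(Suc t := a)) = ((fst (joint_path t z))(Suc t := fst a),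
     (snd (joint_path t z))(Suc t := G (Suc t) a (snd (joint_path t z))))"
proof -
  have "seq_path G (z(Suc t := a)) t = seq_path G z t" by (rule seq_path_cong) auto
  moreover have "(\<lambda>s\<in>{1..Suc t}. fst ((z(Suc t := a)) s)) = (\<lambda>s\<in>{1..t}. fst (z s))(Suc t := fst a)"
    by (auto simp: fun_eq_iff)
  ultimately show ?thesis unfolding joint_path_def by simp
qed

text \<open>Induction on t. Given y_1, ..., y_t, the earlier source coordinates are independent of
  the noise of step t + 1, so the two integrations may be exchanged and \<open>back_law\<close>
  replaces the forward step by a draw of x_{t+1} from the finished path.\<close>

lemma nn_integral_joint_back_path:
  "t \<le> N \<Longrightarrow> f \<in> borel_measurable (RN t \<Otimes>\<^sub>M RN t) \<Longrightarrow>
    (\<integral>\<^sup>+z. f (joint_path t z) \<partial>noise t)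
      = (\<integral>\<^sup>+y. \<integral>\<^sup>+w. f (back_path t y w, y) \<partial>PiM {1..t} (\<lambda>_. U01) \<partial>hist_law \<nu> t)"
proof (induction t arbitrary: f)
  case 0
  interpret H: prob_space "hist_law \<nu> 0" by (rule prob_space_hist_law[OF \<nu>]) simp
  interpret P: prob_space "noise 0" by (rule prob_space_PiM[OF R])
  interpret Q: prob_space "PiM {1..0::nat} (\<lambda>_. U01)" by (rule prob_space_PiM[OF prob_space_U01])
  have "(\<integral>\<^sup>+y. \<integral>\<^sup>+w. f (back_path 0 y w, y) \<partial>PiM {1..0} (\<lambda>_. U01) \<partial>hist_law \<nu> 0)
      = (\<integral>\<^sup>+y. f (\<lambda>_. undefined, \<lambda>_. undefined) \<partial>hist_law \<nu> 0)"
  proof (rule nn_integral_cong)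
    fix y assume "y \<in> space (hist_law \<nu> 0)"
    then have y: "y = (\<lambda>_. undefined)" by (simp add: space_PiM)
    have b: "back_path 0 y w = (\<lambda>_. undefined)" for w by (auto simp: back_path_def)
    show "(\<integral>\<^sup>+w. f (back_path 0 y w, y) \<partial>PiM {1..0} (\<lambda>_. U01)) = f (\<lambda>_. undefined, \<lambda>_. undefined)"
      unfolding b unfolding y nn_integral_const Q.emeasure_space_1 by simp
  qed
  moreover have "joint_path 0 z = (\<lambda>_. undefined, \<lambda>_. undefined)" for z by (auto simp: joint_path_def)
  ultimately show ?case
    by (simp only: nn_integral_const H.emeasure_space_1 P.emeasure_space_1)
next
  case (Suc t)
  let ?S = "Suc t"
  let ?R = "m ?S \<Otimes>\<^sub>M U01"
  let ?Q = "\<lambda>t. PiM {1..t::nat} (\<lambda>_. U01)"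
  note f = Suc.prems(2)
  have t: "t < N" "t \<le> N" using Suc.prems by auto
  interpret Rp: prob_space ?R by (rule R)
  interpret Q: prob_space "?Q t" by (rule prob_space_PiM[OF prob_space_U01])
  interpret U: prob_space U01 by (rule prob_space_U01)
  interpret RQ: pair_sigma_finite "?R" "?Q t" ..
  interpret UQ: pair_sigma_finite U01 "?Q t" ..
  have fstR: "fst \<in> ?R \<rightarrow>\<^sub>M borel"
    using measurable_fst[of "m ?S" U01] by (simp add: measurable_cong_sets[OF refl sets_m])
  have jm: "joint_path ?S \<in> noise ?S \<rightarrow>\<^sub>M RN ?S \<Otimes>\<^sub>M RN ?S" by (rule measurable_joint_path[OF Suc.prems(1)])
  have sym: "(\<lambda>p. G ?S (snd p) (snd (fst p))) \<in> borel_measurable ((RN t \<Otimes>\<^sub>M RN t) \<Otimes>\<^sub>M ?R)"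
    using measurable_compose[OF measurable_Pair[OF measurable_snd measurable_compose[OF measurable_fst measurable_snd]] G[OF t(1)]]
    by simp
  have step_m: "(\<lambda>p. f ((fst (fst p))(?S := fst (snd p)), (snd (fst p))(?S := G ?S (snd p) (snd (fst p)))))
      \<in> borel_measurable ((RN t \<Otimes>\<^sub>M RN t) \<Otimes>\<^sub>M ?R)"
    by (intro measurable_compose[OF _ f] measurable_Pair measurable_upd_Suc sym
        measurable_compose[OF measurable_fst measurable_fst] measurable_compose[OF measurable_fst measurable_snd]
        measurable_compose[OF measurable_snd fstR])
  have bp: "(\<lambda>p. back_path t (fst p) (snd p)) \<in> RN t \<Otimes>\<^sub>M ?Q t \<rightarrow>\<^sub>M RN t" by (rule measurable_back_path[OF t(2)])
  \<comment> \<open>The earlier source coordinates are already integrated out in \<open>F\<close>;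
    it depends on the path and the last source coordinate alone, the shape to which
    \<open>back_law\<close> applies.\<close>
  define F where "F = (\<lambda>(y, x). \<integral>\<^sup>+w. f ((back_path t (restrict y {1..t}) w)(?S := x), y) \<partial>?Q t)"
  have Fm0: "(\<lambda>p. f ((back_path t (restrict (fst (fst p)) {1..t}) (snd p))(?S := snd (fst p)), fst (fst p)))
     \<in> borel_measurable ((RN ?S \<Otimes>\<^sub>M borel) \<Otimes>\<^sub>M ?Q t)"
  proof (intro measurable_compose[OF _ f] measurable_Pair measurable_upd_Suc)
    have "(\<lambda>p. restrict (fst (fst p)) {1..t}) \<in> (RN ?S \<Otimes>\<^sub>M borel) \<Otimes>\<^sub>M ?Q t \<rightarrow>\<^sub>M RN t"
      by (rule measurable_compose[OF measurable_compose[OF measurable_fst measurable_fst] measurable_restrict_RN[OF refl]]) simp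
    from measurable_compose[OF measurable_Pair[OF this measurable_snd] bp]
    show "(\<lambda>p. back_path t (restrict (fst (fst p)) {1..t}) (snd p)) \<in> (RN ?S \<Otimes>\<^sub>M borel) \<Otimes>\<^sub>M ?Q t \<rightarrow>\<^sub>M RN t"
      by simp
  qed (intro measurable_compose[OF measurable_fst measurable_fst] measurable_compose[OF measurable_fst measurable_snd])+
  have Fm: "F \<in> borel_measurable (RN ?S \<Otimes>\<^sub>M borel)"
    unfolding F_def split_beta' by (rule Q.borel_measurable_nn_integral) (use Fm0 in \<open>simp add: split_beta'\<close>)
  have "(\<integral>\<^sup>+z. f (joint_path ?S z) \<partial>noise ?S) = (\<integral>\<^sup>+z. \<integral>\<^sup>+a. f (joint_path ?S (z(?S := a))) \<partial>?R \<partial>noise t)"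
    by (rule nn_integral_PiM_Suc[OF R]) (rule measurable_compose[OF jm f])
  also have "\<dots> = (\<integral>\<^sup>+z. (\<lambda>p. \<integral>\<^sup>+a. f ((fst p)(?S := fst a), (snd p)(?S := G ?S a (snd p))) \<partial>?R) (joint_path t z) \<partial>noise t)"
    unfolding joint_path_Suc ..
  also have "\<dots> = (\<integral>\<^sup>+y. \<integral>\<^sup>+w. (\<lambda>p. \<integral>\<^sup>+a. f ((fst p)(?S := fst a), (snd p)(?S := G ?S a (snd p))) \<partial>?R) (back_path t y w, y) \<partial>?Q t \<partial>hist_law \<nu> t)"
    by (rule Suc.IH[OF t(2)], rule Rp.borel_measurable_nn_integral, unfold split_beta', rule step_m)
  also have "\<dots> = (\<integral>\<^sup>+y. \<integral>\<^sup>+w. \<integral>\<^sup>+a. f ((back_path t y w)(?S := fst a), y(?S := G ?S a y)) \<partial>?R \<partial>?Q t \<partial>hist_law \<nu> t)"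
    by simp
  also have "\<dots> = (\<integral>\<^sup>+y. \<integral>\<^sup>+a. \<integral>\<^sup>+w. f ((back_path t y w)(?S := fst a), y(?S := G ?S a y)) \<partial>?Q t \<partial>?R \<partial>hist_law \<nu> t)"
  proof (rule nn_integral_cong)
    fix y assume "y \<in> space (hist_law \<nu> t)"
    then have y: "y \<in> space (RN t)" by simp
    show "(\<integral>\<^sup>+w. \<integral>\<^sup>+a. f ((back_path t y w)(?S := fst a), y(?S := G ?S a y)) \<partial>?R \<partial>?Q t)
      = (\<integral>\<^sup>+a. \<integral>\<^sup>+w. f ((back_path t y w)(?S := fst a), y(?S := G ?S a y)) \<partial>?Q t \<partial>?R)"
    proof (rule RQ.Fubini')
      have "(\<lambda>p. ((back_path t y (snd p), y), fst p)) \<in> ?R \<Otimes>\<^sub>M ?Q t \<rightarrow>\<^sub>M (RN t \<Otimes>\<^sub>M RN t) \<Otimes>\<^sub>M ?R"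
        using measurable_compose[OF measurable_snd measurable_Pair2[OF bp y]] y
        by (intro measurable_Pair measurable_fst) simp_all
      from measurable_compose[OF this step_m]
      show "(\<lambda>(a, w). f ((back_path t y w)(?S := fst a), y(?S := G ?S a y))) \<in> borel_measurable (?R \<Otimes>\<^sub>M ?Q t)"
        by (simp add: split_beta')
    qed
  qed
  also have "\<dots> = (\<integral>\<^sup>+y. \<integral>\<^sup>+a. F (y(?S := G ?S a y), fst a) \<partial>?R \<partial>hist_law \<nu> t)"
  proof (intro nn_integral_cong)
    fix y a assume "y \<in> space (hist_law \<nu> t)"
    then have "restrict (y(?S := G ?S a y)) {1..t} = y" by (intro restrict_upd_Suc) simp
    then show "(\<integral>\<^sup>+w. f ((back_path t y w)(?S := fst a), y(?S := G ?S a y)) \<partial>?Q t) = F (y(?S := G ?S a y), fst a)"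
      unfolding F_def by simp
  qed
  also have "\<dots> = (\<integral>\<^sup>+y. \<integral>\<^sup>+b. F (y, \<xi> ?S (y, b)) \<partial>U01 \<partial>hist_law \<nu> ?S)"
    by (rule back_law[OF t(1) Fm])
  also have "\<dots> = (\<integral>\<^sup>+y. \<integral>\<^sup>+w. f (back_path ?S y w, y) \<partial>?Q ?S \<partial>hist_law \<nu> ?S)"
  proof (rule nn_integral_cong)
    fix y assume "y \<in> space (hist_law \<nu> ?S)"
    then have y: "y \<in> space (RN ?S)" by simp
    have chi_y: "(\<lambda>b. \<xi> ?S (y, b)) \<in> borel_measurable U01"
      using measurable_Pair2[OF \<xi>[OF t(1)] y] by simp
    have "(\<lambda>w. f (back_path ?S y w, y)) \<in> borel_measurable (?Q ?S)"
      using measurable_Pair2[OF measurable_back_path[OF Suc.prems(1)] y] y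
      by (intro measurable_compose[OF _ f] measurable_Pair) simp_all
    then have "(\<integral>\<^sup>+w. f (back_path ?S y w, y) \<partial>?Q ?S) = (\<integral>\<^sup>+w. \<integral>\<^sup>+b. f (back_path ?S y (w(?S := b)), y) \<partial>U01 \<partial>?Q t)"
      by (rule nn_integral_PiM_Suc[OF prob_space_U01])
    also have "\<dots> = (\<integral>\<^sup>+w. \<integral>\<^sup>+b. f ((back_path t (restrict y {1..t}) w)(?S := \<xi> ?S (y, b)), y) \<partial>U01 \<partial>?Q t)"
      unfolding back_path_Suc[OF y] ..
    also have "\<dots> = (\<integral>\<^sup>+b. \<integral>\<^sup>+w. f ((back_path t (restrict y {1..t}) w)(?S := \<xi> ?S (y, b)), y) \<partial>?Q t \<partial>U01)"
    proof (rule UQ.Fubini')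
      have "(\<lambda>p. ((y, \<xi> ?S (y, fst p)), snd p)) \<in> U01 \<Otimes>\<^sub>M ?Q t \<rightarrow>\<^sub>M (RN ?S \<Otimes>\<^sub>M borel) \<Otimes>\<^sub>M ?Q t"
        using y by (intro measurable_Pair measurable_snd measurable_compose[OF measurable_fst chi_y]) simp
      from measurable_compose[OF this Fm0]
      show "(\<lambda>(b, w). f ((back_path t (restrict y {1..t}) w)(?S := \<xi> ?S (y, b)), y)) \<in> borel_measurable (U01 \<Otimes>\<^sub>M ?Q t)"
        by (simp add: split_beta')
    qed
    finally show "(\<integral>\<^sup>+b. F (y, \<xi> ?S (y, b)) \<partial>U01) = (\<integral>\<^sup>+w. f (back_path ?S y w, y) \<partial>?Q ?S)"
      unfolding F_def by simp
  qed
  finally show ?case .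
qed

text \<open>The swapped coupling is the law of (y, \<open>back_path N y w\<close>), whose coordinate
  s reads y_1, ..., y_s and one uniform; this is an adapted map of y.\<close>

lemma coupling_bicausal: "coupling \<in> bicausal_couplings N (PiM {1..N} m) \<nu>"
proof -
  let ?Q = "PiM {1..N} (\<lambda>_. U01)" and ?\<alpha> = "PiM {1..N} m"
  interpret Q: prob_space ?Q by (rule prob_space_PiM[OF prob_space_U01])
  interpret \<nu>: prob_space \<nu> by (rule \<nu>)
  let ?S = "\<lambda>p. back_path N (fst p) (snd p)"
  have sQ: "sets (\<nu> \<Otimes>\<^sub>M ?Q) = sets (RN N \<Otimes>\<^sub>M ?Q)"
    by (rule sets_pair_measure_cong[OF \<nu>(2) refl])
  have S: "?S \<in> RN N \<Otimes>\<^sub>M ?Q \<rightarrow>\<^sub>M RN N" by (rule measurable_back_path) simp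
  have S': "?S \<in> \<nu> \<Otimes>\<^sub>M ?Q \<rightarrow>\<^sub>M RN N" using S by (subst measurable_cong_sets[OF sQ refl])
  have f': "fst \<in> \<nu> \<Otimes>\<^sub>M ?Q \<rightarrow>\<^sub>M RN N" by (subst measurable_cong_sets[OF sQ refl]) simp
  have fS: "(\<lambda>z. (fst z, ?S z)) \<in> \<nu> \<Otimes>\<^sub>M ?Q \<rightarrow>\<^sub>M RN N \<Otimes>\<^sub>M RN N" by (rule measurable_Pair[OF f' S'])
  have jm: "joint_path N \<in> noise N \<rightarrow>\<^sub>M RN N \<Otimes>\<^sub>M RN N" by (rule measurable_joint_path) simp
  have sw: "(\<lambda>(x, y). (y, x)) \<in> RN N \<Otimes>\<^sub>M RN N \<rightarrow>\<^sub>M RN N \<Otimes>\<^sub>M RN N" by (rule measurable_pair_swap')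
  have sN: "sets (\<nu> \<Otimes>\<^sub>M ?\<alpha>) = sets (RN N \<Otimes>\<^sub>M RN N)"
    by (rule sets_pair_measure_cong[OF \<nu>(2) sets_PiM_m])
  have spn: "space \<nu> = space (RN N)" by (rule sets_eq_imp_space_eq[OF \<nu>(2)])
  have flip: "distr coupling (\<nu> \<Otimes>\<^sub>M ?\<alpha>) (\<lambda>(x, y). (y, x)) = distr (noise N) (RN N \<Otimes>\<^sub>M RN N) (\<lambda>z. (snd (joint_path N z), fst (joint_path N z)))"
  proof -
    have "distr coupling (\<nu> \<Otimes>\<^sub>M ?\<alpha>) (\<lambda>(x, y). (y, x)) = distr coupling (RN N \<Otimes>\<^sub>M RN N) (\<lambda>(x, y). (y, x))"
      by (rule distr_cong) (use sN in auto)
    also have "\<dots> = distr (noise N) (RN N \<Otimes>\<^sub>M RN N) (\<lambda>z. (snd (joint_path N z), fst (joint_path N z)))"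
      unfolding coupling_def by (subst distr_distr[OF sw jm]) (simp add: comp_def split_beta')
    finally show ?thesis .
  qed
  have jm': "(\<lambda>z. (snd (joint_path N z), fst (joint_path N z))) \<in> noise N \<rightarrow>\<^sub>M RN N \<Otimes>\<^sub>M RN N"
    using measurable_compose[OF jm sw] by (simp add: split_beta')
  have eq: "distr coupling (\<nu> \<Otimes>\<^sub>M ?\<alpha>) (\<lambda>(x, y). (y, x)) = distr (\<nu> \<Otimes>\<^sub>M ?Q) (RN N \<Otimes>\<^sub>M RN N) (\<lambda>z. (fst z, ?S z))"
    unfolding flip
  proof (rule measure_eqI)
    fix A assume "A \<in> sets (distr (noise N) (RN N \<Otimes>\<^sub>M RN N) (\<lambda>z. (snd (joint_path N z), fst (joint_path N z))))"
    then have A: "A \<in> sets (RN N \<Otimes>\<^sub>M RN N)" by simp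
    have Am: "(\<lambda>p. indicator A (snd p, fst p) :: ennreal) \<in> borel_measurable (RN N \<Otimes>\<^sub>M RN N)"
      using measurable_compose[OF sw borel_measurable_indicator[OF A]] by (simp add: split_beta')
    have Bm: "(\<lambda>y. \<integral>\<^sup>+w. indicator A (y, back_path N y w) \<partial>?Q) \<in> borel_measurable (RN N)"
      by (rule Q.borel_measurable_nn_integral)
         (use measurable_compose[OF measurable_Pair[OF measurable_fst S] borel_measurable_indicator[OF A]] in \<open>simp add: split_beta'\<close>)
    have "emeasure (distr (noise N) (RN N \<Otimes>\<^sub>M RN N) (\<lambda>z. (snd (joint_path N z), fst (joint_path N z)))) A
       = (\<integral>\<^sup>+z. indicator A (snd (joint_path N z), fst (joint_path N z)) \<partial>noise N)"
      by (rule emeasure_distr_nn_integral[OF jm' A])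
    also have "\<dots> = (\<integral>\<^sup>+y. \<integral>\<^sup>+w. indicator A (y, back_path N y w) \<partial>?Q \<partial>hist_law \<nu> N)"
      by (subst nn_integral_joint_back_path[OF order_refl Am]) simp
    also have "\<dots> = (\<integral>\<^sup>+y. \<integral>\<^sup>+w. indicator A (restrict y {1..N}, back_path N (restrict y {1..N}) w) \<partial>?Q \<partial>\<nu>)"
      by (rule nn_integral_hist_law[OF \<nu>(2) order_refl Bm])
    also have "\<dots> = (\<integral>\<^sup>+y. \<integral>\<^sup>+w. indicator A (y, back_path N y w) \<partial>?Q \<partial>\<nu>)"
    proof (rule nn_integral_cong)
      fix y assume "y \<in> space \<nu>"
      then have "restrict y {1..N} = y" unfolding spn by (rule restrict_space_RN)
      then show "(\<integral>\<^sup>+w. indicator A (restrict y {1..N}, back_path N (restrict y {1..N}) w) \<partial>?Q)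
        = (\<integral>\<^sup>+w. indicator A (y, back_path N y w) \<partial>?Q)" by simp
    qed
    also have "\<dots> = (\<integral>\<^sup>+z. indicator A (fst z, ?S z) \<partial>(\<nu> \<Otimes>\<^sub>M ?Q))"
      by (subst Q.nn_integral_fst[symmetric])
         (use measurable_compose[OF fS borel_measurable_indicator[OF A]] in simp_all)
    also have "\<dots> = emeasure (distr (\<nu> \<Otimes>\<^sub>M ?Q) (RN N \<Otimes>\<^sub>M RN N) (\<lambda>z. (fst z, ?S z))) A"
      by (rule emeasure_distr_nn_integral[OF fS A, symmetric])
    finally show "emeasure (distr (noise N) (RN N \<Otimes>\<^sub>M RN N) (\<lambda>z. (snd (joint_path N z), fst (joint_path N z)))) A
      = emeasure (distr (\<nu> \<Otimes>\<^sub>M ?Q) (RN N \<Otimes>\<^sub>M RN N) (\<lambda>z. (fst z, ?S z))) A" .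
  qed simp
  \<comment> \<open>The law of the reverse map is read off from the first marginal of the coupling,
    known from the forward direction.\<close>
  have "distr (\<nu> \<Otimes>\<^sub>M ?Q) (RN N) ?S = distr (distr (\<nu> \<Otimes>\<^sub>M ?Q) (RN N \<Otimes>\<^sub>M RN N) (\<lambda>z. (fst z, ?S z))) (RN N) snd"
    by (subst distr_distr[OF measurable_snd fS]) (simp add: comp_def)
  also have "\<dots> = distr (noise N) (RN N) (\<lambda>z. fst (joint_path N z))"
    unfolding eq[symmetric] flip by (subst distr_distr[OF measurable_snd jm']) (simp add: comp_def)
  also have "\<dots> = distr coupling (RN N) fst"
    unfolding coupling_def by (subst distr_distr[OF measurable_fst jm]) (simp add: comp_def)
  also have "\<dots> = distr coupling ?\<alpha> fst"
    by (rule distr_cong) (use sets_PiM_m in auto)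
  also have "\<dots> = ?\<alpha>"
    using coupling_causal by (simp add: causal_couplings_def couplings_def)
  finally have law: "distr (\<nu> \<Otimes>\<^sub>M ?Q) (RN N) ?S = ?\<alpha>" .
  have "distr coupling (\<nu> \<Otimes>\<^sub>M ?\<alpha>) (\<lambda>(x, y). (y, x)) \<in> causal_couplings N \<nu> ?\<alpha>"
    unfolding eq
  proof (rule causal_couplingI[OF \<nu> _ sets_PiM_m S law])
    show "prob_space ?Q" by unfold_locales
    fix t and y y' w :: "nat \<Rightarrow> real" assume t: "t \<le> N" and y: "\<And>s. s \<in> {1..t} \<Longrightarrow> y s = y' s"
    have "restrict y {1..s} = restrict y' {1..s}" if "s \<le> t" for s
      by (rule restrict_ext) (use y that in auto)
    then show "restrict (back_path N (fst (y, w)) (snd (y, w))) {1..t} = restrict (back_path N (fst (y', w)) (snd (y', w))) {1..t}"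
      unfolding back_path_def by (intro restrict_ext) auto
  qed
  then show ?thesis using coupling_causal by (simp add: bicausal_couplings_def)
qed

end

end

section \<open>Causal couplings with a product source\<close>

text \<open>Doob-Dynkin factorisation with an explicit factor: pad a history by zeros and apply g.
  The set where g takes its value at x is a preimage under restriction to \<open>{1..t}\<close>, so
  it also contains the padded point.\<close>

lemma hist_algebra_measurable_factor:
  assumes t: "t \<le> N" and g: "g \<in> borel_measurable (hist_algebra N t)"
  obtains g' :: "(nat \<Rightarrow> real) \<Rightarrow> real" where "g' \<in> borel_measurable (RN t)"
    "\<And>x. x \<in> space (RN N) \<Longrightarrow> g x = g' (restrict x {1..t})"
proof -
  define e where "e y = (\<lambda>s\<in>{1..N}. if s \<le> t then y s else 0)" for y :: "nat \<Rightarrow> real"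
  have sp: "space (hist_algebra N t) = space (RN N)" by (simp add: hist_algebra_def)
  have e: "e \<in> RN t \<rightarrow>\<^sub>M RN N"
    unfolding e_def
  proof (rule measurable_restrict)
    fix s assume "s \<in> {1..N}"
    then show "(\<lambda>y. if s \<le> t then y s else (0::real)) \<in> RN t \<rightarrow>\<^sub>M borel"
      by (cases "s \<le> t") auto
  qed
  have "sets (hist_algebra N t) \<subseteq> sets (RN N)"
  proof
    fix B assume "B \<in> sets (hist_algebra N t)"
    then obtain C where "C \<in> sets (RN t)" "B = (\<lambda>x. restrict x {1..t}) -` C \<inter> space (RN N)"
      using sets_hist_algebra_iff[OF t] by auto
    then show "B \<in> sets (RN N)" using measurable_sets[OF measurable_restrict_RN[OF refl t]] by auto
  qed
  then have "g \<in> borel_measurable (RN N)" using g sp unfolding measurable_def by auto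
  then have "(\<lambda>y. g (e y)) \<in> borel_measurable (RN t)" by (rule measurable_compose[OF e])
  moreover have "g x = g (e (restrict x {1..t}))" if x: "x \<in> space (RN N)" for x
  proof -
    have "g -` {g x} \<inter> space (RN N) \<in> sets (hist_algebra N t)"
      using measurable_sets[OF g, of "{g x}"] sp by simp
    then obtain C where C: "g -` {g x} \<inter> space (RN N) = (\<lambda>x. restrict x {1..t}) -` C \<inter> space (RN N)"
      using sets_hist_algebra_iff[OF t] by auto
    have ex: "e (restrict x {1..t}) \<in> space (RN N)" by (auto simp: e_def space_PiM)
    have "restrict (e (restrict x {1..t})) {1..t} = restrict x {1..t}"
      using t by (auto simp: e_def fun_eq_iff)
    moreover have "restrict x {1..t} \<in> C" using C x by blast
    ultimately have "e (restrict x {1..t}) \<in> g -` {g x} \<inter> space (RN N)" unfolding C using ex by simp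
    then show ?thesis by simp
  qed
  ultimately show thesis by (rule that)
qed

section \<open>Independence of the next source coordinate from the past of the target\<close>

locale product_source =
  fixes N :: nat and \<mu> \<nu> :: "(nat \<Rightarrow> real) measure"
  assumes \<mu>: "prob_space \<mu>" "sets \<mu> = sets (RN N)"
    and \<nu>: "prob_space \<nu>" "sets \<nu> = sets (RN N)"
    and product: "\<mu> = PiM {1..N} (marginal \<mu>)"
begin

abbreviation "m \<equiv> marginal \<mu>"

lemma real_distribution_m: "real_distribution (m t)"
  by (rule real_distribution_marginal[OF \<mu>])

lemma prob_space_m: "prob_space (m t)" and sets_m: "sets (m t) = sets borel" and space_m: "space (m t) = UNIV"
proof -
  interpret real_distribution "m t" by (rule real_distribution_m)
  show "prob_space (m t)" "sets (m t) = sets borel" "space (m t) = UNIV"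
    by (simp_all add: prob_space_axioms)
qed

lemma sets_PiM_m: "sets (PiM {1..t} m) = sets (RN t)"
  by (rule sets_PiM_cong) (simp_all add: sets_m)

end

locale causal_from_product = product_source +
  fixes \<gamma>
  assumes \<gamma>: "\<gamma> \<in> causal_couplings N \<mu> \<nu>"
begin

lemma sets_\<gamma>: "sets \<gamma> = sets (RN N \<Otimes>\<^sub>M RN N)"
  using \<gamma> sets_pair_measure_cong[OF \<mu>(2) \<nu>(2)] by (simp add: causal_couplings_def couplings_def)

lemma space_\<gamma>: "space \<gamma> = space (RN N) \<times> space (RN N)"
  using sets_eq_imp_space_eq[OF sets_\<gamma>] by (simp add: space_pair_measure)

lemma fst_\<gamma>: "fst \<in> \<gamma> \<rightarrow>\<^sub>M RN N" and snd_\<gamma>: "snd \<in> \<gamma> \<rightarrow>\<^sub>M RN N"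
  by (simp_all add: measurable_cong_sets[OF sets_\<gamma> refl])

lemma distr_fst: "distr \<gamma> (RN N) fst = \<mu>"
proof -
  have "distr \<gamma> (RN N) fst = distr \<gamma> \<mu> fst" by (rule distr_cong) (use \<mu> in auto)
  then show ?thesis using \<gamma> by (simp add: causal_couplings_def couplings_def)
qed

lemma distr_snd: "distr \<gamma> (RN N) snd = \<nu>"
proof -
  have "distr \<gamma> (RN N) snd = distr \<gamma> \<nu> snd" by (rule distr_cong) (use \<nu> in auto)
  then show ?thesis using \<gamma> by (simp add: causal_couplings_def couplings_def)
qed

lemma prob_space_\<gamma>: "prob_space \<gamma>"
  by (rule prob_space_distrD[OF fst_\<gamma>]) (unfold distr_fst, rule \<mu>)

lemma measurable_coords:
  assumes t: "t < N"
  shows "(\<lambda>p. fst p (Suc t)) \<in> borel_measurable \<gamma>" "(\<lambda>p. snd p (Suc t)) \<in> borel_measurable \<gamma>"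
    "s \<le> N \<Longrightarrow> (\<lambda>p. restrict (snd p) {1..s}) \<in> \<gamma> \<rightarrow>\<^sub>M RN s"
proof -
  have c: "(\<lambda>x. x (Suc t)) \<in> borel_measurable (RN N)" by (rule measurable_component_singleton) (use t in auto)
  show "(\<lambda>p. fst p (Suc t)) \<in> borel_measurable \<gamma>" "(\<lambda>p. snd p (Suc t)) \<in> borel_measurable \<gamma>"
    by (rule measurable_compose[OF fst_\<gamma> c] measurable_compose[OF snd_\<gamma> c])+
  show "(\<lambda>p. restrict (snd p) {1..s}) \<in> \<gamma> \<rightarrow>\<^sub>M RN s" if "s \<le> N"
    by (rule measurable_compose[OF snd_\<gamma> measurable_restrict_RN[OF refl that]])
qed

lemma distr_hist: "s \<le> N \<Longrightarrow> distr \<gamma> (RN s) (\<lambda>p. restrict (snd p) {1..s}) = hist_law \<nu> s"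
  unfolding hist_law_def distr_snd[symmetric]
  by (subst distr_distr[OF measurable_restrict_RN[OF refl] snd_\<gamma>]) (simp_all add: comp_def)

lemma emeasure_coord: "A \<in> sets borel \<Longrightarrow> emeasure (m t) A = emeasure \<gamma> {p \<in> space \<gamma>. fst p t \<in> A}"
proof -
  assume A: "A \<in> sets borel"
  have c: "(\<lambda>x. x t) \<in> borel_measurable (RN N)" by (rule measurable_coordinate[OF refl])
  have "m t = distr \<gamma> borel (\<lambda>p. fst p t)"
    unfolding marginal_def distr_fst[symmetric]
    by (subst distr_distr[OF c fst_\<gamma>]) (simp add: comp_def)
  then show ?thesis
    using A measurable_compose[OF fst_\<gamma> c] by (simp add: emeasure_distr vimage_def Int_def conj_commute)
qed

text \<open>By causality the conditional probability of an event of y_1, ..., y_t is a function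
  \<open>g'\<close> of x_1, ..., x_t, which under the product measure is independent of x_{t+1}.
  Only proportionality in A is recorded; the constant is found afterwards from A =
  \<open>UNIV\<close>.\<close>

lemma independent_next_coord_aux:
  assumes t: "t < N" and B: "B \<in> sets (RN t)"
  shows "\<exists>c. \<forall>A\<in>sets borel. emeasure \<gamma> {p \<in> space \<gamma>. fst p (Suc t) \<in> A \<and> restrict (snd p) {1..t} \<in> B}
    = emeasure (m (Suc t)) A * c"
proof (cases "t = 0")
  \<comment> \<open>Causality speaks of t \<ge> 1. With an empty history the event is decided by one
    point: it either always holds or never does.\<close>
  case True
  have r: "restrict (snd p) {1..t} = (\<lambda>_. undefined)" for p :: "(nat \<Rightarrow> real) \<times> (nat \<Rightarrow> real)"
    unfolding True by auto
  show ?thesis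
  proof (cases "(\<lambda>_. undefined) \<in> B")
    case True
    then show ?thesis unfolding r by (intro exI[of _ 1]) (simp add: emeasure_coord)
  next
    case False
    then show ?thesis unfolding r by (intro exI[of _ 0]) simp
  qed
next
  case False
  then have tN: "t \<in> {1..N}" "t \<le> N" using t by auto
  obtain \<kappa> where cl: "is_cond_law \<gamma> fst (RN N) snd (RN N) \<kappa>"
    and ad: "\<And>B. B \<in> sets (hist_algebra N t) \<Longrightarrow> \<exists>g\<in>borel_measurable (hist_algebra N t). AE x in \<mu>. measure (\<kappa> x) B = g x"
    using \<gamma> tN by (auto simp: causal_couplings_def)
  define B' where "B' = (\<lambda>x. restrict x {1..t}) -` B \<inter> space (RN N)"
  have B': "B' \<in> sets (RN N)"
    unfolding B'_def by (rule measurable_sets[OF measurable_restrict_RN[OF refl tN(2)] B])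
  have "B' \<in> sets (hist_algebra N t)" using sets_hist_algebra_iff[OF tN(2)] B B'_def by auto
  then obtain g where g: "g \<in> borel_measurable (hist_algebra N t)" and gB: "AE x in \<mu>. measure (\<kappa> x) B' = g x"
    using ad by blast
  obtain g' where g'[measurable]: "g' \<in> borel_measurable (RN t)" and gg': "\<And>x. x \<in> space (RN N) \<Longrightarrow> g x = g' (restrict x {1..t})"
    using hist_algebra_measurable_factor[OF tN(2) g] by blast
  have spm: "space \<mu> = space (RN N)" by (rule sets_eq_imp_space_eq[OF \<mu>(2)])
  show ?thesis
  proof (intro exI[of _ "\<integral>\<^sup>+z. ennreal (g' z) \<partial>PiM {1..t} m"] ballI)
    fix A :: "real set" assume A: "A \<in> sets borel"
    define A' where "A' = {x \<in> space (RN N). x (Suc t) \<in> A}"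
    have A': "A' \<in> sets (RN N)"
      using measurable_sets[OF measurable_coordinate[where \<eta>="RN N" and N=N and t="Suc t", OF refl] A]
      by (simp add: A'_def vimage_def Int_def conj_commute)
    define F where "F z = indicator A (z (Suc t)) * ennreal (g' (restrict z {1..t}))" for z
    have Fm: "F \<in> borel_measurable (PiM {1..Suc t} m)"
    proof -
      have 1: "(\<lambda>z. z (Suc t)) \<in> borel_measurable (RN (Suc t))"
        by (rule measurable_component_singleton) simp
      have 2: "(\<lambda>z. g' (restrict z {1..t})) \<in> borel_measurable (RN (Suc t))"
        by (rule measurable_compose[OF measurable_restrict_RN[OF refl] g']) simp
      have "F \<in> borel_measurable (RN (Suc t))"
        unfolding F_def using measurable_compose[OF 1 borel_measurable_indicator[OF A]] 2 by measurable
      then show ?thesis by (simp only: measurable_cong_sets[OF sets_PiM_m refl])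
    qed
    have "{p \<in> space \<gamma>. fst p (Suc t) \<in> A \<and> restrict (snd p) {1..t} \<in> B}
        = {p \<in> space \<gamma>. fst p \<in> A' \<and> snd p \<in> B'}"
      by (auto simp: space_\<gamma> A'_def B'_def)
    then have "emeasure \<gamma> {p \<in> space \<gamma>. fst p (Suc t) \<in> A \<and> restrict (snd p) {1..t} \<in> B}
        = (\<integral>\<^sup>+x\<in>A'. emeasure (\<kappa> x) B' \<partial>\<mu>)"
      using cl A' B' unfolding is_cond_law_def distr_fst by simp
    also have "\<dots> = (\<integral>\<^sup>+x. F (restrict x {1..Suc t}) \<partial>\<mu>)"
    proof (rule nn_integral_cong_AE)
      show "AE x in \<mu>. emeasure (\<kappa> x) B' * indicator A' x = F (restrict x {1..Suc t})"
        using gB AE_space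
      proof eventually_elim
        case (elim x)
        then have x: "x \<in> space (RN N)" using spm by simp
        interpret K: prob_space "\<kappa> x"
          using cl measurable_space[of \<kappa> "RN N" "prob_algebra (RN N)" x] x
          by (auto simp: is_cond_law_def space_prob_algebra)
        have "restrict (restrict x {1..Suc t}) {1..t} = restrict x {1..t}" by (auto simp: fun_eq_iff)
        then show ?case
          using elim x gg'[OF x] by (auto simp: F_def A'_def indicator_def K.emeasure_eq_measure)
      qed
    qed
    also have "\<dots> = (\<integral>\<^sup>+x. F (restrict x {1..Suc t}) \<partial>PiM {1..N} m)"
      by (subst product) simp
    also have "\<dots> = (\<integral>\<^sup>+z. F z \<partial>PiM {1..Suc t} m)"
      by (rule nn_integral_PiM_restrict[OF prob_space_m _ Fm]) (use t in simp)
    also have "\<dots> = (\<integral>\<^sup>+z. \<integral>\<^sup>+a. F (z(Suc t := a)) \<partial>m (Suc t) \<partial>PiM {1..t} m)"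
      by (rule nn_integral_PiM_Suc[OF prob_space_m Fm])
    also have "\<dots> = (\<integral>\<^sup>+z. emeasure (m (Suc t)) A * ennreal (g' z) \<partial>PiM {1..t} m)"
    proof (rule nn_integral_cong)
      fix z assume z: "z \<in> space (PiM {1..t} m)"
      have "(\<integral>\<^sup>+a. F (z(Suc t := a)) \<partial>m (Suc t)) = (\<integral>\<^sup>+a. indicator A a * ennreal (g' z) \<partial>m (Suc t))"
        unfolding F_def restrict_upd_Suc[OF z] by simp
      also have "\<dots> = emeasure (m (Suc t)) A * ennreal (g' z)"
        using A by (subst nn_integral_multc) (simp_all add: sets_m measurable_cong_sets[OF sets_m refl])
      finally show "(\<integral>\<^sup>+a. F (z(Suc t := a)) \<partial>m (Suc t)) = emeasure (m (Suc t)) A * ennreal (g' z)" .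
    qed
    also have "\<dots> = emeasure (m (Suc t)) A * (\<integral>\<^sup>+z. ennreal (g' z) \<partial>PiM {1..t} m)"
      by (rule nn_integral_cmult) (simp only: measurable_cong_sets[OF sets_PiM_m refl], measurable)
    finally show "emeasure \<gamma> {p \<in> space \<gamma>. fst p (Suc t) \<in> A \<and> restrict (snd p) {1..t} \<in> B}
        = emeasure (m (Suc t)) A * (\<integral>\<^sup>+z. ennreal (g' z) \<partial>PiM {1..t} m)" .
  qed
qed

lemma independent_next_coord:
  assumes t: "t < N" and A: "A \<in> sets borel" and B: "B \<in> sets (RN t)"
  shows "emeasure \<gamma> {p \<in> space \<gamma>. fst p (Suc t) \<in> A \<and> restrict (snd p) {1..t} \<in> B}
    = emeasure (m (Suc t)) A * emeasure (hist_law \<nu> t) B"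
proof -
  obtain c where c: "\<And>A. A \<in> sets borel \<Longrightarrow> emeasure \<gamma> {p \<in> space \<gamma>. fst p (Suc t) \<in> A \<and> restrict (snd p) {1..t} \<in> B}
    = emeasure (m (Suc t)) A * c"
    using independent_next_coord_aux[OF t B] by blast
  have "c = emeasure \<gamma> {p \<in> space \<gamma>. restrict (snd p) {1..t} \<in> B}"
    using c[of UNIV] prob_space.emeasure_space_1[OF prob_space_m[of "Suc t"]] by (simp add: space_m)
  also have "\<dots> = emeasure (hist_law \<nu> t) B"
    using t B measurable_coords(3)[OF t, of t] unfolding distr_hist[OF less_imp_le[OF t], symmetric]
    by (subst emeasure_distr) (auto intro!: arg_cong[where f="emeasure \<gamma>"])
  finally show ?thesis using c[OF A] by simp
qed

lemma distr_next_coord: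
  assumes t: "t < N"
  shows "distr \<gamma> (borel \<Otimes>\<^sub>M RN t) (\<lambda>p. (fst p (Suc t), restrict (snd p) {1..t})) = m (Suc t) \<Otimes>\<^sub>M hist_law \<nu> t"
proof (rule pair_measure_eqI[symmetric])
  show "sigma_finite_measure (m (Suc t))" by (rule prob_space_imp_sigma_finite[OF prob_space_m])
  show "sigma_finite_measure (hist_law \<nu> t)"
    by (rule prob_space_imp_sigma_finite[OF prob_space_hist_law[OF \<nu>]]) (use t in simp)
  show "sets (m (Suc t) \<Otimes>\<^sub>M hist_law \<nu> t) = sets (distr \<gamma> (borel \<Otimes>\<^sub>M RN t) (\<lambda>p. (fst p (Suc t), restrict (snd p) {1..t})))"
    by (simp, rule sets_pair_measure_cong) (simp_all add: sets_m)
  fix A B assume "A \<in> sets (m (Suc t))" "B \<in> sets (hist_law \<nu> t)"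
  then have A: "A \<in> sets borel" and B: "B \<in> sets (RN t)" by (simp_all add: sets_m)
  have j: "(\<lambda>p. (fst p (Suc t), restrict (snd p) {1..t})) \<in> \<gamma> \<rightarrow>\<^sub>M borel \<Otimes>\<^sub>M RN t"
    using t by (intro measurable_Pair measurable_coords) simp_all
  have "emeasure (distr \<gamma> (borel \<Otimes>\<^sub>M RN t) (\<lambda>p. (fst p (Suc t), restrict (snd p) {1..t}))) (A \<times> B)
     = emeasure \<gamma> ((\<lambda>p. (fst p (Suc t), restrict (snd p) {1..t})) -` (A \<times> B) \<inter> space \<gamma>)"
    by (rule emeasure_distr[OF j]) (use A B in simp)
  also have "(\<lambda>p. (fst p (Suc t), restrict (snd p) {1..t})) -` (A \<times> B) \<inter> space \<gamma>
     = {p \<in> space \<gamma>. fst p (Suc t) \<in> A \<and> restrict (snd p) {1..t} \<in> B}" by blast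
  finally show "emeasure (m (Suc t)) A * emeasure (hist_law \<nu> t) B
     = emeasure (distr \<gamma> (borel \<Otimes>\<^sub>M RN t) (\<lambda>p. (fst p (Suc t), restrict (snd p) {1..t}))) (A \<times> B)"
    unfolding independent_next_coord[OF t A B] by (rule sym)
qed

text \<open>The rule produces y_{t+1} from x_{t+1}, a fresh uniform and y_1, ..., y_t. It forgets
  x_1, ..., x_t, and this is where the new coupling departs from \<gamma>.\<close>

definition forward_rule :: "nat \<Rightarrow> (real \<times> real \<Rightarrow> (nat \<Rightarrow> real) \<Rightarrow> real) \<Rightarrow> bool" where
  "forward_rule t g \<longleftrightarrow> (\<lambda>z. g (fst z) (snd z)) \<in> borel_measurable ((m (Suc t) \<Otimes>\<^sub>M U01) \<Otimes>\<^sub>M RN t) \<and>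
    (\<forall>f\<in>borel_measurable ((borel \<Otimes>\<^sub>M RN t) \<Otimes>\<^sub>M borel).
      (\<integral>\<^sup>+p. f ((fst p (Suc t), restrict (snd p) {1..t}), snd p (Suc t)) \<partial>\<gamma>)
        = (\<integral>\<^sup>+y. \<integral>\<^sup>+a. f ((fst a, y), g a y) \<partial>(m (Suc t) \<Otimes>\<^sub>M U01) \<partial>hist_law \<nu> t))"

text \<open>The transfer takes the pair (x_{t+1}, (y_1, ..., y_t)) as the given variable. Its law is
  a product by independence, so x_{t+1} can be moved from the condition into the noise.\<close>

lemma forward_step:
  assumes t: "t < N"
  shows "\<exists>g. forward_rule t g"
proof -
  have j: "(\<lambda>p. (fst p (Suc t), restrict (snd p) {1..t})) \<in> \<gamma> \<rightarrow>\<^sub>M borel \<Otimes>\<^sub>M RN t"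
    using t by (intro measurable_Pair measurable_coords) simp_all
  obtain \<psi> where \<psi>: "\<psi> \<in> borel_measurable ((borel \<Otimes>\<^sub>M RN t) \<Otimes>\<^sub>M borel)"
    and eq: "\<And>f. f \<in> borel_measurable ((borel \<Otimes>\<^sub>M RN t) \<Otimes>\<^sub>M borel) \<Longrightarrow>
      (\<integral>\<^sup>+p. f ((fst p (Suc t), restrict (snd p) {1..t}), snd p (Suc t)) \<partial>\<gamma>)
        = (\<integral>\<^sup>+w. \<integral>\<^sup>+u. f (w, \<psi> (w, u)) \<partial>U01 \<partial>(m (Suc t) \<Otimes>\<^sub>M hist_law \<nu> t))"
    by (rule nn_integral_transfer_real[OF prob_space_\<gamma> j measurable_coords(2)[OF t], unfolded distr_next_coord[OF t]]) blast
  interpret U: prob_space U01 by (rule prob_space_U01)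
  interpret M: prob_space "m (Suc t)" by (rule prob_space_m)
  interpret H: prob_space "hist_law \<nu> t" by (rule prob_space_hist_law[OF \<nu>]) (use t in simp)
  interpret MH: pair_sigma_finite "m (Suc t)" "hist_law \<nu> t" ..
  define g where "g a y = \<psi> ((fst a, y), snd a)" for a y
  have fst_m: "fst \<in> m (Suc t) \<Otimes>\<^sub>M U01 \<rightarrow>\<^sub>M borel"
    using measurable_fst[of "m (Suc t)" U01] by (simp add: measurable_cong_sets[OF refl sets_m])
  have snd_m: "snd \<in> m (Suc t) \<Otimes>\<^sub>M U01 \<rightarrow>\<^sub>M borel"
    using measurable_snd[of "m (Suc t)" U01] by (subst (asm) measurable_cong_sets[of _ _ U01 borel]) simp_all
  have gm: "(\<lambda>z. g (fst z) (snd z)) \<in> borel_measurable ((m (Suc t) \<Otimes>\<^sub>M U01) \<Otimes>\<^sub>M RN t)"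
    unfolding g_def
    by (intro measurable_compose[OF _ \<psi>] measurable_Pair measurable_snd
        measurable_compose[OF measurable_fst fst_m] measurable_compose[OF measurable_fst snd_m])
  moreover have "(\<integral>\<^sup>+p. f ((fst p (Suc t), restrict (snd p) {1..t}), snd p (Suc t)) \<partial>\<gamma>)
        = (\<integral>\<^sup>+y. \<integral>\<^sup>+a. f ((fst a, y), g a y) \<partial>(m (Suc t) \<Otimes>\<^sub>M U01) \<partial>hist_law \<nu> t)"
    if f: "f \<in> borel_measurable ((borel \<Otimes>\<^sub>M RN t) \<Otimes>\<^sub>M borel)" for f
  proof -
    have s1: "sets (m (Suc t) \<Otimes>\<^sub>M hist_law \<nu> t) = sets (borel \<Otimes>\<^sub>M RN t)"
      by (rule sets_pair_measure_cong) (simp_all add: sets_m)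
    have f2: "(\<lambda>p. f (fst p, \<psi> (fst p, snd p))) \<in> borel_measurable ((borel \<Otimes>\<^sub>M RN t) \<Otimes>\<^sub>M borel)"
      by (intro measurable_compose[OF _ f] measurable_Pair measurable_fst) (use \<psi> in simp)
    have s2: "sets ((borel \<Otimes>\<^sub>M RN t) \<Otimes>\<^sub>M borel) = sets ((m (Suc t) \<Otimes>\<^sub>M hist_law \<nu> t) \<Otimes>\<^sub>M U01)"
      by (rule sets_pair_measure_cong[OF s1[symmetric]]) simp
    have f3: "(\<lambda>w. \<integral>\<^sup>+u. f (w, \<psi> (w, u)) \<partial>U01) \<in> borel_measurable (m (Suc t) \<Otimes>\<^sub>M hist_law \<nu> t)"
      using f2 unfolding measurable_cong_sets[OF s2 refl]
      by (intro U.borel_measurable_nn_integral) (simp add: split_beta')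
    have "(\<integral>\<^sup>+w. \<integral>\<^sup>+u. f (w, \<psi> (w, u)) \<partial>U01 \<partial>(m (Suc t) \<Otimes>\<^sub>M hist_law \<nu> t))
       = (\<integral>\<^sup>+y. \<integral>\<^sup>+x. \<integral>\<^sup>+u. f ((x, y), \<psi> ((x, y), u)) \<partial>U01 \<partial>m (Suc t) \<partial>hist_law \<nu> t)"
      by (rule MH.nn_integral_snd[symmetric, OF f3])
    also have "\<dots> = (\<integral>\<^sup>+y. \<integral>\<^sup>+a. f ((fst a, y), g a y) \<partial>(m (Suc t) \<Otimes>\<^sub>M U01) \<partial>hist_law \<nu> t)"
    proof (rule nn_integral_cong)
      fix y assume "y \<in> space (hist_law \<nu> t)"
      then have y: "y \<in> space (RN t)" by simp
      have "(\<lambda>a. ((fst a, y), snd a)) \<in> m (Suc t) \<Otimes>\<^sub>M U01 \<rightarrow>\<^sub>M (borel \<Otimes>\<^sub>M RN t) \<Otimes>\<^sub>M borel"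
        using y by (intro measurable_Pair fst_m snd_m) simp
      from measurable_compose[OF this f2]
      have "(\<lambda>a. f ((fst a, y), g a y)) \<in> borel_measurable (m (Suc t) \<Otimes>\<^sub>M U01)" by (simp add: g_def)
      from U.nn_integral_fst[OF this]
      show "(\<integral>\<^sup>+x. \<integral>\<^sup>+u. f ((x, y), \<psi> ((x, y), u)) \<partial>U01 \<partial>m (Suc t)) = (\<integral>\<^sup>+a. f ((fst a, y), g a y) \<partial>(m (Suc t) \<Otimes>\<^sub>M U01))"
        by (simp add: g_def)
    qed
    finally show ?thesis using eq[OF f] by simp
  qed
  ultimately show ?thesis unfolding forward_rule_def by blast
qed

definition backward_rule :: "nat \<Rightarrow> ((nat \<Rightarrow> real) \<times> real \<Rightarrow> real) \<Rightarrow> bool" where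
  "backward_rule t \<xi> \<longleftrightarrow> \<xi> \<in> borel_measurable (RN (Suc t) \<Otimes>\<^sub>M borel) \<and>
    (\<forall>f\<in>borel_measurable (RN (Suc t) \<Otimes>\<^sub>M borel).
      (\<integral>\<^sup>+p. f (restrict (snd p) {1..Suc t}, fst p (Suc t)) \<partial>\<gamma>)
        = (\<integral>\<^sup>+y. \<integral>\<^sup>+w. f (y, \<xi> (y, w)) \<partial>U01 \<partial>hist_law \<nu> (Suc t)))"

lemma backward_step:
  assumes t: "t < N"
  shows "\<exists>\<xi>. backward_rule t \<xi>"
proof -
  have "Suc t \<le> N" using t by simp
  show ?thesis
    unfolding backward_rule_def
    by (rule nn_integral_transfer_real[OF prob_space_\<gamma> measurable_coords(3)[OF t \<open>Suc t \<le> N\<close>] measurable_coords(1)[OF t],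
          unfolded distr_hist[OF \<open>Suc t \<le> N\<close>]]) blast
qed

text \<open>Forward and backward rules are two descriptions of the same law under \<gamma>, that of
  (x_{t+1}, y_1, ..., y_{t+1}). The forward rules define the construction, and this common law makes
  the backward rules valid for its reverse direction.\<close>

lemma bicausal_improvement:
  "\<exists>G. forward_construction N m \<nu> G
    \<and> (\<forall>t<N. forward_rule t (G (Suc t)))
    \<and> forward_construction.coupling N m G \<in> bicausal_couplings N \<mu> \<nu>"
proof -
  obtain g where "\<And>t. t < N \<Longrightarrow> forward_rule t (g t)" using forward_step by metis
  then have g: "\<And>t. t < N \<Longrightarrow> (\<lambda>z. g t (fst z) (snd z)) \<in> borel_measurable ((m (Suc t) \<Otimes>\<^sub>M U01) \<Otimes>\<^sub>M RN t)"
    and law: "\<And>t f. t < N \<Longrightarrow> f \<in> borel_measurable ((borel \<Otimes>\<^sub>M RN t) \<Otimes>\<^sub>M borel) \<Longrightarrow>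
      (\<integral>\<^sup>+p. f ((fst p (Suc t), restrict (snd p) {1..t}), snd p (Suc t)) \<partial>\<gamma>)
        = (\<integral>\<^sup>+y. \<integral>\<^sup>+a. f ((fst a, y), g t a y) \<partial>(m (Suc t) \<Otimes>\<^sub>M U01) \<partial>hist_law \<nu> t)"
    unfolding forward_rule_def by blast+
  obtain x where "\<And>t. t < N \<Longrightarrow> backward_rule t (x t)" using backward_step by metis
  then have x: "\<And>t. t < N \<Longrightarrow> x t \<in> borel_measurable (RN (Suc t) \<Otimes>\<^sub>M borel)"
    and xlaw: "\<And>t f. t < N \<Longrightarrow> f \<in> borel_measurable (RN (Suc t) \<Otimes>\<^sub>M borel) \<Longrightarrow>
      (\<integral>\<^sup>+p. f (restrict (snd p) {1..Suc t}, fst p (Suc t)) \<partial>\<gamma>)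
        = (\<integral>\<^sup>+y. \<integral>\<^sup>+w. f (y, x t (y, w)) \<partial>U01 \<partial>hist_law \<nu> (Suc t))"
    unfolding backward_rule_def by blast+
  \<comment> \<open>The rules were chosen by the number of past steps, whereas the construction
    numbers them by the coordinate produced.\<close>
  define G where "G s = g (s - 1)" for s
  have G_Suc: "G (Suc t) = g t" for t by (simp add: G_def)
  have upd: "(\<lambda>p. (snd (fst p))(Suc t := snd p)) \<in> (borel \<Otimes>\<^sub>M RN t) \<Otimes>\<^sub>M borel \<rightarrow>\<^sub>M RN (Suc t)" for t
    by (intro measurable_upd_Suc measurable_compose[OF measurable_fst measurable_snd] measurable_snd)
  have upd_restrict: "(restrict y {1..t})(Suc t := y (Suc t)) = restrict y {1..Suc t}" for y :: "nat \<Rightarrow> real" and t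
    by (auto simp: fun_eq_iff)
  have F: "forward_construction N m \<nu> G"
    unfolding forward_construction_def forward_construction_axioms_def sequential_construction_def
  proof (intro conjI allI impI)
    show "prob_space (m t \<Otimes>\<^sub>M U01)" for t by (rule prob_space_pair[OF prob_space_m prob_space_U01])
    show "prob_space \<nu>" "sets \<nu> = sets (RN N)" by (rule \<nu>)+
    show "(\<lambda>z. G (Suc t) (fst z) (snd z)) \<in> borel_measurable ((m (Suc t) \<Otimes>\<^sub>M U01) \<Otimes>\<^sub>M RN t)" if "t < N" for t
      unfolding G_Suc by (rule g[OF that])
    show "real_distribution (m t)" for t by (rule real_distribution_m)
    fix t and h :: "(nat \<Rightarrow> real) \<Rightarrow> ennreal" assume t: "t < N" and h: "h \<in> borel_measurable (RN (Suc t))"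
    have "(\<integral>\<^sup>+y. \<integral>\<^sup>+a. h (y(Suc t := G (Suc t) a y)) \<partial>(m (Suc t) \<Otimes>\<^sub>M U01) \<partial>hist_law \<nu> t)
      = (\<integral>\<^sup>+p. h ((restrict (snd p) {1..t})(Suc t := snd p (Suc t))) \<partial>\<gamma>)"
      unfolding G_Suc using law[OF t measurable_compose[OF upd h]] by simp
    also have "\<dots> = (\<integral>\<^sup>+p. h (restrict (snd p) {1..Suc t}) \<partial>\<gamma>)" unfolding upd_restrict ..
    also have "\<dots> = (\<integral>\<^sup>+y. h y \<partial>distr \<gamma> (RN (Suc t)) (\<lambda>p. restrict (snd p) {1..Suc t}))"
      by (rule nn_integral_distr[OF measurable_coords(3)[OF t], symmetric]) (use t h in simp_all)
    also have "\<dots> = (\<integral>\<^sup>+y. h y \<partial>hist_law \<nu> (Suc t))" by (subst distr_hist) (use t in simp_all)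
    finally show "(\<integral>\<^sup>+y. \<integral>\<^sup>+a. h (y(Suc t := G (Suc t) a y)) \<partial>(m (Suc t) \<Otimes>\<^sub>M U01) \<partial>hist_law \<nu> t) = (\<integral>\<^sup>+y. h y \<partial>hist_law \<nu> (Suc t))" .
  qed
  define \<xi> where "\<xi> s = x (s - 1)" for s
  have xi_Suc: "\<xi> (Suc t) = x t" for t by (simp add: \<xi>_def)
  have "forward_construction.coupling N m G \<in> bicausal_couplings N (PiM {1..N} m) \<nu>"
  proof (rule forward_construction.coupling_bicausal[OF F, where \<xi>=\<xi>])
    show "\<xi> (Suc t) \<in> borel_measurable (RN (Suc t) \<Otimes>\<^sub>M borel)" if "t < N" for t
      unfolding xi_Suc by (rule x[OF that])
    fix t and f :: "(nat \<Rightarrow> real) \<times> real \<Rightarrow> ennreal" assume t: "t < N" and f: "f \<in> borel_measurable (RN (Suc t) \<Otimes>\<^sub>M borel)"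
    have "(\<lambda>p. f ((snd (fst p))(Suc t := snd p), fst (fst p))) \<in> borel_measurable ((borel \<Otimes>\<^sub>M RN t) \<Otimes>\<^sub>M borel)"
      by (intro measurable_compose[OF _ f] measurable_Pair upd measurable_compose[OF measurable_fst measurable_fst])
    from law[OF t this]
    have "(\<integral>\<^sup>+y. \<integral>\<^sup>+a. f (y(Suc t := G (Suc t) a y), fst a) \<partial>(m (Suc t) \<Otimes>\<^sub>M U01) \<partial>hist_law \<nu> t)
      = (\<integral>\<^sup>+p. f ((restrict (snd p) {1..t})(Suc t := snd p (Suc t)), fst p (Suc t)) \<partial>\<gamma>)"
      unfolding G_Suc by simp
    also have "\<dots> = (\<integral>\<^sup>+p. f (restrict (snd p) {1..Suc t}, fst p (Suc t)) \<partial>\<gamma>)" unfolding upd_restrict ..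
    also have "\<dots> = (\<integral>\<^sup>+y. \<integral>\<^sup>+w. f (y, \<xi> (Suc t) (y, w)) \<partial>U01 \<partial>hist_law \<nu> (Suc t))"
      unfolding xi_Suc by (rule xlaw[OF t f])
    finally show "(\<integral>\<^sup>+y. \<integral>\<^sup>+a. f (y(Suc t := G (Suc t) a y), fst a) \<partial>(m (Suc t) \<Otimes>\<^sub>M U01) \<partial>hist_law \<nu> t)
      = (\<integral>\<^sup>+y. \<integral>\<^sup>+w. f (y, \<xi> (Suc t) (y, w)) \<partial>U01 \<partial>hist_law \<nu> (Suc t))" .
  qed
  then have "forward_construction.coupling N m G \<in> bicausal_couplings N \<mu> \<nu>" using product by simp
  then show ?thesis using F g law unfolding forward_rule_def G_Suc[symmetric] by blast
qed

end

section \<open>Conditional laws generated by a construction\<close>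

context sequential_construction
begin

lemma distr_path_hist:
  assumes "t \<le> N"
  shows "distr (PiM {1..N} R) (RN t) (\<lambda>z. seq_path G z t) = hist_law \<nu> t"
proof -
  have "hist_law \<nu> t = distr (distr (PiM {1..N} R) (RN N) (\<lambda>z. seq_path G z N)) (RN t) (\<lambda>y. restrict y {1..t})"
    unfolding hist_law_def distr_path ..
  also have "\<dots> = distr (PiM {1..N} R) (RN t) (\<lambda>z. restrict (seq_path G z N) {1..t})"
    by (subst distr_distr[OF measurable_restrict_RN[OF refl assms] measurable_path]) (simp_all add: comp_def)
  finally show ?thesis unfolding seq_path_restrict[OF assms] by simp
qed

lemma AE_path:
  assumes "t \<le> N" "AE y in hist_law \<nu> t. P y"
  shows "AE z in PiM {1..N} R. P (seq_path G z t)"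
proof -
  have m: "(\<lambda>z. seq_path G z t) \<in> PiM {1..N} R \<rightarrow>\<^sub>M RN t" by (rule measurable_path) (use assms in auto)
  show ?thesis by (rule AE_distrD[OF m]) (unfold distr_path_hist[OF assms(1)], rule assms(2))
qed

text \<open>With \<open>cond_law_unique\<close> this identifies the versions fixed in
  \<open>cond_coord\<close>, almost everywhere, with the laws produced by the step functions of any
  construction of \<nu>.\<close>

lemma is_cond_law_step:
  assumes t: "t < N"
  shows "is_cond_law \<nu> (\<lambda>x. restrict x {1..t}) (RN t) (\<lambda>x. x (Suc t)) borel
    (\<lambda>y. distr (R (Suc t)) borel (\<lambda>a. G (Suc t) a y))"
  unfolding is_cond_law_def
proof (intro conjI ballI)
  interpret R: prob_space "R (Suc t)" by (rule R)
  have Gm: "(\<lambda>(y, a). G (Suc t) a y) \<in> borel_measurable (RN t \<Otimes>\<^sub>M R (Suc t))"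
    using measurable_compose[OF measurable_pair_swap' G[OF t]] by (simp add: split_beta')
  show "(\<lambda>y. distr (R (Suc t)) borel (\<lambda>a. G (Suc t) a y)) \<in> RN t \<rightarrow>\<^sub>M prob_algebra borel"
    by (rule measurable_distr_prob_space2[OF _ Gm]) (simp add: space_prob_algebra R)
  fix A and B :: "real set" assume A: "A \<in> sets (RN t)" and B: "B \<in> sets borel"
  define h where "h y = (indicator A (restrict y {1..t}) * indicator B (y (Suc t)) :: ennreal)" for y :: "nat \<Rightarrow> real"
  have r: "(\<lambda>y. restrict y {1..t}) \<in> RN (Suc t) \<rightarrow>\<^sub>M RN t" by (rule measurable_restrict_RN[OF refl]) simp
  have c: "(\<lambda>y. y (Suc t)) \<in> borel_measurable (RN (Suc t))" by (rule measurable_component_singleton) simp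
  have h: "h \<in> borel_measurable (RN (Suc t))"
    unfolding h_def using measurable_compose[OF r borel_measurable_indicator[OF A]]
      measurable_compose[OF c borel_measurable_indicator[OF B]]
    by (intro borel_measurable_times_ennreal) simp_all
  have AB: "{x \<in> space \<nu>. restrict x {1..t} \<in> A \<and> x (Suc t) \<in> B} \<in> sets \<nu>"
  proof -
    have "(\<lambda>x. restrict x {1..t}) -` A \<inter> space \<nu> \<inter> ((\<lambda>x. x (Suc t)) -` B \<inter> space \<nu>) \<in> sets \<nu>"
      by (intro sets.Int measurable_sets[OF measurable_restrict_RN[OF \<nu>(2)] A]
          measurable_sets[OF measurable_coordinate[OF \<nu>(2)] B]) (use t in simp)
    then show ?thesis by (rule back_subst[where P="\<lambda>S. S \<in> sets \<nu>"]) auto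
  qed
  have "emeasure \<nu> {x \<in> space \<nu>. restrict x {1..t} \<in> A \<and> x (Suc t) \<in> B}
      = (\<integral>\<^sup>+x. indicator {x \<in> space \<nu>. restrict x {1..t} \<in> A \<and> x (Suc t) \<in> B} x \<partial>\<nu>)"
    by (rule nn_integral_indicator[OF AB, symmetric])
  also have "\<dots> = (\<integral>\<^sup>+x. h (restrict x {1..Suc t}) \<partial>\<nu>)"
  proof (rule nn_integral_cong)
    fix x assume "x \<in> space \<nu>"
    moreover have "restrict (restrict x {1..Suc t}) {1..t} = restrict x {1..t}" by (auto simp: fun_eq_iff)
    ultimately show "indicator {x \<in> space \<nu>. restrict x {1..t} \<in> A \<and> x (Suc t) \<in> B} x = h (restrict x {1..Suc t})"
      unfolding h_def by (simp add: indicator_def)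
  qed
  also have "\<dots> = (\<integral>\<^sup>+y. h y \<partial>hist_law \<nu> (Suc t))"
    by (rule nn_integral_hist_law[OF \<nu>(2) _ h, symmetric]) (use t in simp)
  also have "\<dots> = (\<integral>\<^sup>+y. \<integral>\<^sup>+a. h (y(Suc t := G (Suc t) a y)) \<partial>R (Suc t) \<partial>hist_law \<nu> t)"
    by (rule law[OF t h, symmetric])
  also have "\<dots> = (\<integral>\<^sup>+y\<in>A. emeasure (distr (R (Suc t)) borel (\<lambda>a. G (Suc t) a y)) B \<partial>hist_law \<nu> t)"
  proof (rule nn_integral_cong)
    fix y assume "y \<in> space (hist_law \<nu> t)"
    then have y: "y \<in> space (RN t)" by simp
    have Gy: "(\<lambda>a. G (Suc t) a y) \<in> borel_measurable (R (Suc t))" using measurable_Pair2[OF Gm y] by simp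
    have "(\<integral>\<^sup>+a. h (y(Suc t := G (Suc t) a y)) \<partial>R (Suc t)) = (\<integral>\<^sup>+a. indicator A y * indicator B (G (Suc t) a y) \<partial>R (Suc t))"
      unfolding h_def restrict_upd_Suc[OF y] by simp
    also have "\<dots> = indicator A y * (\<integral>\<^sup>+a. indicator B (G (Suc t) a y) \<partial>R (Suc t))"
      by (rule nn_integral_cmult) (rule measurable_compose[OF Gy borel_measurable_indicator[OF B]])
    also have "(\<integral>\<^sup>+a. indicator B (G (Suc t) a y) \<partial>R (Suc t)) = emeasure (distr (R (Suc t)) borel (\<lambda>a. G (Suc t) a y)) B"
      by (rule emeasure_distr_nn_integral[OF Gy B, symmetric])
    finally show "(\<integral>\<^sup>+a. h (y(Suc t := G (Suc t) a y)) \<partial>R (Suc t))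
      = emeasure (distr (R (Suc t)) borel (\<lambda>a. G (Suc t) a y)) B * indicator A y" by (simp only: mult.commute)
  qed
  finally show "emeasure \<nu> {x \<in> space \<nu>. restrict x {1..t} \<in> A \<and> x (Suc t) \<in> B}
    = (\<integral>\<^sup>+y\<in>A. emeasure (distr (R (Suc t)) borel (\<lambda>a. G (Suc t) a y)) B \<partial>distr \<nu> (RN t) (\<lambda>x. restrict x {1..t}))"
    unfolding hist_law_def .
qed

end

section \<open>The Knothe-Rosenblatt rearrangement\<close>

lemma is_cond_law_cond_coord:
  assumes \<eta>: "prob_space \<eta>" "sets \<eta> = sets (RN N)" and t: "t < N"
  shows "is_cond_law \<eta> (\<lambda>x. restrict x {1..t}) (RN t) (\<lambda>x. x (Suc t)) borel (cond_coord \<eta> (Suc t))"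
proof (cases "t = 0")
  \<comment> \<open>At the first coordinate the history space is a single point and the kernel is
    the constant marginal, so nothing is chosen and the identity is checked directly.\<close>
  case True
  interpret \<eta>: prob_space \<eta> by fact
  interpret M: real_distribution "marginal \<eta> (Suc 0)" by (rule real_distribution_marginal[OF \<eta>])
  have e: "cond_coord \<eta> (Suc 0) = (\<lambda>_. marginal \<eta> (Suc 0))" by (simp add: cond_coord_def)
  have r: "restrict x {1..0::nat} = (\<lambda>_. undefined)" for x :: "nat \<Rightarrow> real" by auto
  have c: "(\<lambda>x. x (Suc 0)) \<in> borel_measurable \<eta>" by (rule measurable_coordinate[OF \<eta>(2)])
  show ?thesis
    unfolding is_cond_law_def True r e
  proof (intro conjI ballI)
    show "(\<lambda>_. marginal \<eta> (Suc 0)) \<in> RN 0 \<rightarrow>\<^sub>M prob_algebra borel"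
      by (rule measurable_const) (simp add: space_prob_algebra M.prob_space_axioms)
    fix A and B :: "real set" assume A: "A \<in> sets (RN 0)" and B: "B \<in> sets borel"
    have A1: "emeasure (distr \<eta> (RN 0) (\<lambda>x. \<lambda>_. undefined)) A = indicator A (\<lambda>_. undefined)"
      using A by (subst \<eta>.distr_const) (simp_all add: space_PiM)
    have "emeasure \<eta> {x \<in> space \<eta>. (\<lambda>_. undefined) \<in> A \<and> x (Suc 0) \<in> B} = indicator A (\<lambda>_. undefined) * emeasure (marginal \<eta> (Suc 0)) B"
      using B c by (auto simp: marginal_def emeasure_distr indicator_def vimage_def Int_def conj_commute)
    also have "\<dots> = (\<integral>\<^sup>+x\<in>A. emeasure (marginal \<eta> (Suc 0)) B \<partial>distr \<eta> (RN 0) (\<lambda>x. \<lambda>_. undefined))"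
      by (subst nn_integral_cmult_indicator) (use A A1 in \<open>simp_all add: mult.commute\<close>)
    finally show "emeasure \<eta> {x \<in> space \<eta>. (\<lambda>_. undefined) \<in> A \<and> x (Suc 0) \<in> B}
      = (\<integral>\<^sup>+x\<in>A. emeasure (marginal \<eta> (Suc 0)) B \<partial>distr \<eta> (RN 0) (\<lambda>x. \<lambda>_. undefined))" .
  qed
next
  case False
  have "\<exists>\<kappa>. is_cond_law \<eta> (\<lambda>x. restrict x {1..t}) (RN t) (\<lambda>x. x (Suc t)) borel \<kappa>"
    by (rule cond_law_exists[OF \<eta>(1) measurable_restrict_RN[OF \<eta>(2)] measurable_coordinate[OF \<eta>(2)]]) (use t in simp)
  from someI_ex[OF this] show ?thesis using False by (simp add: cond_coord_def)
qed

lemma cond_coord_kernel: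
  assumes "prob_space \<eta>" "sets \<eta> = sets (RN N)" "t < N"
  shows "cond_coord \<eta> (Suc t) \<in> RN t \<rightarrow>\<^sub>M prob_algebra borel"
  using is_cond_law_cond_coord[OF assms] by (simp add: is_cond_law_def)

lemma KR_path_seq_path: "KR_path \<eta> u t = seq_path (\<lambda>t a y. quantile (cond_coord \<eta> t y) a) u t"
  by (induction t) simp_all

lemma sets_U01_pair: "sets (U01 \<Otimes>\<^sub>M M) = sets (borel \<Otimes>\<^sub>M M)"
  by (rule sets_pair_measure_cong) simp_all

text \<open>At a uniform level the quantile has the conditional law of the next coordinate, and
  averaging that law over the history gives the law of the longer history.\<close>

lemma KR_sequential_construction:
  assumes \<eta>: "prob_space \<eta>" "sets \<eta> = sets (RN N)"
  shows "sequential_construction N (\<lambda>_. U01) \<eta> (\<lambda>t a y. quantile (cond_coord \<eta> t y) a)"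
  unfolding sequential_construction_def
proof (intro conjI allI impI)
  fix t assume t: "t < N"
  note \<kappa> = cond_coord_kernel[OF \<eta> t]
  have "(\<lambda>z. quantile (cond_coord \<eta> (Suc t) (snd z)) (fst z)) \<in> borel_measurable (borel \<Otimes>\<^sub>M RN t)"
    using measurable_compose[OF measurable_pair_swap' measurable_quantile_kernel[OF \<kappa>]] by (simp add: split_beta')
  then show "(\<lambda>z. quantile (cond_coord \<eta> (Suc t) (snd z)) (fst z)) \<in> borel_measurable (U01 \<Otimes>\<^sub>M RN t)"
    unfolding measurable_cong_sets[OF sets_U01_pair refl] .
  fix h :: "(nat \<Rightarrow> real) \<Rightarrow> ennreal" assume h: "h \<in> borel_measurable (RN (Suc t))"
  have hm: "(\<lambda>p. h ((fst p)(Suc t := snd p))) \<in> borel_measurable (RN t \<Otimes>\<^sub>M borel)"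
    by (rule measurable_compose[OF measurable_upd_Suc[OF measurable_fst measurable_snd] h])
  have "(\<integral>\<^sup>+y. \<integral>\<^sup>+a. h (y(Suc t := quantile (cond_coord \<eta> (Suc t) y) a)) \<partial>U01 \<partial>hist_law \<eta> t)
    = (\<integral>\<^sup>+y. \<integral>\<^sup>+b. h (y(Suc t := b)) \<partial>cond_coord \<eta> (Suc t) y \<partial>hist_law \<eta> t)"
  proof (rule nn_integral_cong)
    fix y assume "y \<in> space (hist_law \<eta> t)"
    then have y: "y \<in> space (RN t)" by simp
    show "(\<integral>\<^sup>+a. h (y(Suc t := quantile (cond_coord \<eta> (Suc t) y) a)) \<partial>U01)
      = (\<integral>\<^sup>+b. h (y(Suc t := b)) \<partial>cond_coord \<eta> (Suc t) y)"
      by (rule nn_integral_quantile[OF real_distribution_kernel[OF \<kappa> y], where f="\<lambda>b. h (y(Suc t := b))"])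
         (use measurable_Pair2[OF hm y] in simp)
  qed
  also have "\<dots> = (\<integral>\<^sup>+x. h ((restrict x {1..t})(Suc t := x (Suc t))) \<partial>\<eta>)"
    unfolding hist_law_def
    using nn_integral_cond_law[OF \<eta>(1) measurable_restrict_RN[OF \<eta>(2)] measurable_coordinate[OF \<eta>(2)]
        is_cond_law_cond_coord[OF \<eta> t] hm] t by simp
  also have "\<dots> = (\<integral>\<^sup>+x. h (restrict x {1..Suc t}) \<partial>\<eta>)"
  proof -
    have "(restrict x {1..t})(Suc t := x (Suc t)) = restrict x {1..Suc t}" for x :: "nat \<Rightarrow> real"
      by (auto simp: fun_eq_iff)
    then show ?thesis by simp
  qed
  also have "\<dots> = (\<integral>\<^sup>+y. h y \<partial>hist_law \<eta> (Suc t))"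
    by (rule nn_integral_hist_law[OF \<eta>(2) _ h, symmetric]) (use t in simp)
  finally show "(\<integral>\<^sup>+y. \<integral>\<^sup>+a. h (y(Suc t := quantile (cond_coord \<eta> (Suc t) y) a)) \<partial>U01 \<partial>hist_law \<eta> t)
    = (\<integral>\<^sup>+y. h y \<partial>hist_law \<eta> (Suc t))" .
qed (use \<eta> prob_space_U01 in auto)

section \<open>The rearrangement for a product source\<close>

context product_source
begin

abbreviation "\<U> \<equiv> PiM {1..N} (\<lambda>_. U01)"

lemma hist_law_product:
  assumes "t \<le> N"
  shows "hist_law \<mu> t = PiM {1..t} m"
proof (rule measure_eqI)
  fix A assume "A \<in> sets (hist_law \<mu> t)"
  then have A: "A \<in> sets (RN t)" by simp
  have i: "indicator A \<in> borel_measurable (PiM {1..t} m)"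
    by (subst measurable_cong_sets[OF sets_PiM_m refl]) (rule borel_measurable_indicator[OF A])
  have "emeasure (hist_law \<mu> t) A = (\<integral>\<^sup>+x. indicator A (restrict x {1..t}) \<partial>\<mu>)"
    unfolding hist_law_def by (rule emeasure_distr_nn_integral[OF measurable_restrict_RN[OF \<mu>(2) assms] A])
  also have "\<dots> = (\<integral>\<^sup>+x. indicator A (restrict x {1..t}) \<partial>PiM {1..N} m)" by (subst product) simp
  also have "\<dots> = (\<integral>\<^sup>+x. indicator A x \<partial>PiM {1..t} m)"
    by (rule nn_integral_PiM_restrict[OF prob_space_m assms i])
  also have "\<dots> = emeasure (PiM {1..t} m) A"
    by (rule nn_integral_indicator) (simp only: sets_PiM_m A)
  finally show "emeasure (hist_law \<mu> t) A = emeasure (PiM {1..t} m) A" .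
qed (simp only: sets_hist_law sets_PiM_m)

text \<open>Taking the noise itself as the next coordinate, with noise drawn from the marginals, is
  a sequential construction of \<mu>; so the constant marginal is a version of the conditional law,
  and the fixed version agrees with it up to a null set of histories.\<close>

lemma cond_coord_product:
  assumes t: "t < N"
  shows "AE y in hist_law \<mu> t. cond_coord \<mu> (Suc t) y = m (Suc t)"
proof -
  interpret P: sequential_construction N m \<mu> "\<lambda>t a y. a"
    unfolding sequential_construction_def
  proof (intro conjI allI impI)
    fix t assume t: "t < N"
    show "(\<lambda>z. fst z) \<in> borel_measurable (m (Suc t) \<Otimes>\<^sub>M RN t)"
      using measurable_fst[of "m (Suc t)" "RN t"] by (simp add: measurable_cong_sets[OF refl sets_m])
    fix h :: "(nat \<Rightarrow> real) \<Rightarrow> ennreal" assume h: "h \<in> borel_measurable (RN (Suc t))"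
    then have "h \<in> borel_measurable (PiM {1..Suc t} m)" by (simp only: measurable_cong_sets[OF sets_PiM_m refl])
    from nn_integral_PiM_Suc[OF prob_space_m this]
    show "(\<integral>\<^sup>+y. \<integral>\<^sup>+a. h (y(Suc t := a)) \<partial>m (Suc t) \<partial>hist_law \<mu> t) = (\<integral>\<^sup>+y. h y \<partial>hist_law \<mu> (Suc t))"
      using t by (simp add: hist_law_product)
  qed (use \<mu> prob_space_m in auto)
  have id: "distr (m (Suc t)) borel (\<lambda>a. a) = m (Suc t)"
    by (rule distr_id2) (simp add: sets_m)
  have "AE y in distr \<mu> (RN t) (\<lambda>x. restrict x {1..t}). cond_coord \<mu> (Suc t) y = distr (m (Suc t)) borel (\<lambda>a. a)"
    by (rule cond_law_unique[OF \<mu>(1) measurable_restrict_RN[OF \<mu>(2)] is_cond_law_cond_coord[OF \<mu> t] P.is_cond_law_step[OF t]])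
       (use t in simp)
  then show ?thesis unfolding hist_law_def id .
qed

definition quantile_path :: "(nat \<Rightarrow> real) \<Rightarrow> nat \<Rightarrow> real" where
  "quantile_path u = (\<lambda>s\<in>{1..N}. quantile (m s) (u s))"

text \<open>Collects the finitely many exceptional events: extreme levels, and histories at which
  the fixed version differs from the marginal. Off their union the recursions can be compared
  pointwise in u.\<close>

lemma AE_regular:
  "AE u in \<U>. \<forall>t<N. cond_coord \<mu> (Suc t) (KR_path \<mu> u t) = m (Suc t) \<and> 0 < u (Suc t) \<and> u (Suc t) < 1"
proof -
  interpret K: sequential_construction N "\<lambda>_. U01" \<mu> "\<lambda>t a y. quantile (cond_coord \<mu> t y) a"
    by (rule KR_sequential_construction[OF \<mu>])
  have "AE u in \<U>. \<forall>t\<in>{..<N}. cond_coord \<mu> (Suc t) (KR_path \<mu> u t) = m (Suc t) \<and> 0 < u (Suc t) \<and> u (Suc t) < 1"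
  proof (rule eventually_ball_finite, simp, rule ballI)
    fix t assume "t \<in> {..<N}"
    then have t: "t < N" by simp
    have "AE u in \<U>. cond_coord \<mu> (Suc t) (KR_path \<mu> u t) = m (Suc t)"
      unfolding KR_path_seq_path by (rule K.AE_path) (use t cond_coord_product in auto)
    moreover have "AE u in \<U>. 0 < u (Suc t) \<and> u (Suc t) < 1"
      by (rule AE_PiM_component[OF prob_space_U01 _ AE_U01]) (use t in auto)
    ultimately show "AE u in \<U>. cond_coord \<mu> (Suc t) (KR_path \<mu> u t) = m (Suc t) \<and> 0 < u (Suc t) \<and> u (Suc t) < 1"
      by eventually_elim simp
  qed
  then show ?thesis by (simp add: Ball_def)
qed

lemma KR_path_eq_quantile_path:
  assumes "\<forall>t<N. cond_coord \<mu> (Suc t) (KR_path \<mu> u t) = m (Suc t) \<and> 0 < u (Suc t) \<and> u (Suc t) < 1"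
  shows "t \<le> N \<Longrightarrow> KR_path \<mu> u t = restrict (quantile_path u) {1..t}"
proof (induction t)
  case 0
  then show ?case by auto
next
  case (Suc t)
  have c: "cond_coord \<mu> (Suc t) (KR_path \<mu> u t) = m (Suc t)" using assms \<open>Suc t \<le> N\<close> by simp
  have "KR_path \<mu> u (Suc t) = (KR_path \<mu> u t)(Suc t := quantile (m (Suc t)) (u (Suc t)))"
    unfolding KR_path.simps c ..
  also have "\<dots> = (restrict (quantile_path u) {1..t})(Suc t := quantile (m (Suc t)) (u (Suc t)))"
    using Suc.IH Suc.prems by (simp only: Suc_leD)
  also have "\<dots> = restrict (quantile_path u) {1..Suc t}"
    using Suc.prems by (auto simp: fun_eq_iff quantile_path_def)
  finally show ?case .
qed

lemma measurable_quantile_path: "quantile_path \<in> \<U> \<rightarrow>\<^sub>M RN N"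
  unfolding quantile_path_def
proof (rule measurable_restrict)
  fix s assume "s \<in> {1..N}"
  then have "(\<lambda>u. u s) \<in> \<U> \<rightarrow>\<^sub>M U01" by (rule measurable_component_singleton)
  from measurable_compose[OF this, of "quantile (m s)" borel]
  show "(\<lambda>u. quantile (m s) (u s)) \<in> borel_measurable \<U>"
    using real_distribution.measurable_quantile[OF real_distribution_m[of s]] by simp
qed

lemma measurable_KR_path:
  assumes "prob_space \<eta>" "sets \<eta> = sets (RN N)"
  shows "(\<lambda>u. KR_path \<eta> u N) \<in> \<U> \<rightarrow>\<^sub>M RN N"
proof -
  interpret K: sequential_construction N "\<lambda>_. U01" \<eta> "\<lambda>t a y. quantile (cond_coord \<eta> t y) a"
    by (rule KR_sequential_construction[OF assms])
  show ?thesis unfolding KR_path_seq_path by (rule K.measurable_path) auto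
qed

lemma KR_rearrangement_eq:
  "KR_rearrangement N \<mu> \<nu> = distr \<U> (RN N \<Otimes>\<^sub>M RN N) (\<lambda>u. (quantile_path u, KR_path \<nu> u N))"
  unfolding KR_rearrangement_def
proof (rule distr_cong_AE[OF refl refl])
  show "AE u in \<U>. (KR_path \<mu> u N, KR_path \<nu> u N) = (quantile_path u, KR_path \<nu> u N)"
    using AE_regular
  proof eventually_elim
    case (elim u)
    have "restrict (quantile_path u) {1..N} = quantile_path u" by (auto simp: quantile_path_def fun_eq_iff)
    then show ?case using KR_path_eq_quantile_path[OF elim, of N] by simp
  qed
qed (intro measurable_Pair measurable_KR_path \<mu> \<nu> measurable_quantile_path)+

lemma distr_quantile_path: "distr \<U> (RN N) quantile_path = \<mu>"
proof -
  have "distr \<U> (RN N) quantile_path = PiM {1..N} (\<lambda>s. distr U01 borel (quantile (m s)))"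
    unfolding quantile_path_def
  proof (rule distr_PiM_coordinatewise)
    show "quantile (m s) \<in> U01 \<rightarrow>\<^sub>M borel" for s
      using real_distribution.measurable_quantile[OF real_distribution_m[of s]] by simp
  qed (simp_all add: prob_space_U01)
  also have "\<dots> = PiM {1..N} m"
    by (simp add: real_distribution.distr_quantile[OF real_distribution_m])
  finally show ?thesis using product by simp
qed

text \<open>Splitting the uniform driving the \<open>t\<close>-th step into \<open>(x, v)\<close> with \<open>x\<close> the \<open>t\<close>-th source coordinate
  and \<open>v\<close> an independent uniform exhibits the rearrangement as an adapted randomised map of the source.\<close>

lemma KR_forward_construction:
  obtains \<psi> where "forward_construction N m \<nu> (\<lambda>t a y. quantile (cond_coord \<nu> t y) (\<psi> t a))"
    "\<And>t f. f \<in> borel_measurable (borel \<Otimes>\<^sub>M borel) \<Longrightarrow>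
      (\<integral>\<^sup>+a. f (fst a, \<psi> t a) \<partial>(m t \<Otimes>\<^sub>M U01)) = (\<integral>\<^sup>+u. f (quantile (m t) u, u) \<partial>U01)"
    "KR_rearrangement N \<mu> \<nu> = forward_construction.coupling N m (\<lambda>t a y. quantile (cond_coord \<nu> t y) (\<psi> t a))"
proof -
  have qm: "quantile (m t) \<in> borel_measurable U01" for t
    using real_distribution.measurable_quantile[OF real_distribution_m[of t]] by simp
  have idm: "(\<lambda>u. u) \<in> borel_measurable U01" by simp
  \<comment> \<open>Here the transfer recovers the level u from x = \<open>quantile (m t) u\<close>
    and a fresh uniform. At an atom of \<open>m t\<close> a whole interval of levels gives the same
    x, and the fresh uniform chooses among them.\<close>
  have "\<forall>t. \<exists>\<psi>. \<psi> \<in> borel_measurable (borel \<Otimes>\<^sub>M borel) \<and>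
     distr U01 (borel \<Otimes>\<^sub>M borel) (\<lambda>u. (quantile (m t) u, u)) = distr (m t \<Otimes>\<^sub>M U01) (borel \<Otimes>\<^sub>M borel) (\<lambda>z. (fst z, \<psi> z))"
    by (rule allI, rule transfer_real[OF prob_space_U01 qm idm])
       (auto simp: real_distribution.distr_quantile[OF real_distribution_m])
  then obtain \<psi> where \<psi>: "\<And>t. \<psi> t \<in> borel_measurable (borel \<Otimes>\<^sub>M borel)"
    and law: "\<And>t. distr U01 (borel \<Otimes>\<^sub>M borel) (\<lambda>u. (quantile (m t) u, u)) = distr (m t \<Otimes>\<^sub>M U01) (borel \<Otimes>\<^sub>M borel) (\<lambda>z. (fst z, \<psi> t z))"
    by (auto dest!: choice)
  have sR: "sets (m t \<Otimes>\<^sub>M U01) = sets (borel \<Otimes>\<^sub>M borel)" for t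
    by (rule sets_pair_measure_cong) (simp_all add: sets_m)
  have \<psi>': "\<psi> t \<in> borel_measurable (m t \<Otimes>\<^sub>M U01)" for t
    using \<psi> by (simp only: measurable_cong_sets[OF sR refl])
  have pm: "(\<lambda>z. (fst z, \<psi> t z)) \<in> m t \<Otimes>\<^sub>M U01 \<rightarrow>\<^sub>M borel \<Otimes>\<^sub>M borel" for t
    using measurable_Pair[OF measurable_fst \<psi>] by (simp only: measurable_cong_sets[OF sR refl])
  have qpm: "(\<lambda>u. (quantile (m t) u, u)) \<in> U01 \<rightarrow>\<^sub>M borel \<Otimes>\<^sub>M borel" for t
    by (rule measurable_Pair[OF qm idm])
  have int: "(\<integral>\<^sup>+a. f (fst a, \<psi> t a) \<partial>(m t \<Otimes>\<^sub>M U01)) = (\<integral>\<^sup>+u. f (quantile (m t) u, u) \<partial>U01)"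
    if f: "f \<in> borel_measurable (borel \<Otimes>\<^sub>M borel)" for t f
  proof -
    have "(\<integral>\<^sup>+u. f (quantile (m t) u, u) \<partial>U01) = integral\<^sup>N (distr U01 (borel \<Otimes>\<^sub>M borel) (\<lambda>u. (quantile (m t) u, u))) f"
      by (rule nn_integral_distr[OF qpm, symmetric]) (use f in simp)
    also have "\<dots> = (\<integral>\<^sup>+a. f (fst a, \<psi> t a) \<partial>(m t \<Otimes>\<^sub>M U01))"
      unfolding law by (rule nn_integral_distr[OF pm]) (use f in simp)
    finally show ?thesis by simp
  qed
  let ?K = "\<lambda>t u y. quantile (cond_coord \<nu> t y) u"
  let ?G = "\<lambda>t a y. ?K t (\<psi> t a) y"
  interpret K: sequential_construction N "\<lambda>_. U01" \<nu> ?K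
    by (rule KR_sequential_construction[OF \<nu>])
  have F: "forward_construction N m \<nu> ?G"
    unfolding forward_construction_def forward_construction_axioms_def sequential_construction_def
  proof (intro conjI allI impI)
    show "prob_space (m t \<Otimes>\<^sub>M U01)" for t by (rule prob_space_pair[OF prob_space_m prob_space_U01])
    show "prob_space \<nu>" "sets \<nu> = sets (RN N)" by (rule \<nu>)+
    show "real_distribution (m t)" for t by (rule real_distribution_m)
    fix t assume t: "t < N"
    note \<kappa> = measurable_quantile_kernel[OF cond_coord_kernel[OF \<nu> t]]
    show "(\<lambda>z. ?G (Suc t) (fst z) (snd z)) \<in> borel_measurable ((m (Suc t) \<Otimes>\<^sub>M U01) \<Otimes>\<^sub>M RN t)"
      using measurable_compose[OF measurable_Pair[OF measurable_snd measurable_compose[OF measurable_fst \<psi>']] \<kappa>] by simp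
    fix h :: "(nat \<Rightarrow> real) \<Rightarrow> ennreal" assume h: "h \<in> borel_measurable (RN (Suc t))"
    have "(\<integral>\<^sup>+y. \<integral>\<^sup>+a. h (y(Suc t := ?G (Suc t) a y)) \<partial>(m (Suc t) \<Otimes>\<^sub>M U01) \<partial>hist_law \<nu> t)
      = (\<integral>\<^sup>+y. \<integral>\<^sup>+u. h (y(Suc t := ?K (Suc t) u y)) \<partial>U01 \<partial>hist_law \<nu> t)"
    proof (rule nn_integral_cong)
      fix y assume "y \<in> space (hist_law \<nu> t)"
      then have y: "y \<in> space (RN t)" by simp
      have "(\<lambda>w. h (y(Suc t := ?K (Suc t) (snd w) y))) \<in> borel_measurable ((borel :: real measure) \<Otimes>\<^sub>M (borel :: real measure))"
        using measurable_compose[OF measurable_snd measurable_Pair2[OF \<kappa> y]] y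
        by (intro measurable_compose[OF measurable_upd_Suc h]) simp_all
      from int[OF this, of "Suc t"]
      show "(\<integral>\<^sup>+a. h (y(Suc t := ?G (Suc t) a y)) \<partial>(m (Suc t) \<Otimes>\<^sub>M U01)) = (\<integral>\<^sup>+u. h (y(Suc t := ?K (Suc t) u y)) \<partial>U01)"
        by simp
    qed
    also have "\<dots> = (\<integral>\<^sup>+y. h y \<partial>hist_law \<nu> (Suc t))" by (rule K.law[OF t h])
    finally show "(\<integral>\<^sup>+y. \<integral>\<^sup>+a. h (y(Suc t := ?G (Suc t) a y)) \<partial>(m (Suc t) \<Otimes>\<^sub>M U01) \<partial>hist_law \<nu> t)
      = (\<integral>\<^sup>+y. h y \<partial>hist_law \<nu> (Suc t))" .
  qed
  interpret F: forward_construction N m \<nu> ?G by (rule F)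
  define BB where "BB = PiM {1..N} (\<lambda>_. (borel :: real measure) \<Otimes>\<^sub>M (borel :: real measure))"
  \<comment> \<open>Rearrangement and coupling are both images under \<Theta> of a product law on
    pairs (source coordinate, level), so their equality reduces to \<open>law\<close> in each
    coordinate.\<close>
  define \<Theta> where "\<Theta> z = (\<lambda>s\<in>{1..N}. fst (z s), seq_path ?K (\<lambda>s. snd (z s)) N)" for z :: "nat \<Rightarrow> real \<times> real"
  have \<Theta>m: "\<Theta> \<in> BB \<rightarrow>\<^sub>M RN N \<Otimes>\<^sub>M RN N"
    unfolding \<Theta>_def
  proof (rule measurable_Pair)
    have "(\<lambda>z. \<lambda>s\<in>{1..N}. snd (z s)) \<in> BB \<rightarrow>\<^sub>M \<U>"
    proof (rule measurable_restrict)
      fix s assume "s \<in> {1..N}"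
      then have "(\<lambda>z. z s) \<in> BB \<rightarrow>\<^sub>M borel \<Otimes>\<^sub>M borel" unfolding BB_def by (rule measurable_component_singleton)
      from measurable_compose[OF this measurable_snd] show "(\<lambda>z. snd (z s)) \<in> BB \<rightarrow>\<^sub>M U01"
        by (subst measurable_cong_sets[of _ _ U01 borel]) simp_all
    qed
    from measurable_compose[OF this K.measurable_path[OF order_refl subset_refl]]
    have "(\<lambda>z. seq_path ?K (\<lambda>s\<in>{1..N}. snd (z s)) N) \<in> BB \<rightarrow>\<^sub>M RN N" .
    moreover have "seq_path ?K (\<lambda>s\<in>{1..N}. snd (z s)) N = seq_path ?K (\<lambda>s. snd (z s)) N" for z :: "nat \<Rightarrow> real \<times> real"
      by (rule seq_path_cong) simp
    ultimately show "(\<lambda>z. seq_path ?K (\<lambda>s. snd (z s)) N) \<in> BB \<rightarrow>\<^sub>M RN N" by simp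
    show "(\<lambda>z. \<lambda>s\<in>{1..N}. fst (z s)) \<in> BB \<rightarrow>\<^sub>M RN N"
    proof (rule measurable_restrict)
      fix s assume "s \<in> {1..N}"
      then have "(\<lambda>z. z s) \<in> BB \<rightarrow>\<^sub>M borel \<Otimes>\<^sub>M borel" unfolding BB_def by (rule measurable_component_singleton)
      from measurable_compose[OF this measurable_fst] show "(\<lambda>z. fst (z s)) \<in> BB \<rightarrow>\<^sub>M borel" .
    qed
  qed
  have c1: "(\<lambda>u. \<lambda>s\<in>{1..N}. (quantile (m s) (u s), u s)) \<in> \<U> \<rightarrow>\<^sub>M BB"
    unfolding BB_def
  proof (rule measurable_restrict)
    fix s assume "s \<in> {1..N}"
    then have "(\<lambda>u. u s) \<in> \<U> \<rightarrow>\<^sub>M U01" by (rule measurable_component_singleton)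
    from measurable_compose[OF this qpm] show "(\<lambda>u. (quantile (m s) (u s), u s)) \<in> \<U> \<rightarrow>\<^sub>M borel \<Otimes>\<^sub>M borel" .
  qed
  have c2: "(\<lambda>z. \<lambda>s\<in>{1..N}. (fst (z s), \<psi> s (z s))) \<in> F.noise N \<rightarrow>\<^sub>M BB"
    unfolding BB_def
  proof (rule measurable_restrict)
    fix s assume "s \<in> {1..N}"
    then have "(\<lambda>z. z s) \<in> F.noise N \<rightarrow>\<^sub>M m s \<Otimes>\<^sub>M U01" by (rule measurable_component_singleton)
    from measurable_compose[OF this pm] show "(\<lambda>z. (fst (z s), \<psi> s (z s))) \<in> F.noise N \<rightarrow>\<^sub>M borel \<Otimes>\<^sub>M borel" .
  qed
  have "KR_rearrangement N \<mu> \<nu> = distr (distr \<U> BB (\<lambda>u. \<lambda>s\<in>{1..N}. (quantile (m s) (u s), u s))) (RN N \<Otimes>\<^sub>M RN N) \<Theta>"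
    unfolding KR_rearrangement_eq
  proof (subst distr_distr[OF \<Theta>m c1], rule distr_cong[OF refl refl])
    fix u
    have "seq_path ?K (\<lambda>s. snd ((\<lambda>s\<in>{1..N}. (quantile (m s) (u s), u s)) s)) N = seq_path ?K u N"
      by (rule seq_path_cong) simp
    then show "(quantile_path u, KR_path \<nu> u N) = (\<Theta> \<circ> (\<lambda>u. \<lambda>s\<in>{1..N}. (quantile (m s) (u s), u s))) u"
      unfolding \<Theta>_def quantile_path_def KR_path_seq_path by (simp add: fun_eq_iff)
  qed
  also have "distr \<U> BB (\<lambda>u. \<lambda>s\<in>{1..N}. (quantile (m s) (u s), u s))
      = PiM {1..N} (\<lambda>s. distr U01 (borel \<Otimes>\<^sub>M borel) (\<lambda>u. (quantile (m s) u, u)))"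
    unfolding BB_def by (rule distr_PiM_coordinatewise[OF _ prob_space_U01 qpm]) simp
  also have "\<dots> = PiM {1..N} (\<lambda>s. distr (m s \<Otimes>\<^sub>M U01) (borel \<Otimes>\<^sub>M borel) (\<lambda>z. (fst z, \<psi> s z)))"
    unfolding law ..
  also have "\<dots> = distr (F.noise N) BB (\<lambda>z. \<lambda>s\<in>{1..N}. (fst (z s), \<psi> s (z s)))"
    unfolding BB_def by (rule distr_PiM_coordinatewise[OF _ F.R pm, symmetric]) simp
  also have "distr \<dots> (RN N \<Otimes>\<^sub>M RN N) \<Theta> = F.coupling"
    unfolding F.coupling_def
  proof (subst distr_distr[OF \<Theta>m c2], rule distr_cong[OF refl refl])
    fix z :: "nat \<Rightarrow> real \<times> real"
    have "seq_path ?K (\<lambda>s. snd ((\<lambda>s\<in>{1..N}. (fst (z s), \<psi> s (z s))) s)) N = seq_path ?K (\<lambda>s. \<psi> s (z s)) N"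
      by (rule seq_path_cong) simp
    also have "\<dots> = seq_path ?G z N"
    proof -
      have "seq_path ?K (\<lambda>s. \<psi> s (z s)) t = seq_path ?G z t" for t by (induction t) simp_all
      then show ?thesis .
    qed
    finally show "(\<Theta> \<circ> (\<lambda>z. \<lambda>s\<in>{1..N}. (fst (z s), \<psi> s (z s)))) z = F.joint_path N z"
      unfolding \<Theta>_def F.joint_path_def by (simp add: fun_eq_iff)
  qed
  finally show thesis using F int that by blast
qed

section \<open>The Knothe-Rosenblatt map\<close>

lemma measurable_KR_map_upto:
  "t \<le> N \<Longrightarrow> (\<lambda>x. KR_map_upto \<mu> \<nu> x t) \<in> RN N \<rightarrow>\<^sub>M RN t"
proof (induction t)
  case 0
  then show ?case by (simp add: space_PiM)
next
  case (Suc t)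
  then have t: "t < N" and IH: "(\<lambda>x. KR_map_upto \<mu> \<nu> x t) \<in> RN N \<rightarrow>\<^sub>M RN t" by auto
  have c: "(\<lambda>x. cdf (cond_coord \<mu> (Suc t) (restrict x {1..t})) (x (Suc t))) \<in> borel_measurable (RN N)"
    using measurable_compose[OF measurable_Pair[OF measurable_restrict_RN[OF refl, of t N] measurable_coordinate[where \<eta>="RN N" and N=N and t="Suc t", OF refl]]
        measurable_cdf_kernel[OF cond_coord_kernel[OF \<mu> t]]] t by simp
  show ?case
    unfolding KR_map_upto.simps
    using measurable_compose[OF measurable_Pair[OF IH c] measurable_quantile_kernel[OF cond_coord_kernel[OF \<nu> t]]]
    by (intro measurable_upd_Suc IH) simp
qed

text \<open>Without atoms the distribution function inverts the quantile from both sides at levels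
  in (0, 1) that matter: applied to \<open>quantile_path u\<close> it returns u. Along such points
  the recursion of the map is therefore that of \<open>KR_path \<nu> u\<close>, and
  \<open>quantile_path\<close> has law \<mu>.\<close>

lemma KR_rearrangement_eq_map:
  assumes atomless: "\<forall>t\<in>{1..N}. atomless (m t)"
  shows "KR_rearrangement N \<mu> \<nu> = distr \<mu> (RN N \<Otimes>\<^sub>M RN N) (\<lambda>x. (x, KR_map N \<mu> \<nu> x))"
proof -
  have mm: "(\<lambda>x. (x, KR_map N \<mu> \<nu> x)) \<in> RN N \<rightarrow>\<^sub>M RN N \<Otimes>\<^sub>M RN N"
    unfolding KR_map_def by (intro measurable_Pair measurable_KR_map_upto) simp_all
  \<comment> \<open>A point of positive mass is an atom in the sense of \<open>atomless\<close>,
    since one of any subset of a singleton and its complement therein is empty.\<close>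
  have null: "measure (m (Suc t)) {x} = 0" if "t < N" for t x
  proof (rule ccontr)
    interpret real_distribution "m (Suc t)" by (rule real_distribution_m)
    assume "measure (m (Suc t)) {x} \<noteq> 0"
    then have "0 < emeasure (m (Suc t)) {x}" by (simp add: emeasure_eq_measure zero_less_measure_iff)
    moreover have "emeasure (m (Suc t)) B = 0 \<or> emeasure (m (Suc t)) ({x} - B) = 0" if "B \<subseteq> {x}" for B
      using that by (cases "x \<in> B") (auto simp: subset_singleton_iff)
    ultimately have "\<not> atomless (m (Suc t))" unfolding atomless_def by (auto intro!: bexI[of _ "{x}"])
    then show False using atomless \<open>t < N\<close> by auto
  qed
  have step: "KR_map_upto \<mu> \<nu> (quantile_path u) t = KR_path \<nu> u t"
    if reg: "\<forall>t<N. cond_coord \<mu> (Suc t) (KR_path \<mu> u t) = m (Suc t) \<and> 0 < u (Suc t) \<and> u (Suc t) < 1"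
      and "t \<le> N" for u t
    using \<open>t \<le> N\<close>
  proof (induction t)
    case (Suc t)
    then have t: "t < N" by simp
    have "cond_coord \<mu> (Suc t) (restrict (quantile_path u) {1..t}) = m (Suc t)"
      using KR_path_eq_quantile_path[OF reg, of t] reg t by (metis less_imp_le)
    moreover have "quantile_path u (Suc t) = quantile (m (Suc t)) (u (Suc t))"
      using t by (simp add: quantile_path_def)
    moreover have "cdf (m (Suc t)) (quantile (m (Suc t)) (u (Suc t))) = u (Suc t)"
      by (rule real_distribution.cdf_quantile[OF real_distribution_m]) (use reg t null in auto)
    ultimately show ?case using Suc by simp
  qed simp
  have "distr \<mu> (RN N \<Otimes>\<^sub>M RN N) (\<lambda>x. (x, KR_map N \<mu> \<nu> x))
    = distr (distr \<U> (RN N) quantile_path) (RN N \<Otimes>\<^sub>M RN N) (\<lambda>x. (x, KR_map N \<mu> \<nu> x))"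
    unfolding distr_quantile_path ..
  also have "\<dots> = distr \<U> (RN N \<Otimes>\<^sub>M RN N) (\<lambda>u. (quantile_path u, KR_map N \<mu> \<nu> (quantile_path u)))"
    by (subst distr_distr[OF mm measurable_quantile_path]) (simp add: comp_def)
  also have "\<dots> = distr \<U> (RN N \<Otimes>\<^sub>M RN N) (\<lambda>u. (quantile_path u, KR_path \<nu> u N))"
  proof (rule distr_cong_AE[OF refl refl])
    show "AE u in \<U>. (quantile_path u, KR_map N \<mu> \<nu> (quantile_path u)) = (quantile_path u, KR_path \<nu> u N)"
      using AE_regular by eventually_elim (simp add: KR_map_def step)
    show "(\<lambda>u. (quantile_path u, KR_map N \<mu> \<nu> (quantile_path u))) \<in> \<U> \<rightarrow>\<^sub>M RN N \<Otimes>\<^sub>M RN N"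
      by (rule measurable_compose[OF measurable_quantile_path mm])
    show "(\<lambda>u. (quantile_path u, KR_path \<nu> u N)) \<in> \<U> \<rightarrow>\<^sub>M RN N \<Otimes>\<^sub>M RN N"
      by (intro measurable_Pair measurable_quantile_path measurable_KR_path \<nu>)
  qed
  finally show ?thesis unfolding KR_rearrangement_eq by simp
qed

end

section \<open>Separable costs\<close>

text \<open>Meant for a = max 0 (-k), b = max 0 k and r the integral of a negative part. The
  equation is obtained with nonnegative terms only; finite terms are moved across here, where A and
  B may be infinite together.\<close>

lemma ennreal_balance:
  fixes A B :: ennreal
  assumes "0 \<le> a" "0 \<le> b" "0 \<le> r" and eq: "A + ennreal a = B + (ennreal b + ennreal r)"
  shows "enn2ereal A - enn2ereal (ennreal r) = enn2ereal B + ereal (b - a)"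
proof (cases B)
  case B: (real B')
  show ?thesis
  proof (cases A)
    case A: (real A')
    have "ennreal (A' + a) = ennreal (B' + (b + r))"
      using eq assms(1-3) A B by (simp add: ennreal_plus)
    then have "A' + a = B' + (b + r)"
      using assms(1-3) A B by (subst (asm) ennreal_inj) simp_all
    then show ?thesis using A B assms(1-3) by (simp add: algebra_simps)
  next
    case top
    then show ?thesis using eq B assms(1-3) by (simp add: ennreal_plus[symmetric] del: ennreal_plus)
  qed
next
  case top
  then have "A + ennreal a = \<top>" using eq by simp
  then have "A = \<top>" by (simp add: ennreal_add_eq_top)
  then show ?thesis using top assms by simp
qed

lemma ext_integral_shift:
  assumes M: "prob_space M" and g: "g \<in> borel_measurable M" and g0: "\<And>p. p \<in> space M \<Longrightarrow> 0 \<le> g p"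
    and f: "\<And>p. p \<in> space M \<Longrightarrow> f p = g p + k"
  shows "ext_integral M f = enn2ereal (\<integral>\<^sup>+p. ennreal (g p) \<partial>M) + ereal k"
proof -
  interpret prob_space M by fact
  have fm: "f \<in> borel_measurable M"
    using g by (subst measurable_cong[OF f]) auto
  \<comment> \<open>This is f = g + k rearranged, with positive and negative parts, as f^+ + k^- = g
    + k^+ + f^-; all terms are nonnegative and integrate without finiteness conditions.\<close>
  have pw: "ennreal (f p) + ennreal (max 0 (- k)) = ennreal (g p) + (ennreal (max 0 k) + ennreal (- f p))"
    if p: "p \<in> space M" for p
  proof -
    have e: "ennreal x = ennreal (max 0 x)" for x by (simp add: max_def ennreal_neg)
    have "ennreal (f p) + ennreal (max 0 (- k)) = ennreal (max 0 (f p) + max 0 (- k))"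
      unfolding e[of "f p"] by (rule ennreal_plus[symmetric]) simp_all
    also have "max 0 (f p) + max 0 (- k) = g p + (max 0 k + max 0 (- f p))" using f[OF p] by (simp add: max_def)
    also have "ennreal \<dots> = ennreal (g p) + ennreal (max 0 k + max 0 (- f p))"
      by (rule ennreal_plus) (simp_all add: g0[OF p])
    also have "ennreal (max 0 k + max 0 (- f p)) = ennreal (max 0 k) + ennreal (- f p)"
      unfolding e[of "- f p"] by (rule ennreal_plus) simp_all
    finally show ?thesis .
  qed
  have int: "(\<integral>\<^sup>+p. ennreal (f p) \<partial>M) + ennreal (max 0 (- k))
      = (\<integral>\<^sup>+p. ennreal (g p) \<partial>M) + (ennreal (max 0 k) + (\<integral>\<^sup>+p. ennreal (- f p) \<partial>M))"
  proof -
    have "(\<integral>\<^sup>+p. ennreal (f p) + ennreal (max 0 (- k)) \<partial>M)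
      = (\<integral>\<^sup>+p. ennreal (g p) + (ennreal (max 0 k) + ennreal (- f p)) \<partial>M)"
      by (rule nn_integral_cong) (rule pw)
    then show ?thesis using g fm by (simp add: nn_integral_add emeasure_space_1)
  qed
  have "(\<integral>\<^sup>+p. ennreal (- f p) \<partial>M) \<le> (\<integral>\<^sup>+p. ennreal (max 0 (- k)) \<partial>M)"
    by (rule nn_integral_mono, rule ennreal_leI) (use f g0 in force)
  then have "(\<integral>\<^sup>+p. ennreal (- f p) \<partial>M) < \<infinity>"
    using emeasure_space_1 by (simp add: order_le_less_trans)
  then obtain r where r: "0 \<le> r" "(\<integral>\<^sup>+p. ennreal (- f p) \<partial>M) = ennreal r"
    by (cases "\<integral>\<^sup>+p. ennreal (- f p) \<partial>M") auto
  have "max 0 k - max 0 (- k) = k" by (simp add: max_def)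
  then show ?thesis
    using ennreal_balance[OF max.cobounded1 max.cobounded1 r(1) int[unfolded r(2)]]
    unfolding ext_integral_def r(2) by simp
qed

text \<open>Freezing every coordinate except t at 0 turns c into \<open>ct t\<close> plus a
  constant. The lower bound therefore passes to each summand, and open superlevel sets pass along
  the continuous embedding \<open>e\<close>, which gives measurability.\<close>

lemma separable_component:
  fixes ct :: "nat \<Rightarrow> real \<Rightarrow> real \<Rightarrow> real"
  assumes lsc: "lower_semicontinuous_map (prod_topology (RN_top N) (RN_top N)) c"
    and b: "\<And>p. p \<in> space (RN N \<Otimes>\<^sub>M RN N) \<Longrightarrow> b \<le> c p"
    and separable: "\<forall>x \<in> space (RN N). \<forall>y \<in> space (RN N). c (x, y) = (\<Sum>t=1..N. ct t (x t) (y t))"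
    and t: "t \<in> {1..N}"
  shows "\<exists>k. (\<forall>a b. k \<le> ct t a b) \<and> (\<lambda>p. ct t (fst p) (snd p)) \<in> borel_measurable (borel \<Otimes>\<^sub>M borel)"
proof -
  define e where "e a = (\<lambda>s\<in>{1..N}. if s = t then a else 0)" for a :: real
  define C where "C = (\<Sum>s\<in>{1..N} - {t}. ct s 0 0)"
  have esp: "e a \<in> space (RN N)" for a by (auto simp: e_def space_PiM)
  have top: "(e a, e a') \<in> topspace (prod_topology (RN_top N) (RN_top N))" for a a'
    using esp by (simp add: space_PiM)
  have et: "e a t = a" for a using t by (simp add: e_def)
  have ce: "c (e a, e a') = ct t a a' + C" for a a'
  proof -
    have "c (e a, e a') = (\<Sum>s=1..N. ct s (e a s) (e a' s))" using separable esp by blast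
    also have "\<dots> = ct t (e a t) (e a' t) + (\<Sum>s\<in>{1..N} - {t}. ct s (e a s) (e a' s))"
      by (rule sum.remove) (use t in auto)
    also have "(\<Sum>s\<in>{1..N} - {t}. ct s (e a s) (e a' s)) = C"
      unfolding C_def by (rule sum.cong) (auto simp: e_def)
    finally show ?thesis unfolding et .
  qed
  have lower: "b - C \<le> ct t a a'" for a a'
    using b[of "(e a, e a')"] esp ce[of a a'] by (simp add: space_pair_measure)
  have ec: "continuous_map euclidean (RN_top N) (\<lambda>p. e (\<pi> p))" if "continuous_on UNIV \<pi>" for \<pi> :: "real \<times> real \<Rightarrow> real"
    unfolding continuous_map_componentwise
  proof (intro conjI ballI)
    show "(\<lambda>p. e (\<pi> p)) ` topspace euclidean \<subseteq> extensional {1..N}" by (auto simp: e_def)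
    show "continuous_map euclidean euclidean (\<lambda>p. e (\<pi> p) s)" if "s \<in> {1..N}" for s
      using that \<open>continuous_on UNIV \<pi>\<close> by (cases "s = t") (simp_all add: e_def)
  qed
  have cont: "continuous_map euclidean (prod_topology (RN_top N) (RN_top N)) (\<lambda>p. (e (fst p), e (snd p)))"
    by (intro continuous_map_pairedI ec continuous_intros)
  have "(\<lambda>p. ct t (fst p) (snd p)) \<in> borel_measurable (borel :: (real \<times> real) measure)"
  proof (subst borel_measurable_iff_greater, intro allI)
    fix a
    have "openin (prod_topology (RN_top N) (RN_top N)) {p \<in> topspace (prod_topology (RN_top N) (RN_top N)). a + C < c p}"
      using lsc by (simp only: lower_semicontinuous_map_def)
    from openin_continuous_map_preimage[OF cont this]
    have "openin euclidean {p \<in> topspace euclidean. (e (fst p), e (snd p))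
       \<in> {p \<in> topspace (prod_topology (RN_top N) (RN_top N)). a + C < c p}}" .
    also have "{p \<in> topspace euclidean. (e (fst p), e (snd p)) \<in> {p \<in> topspace (prod_topology (RN_top N) (RN_top N)). a + C < c p}}
      = {p. a < ct t (fst p) (snd p)}"
      using top unfolding mem_Collect_eq ce topspace_euclidean by auto
    finally have "open {p. a < ct t (fst p) (snd p)}" by (rule open_openin[THEN iffD2])
    then show "{w \<in> space borel. a < ct t (fst w) (snd w)} \<in> sets borel" by simp
  qed
  then show ?thesis using lower by (auto simp: borel_prod)
qed

text \<open>Each summand is shifted by its own lower bound, so that sum and integral commute for
  nonnegative functions whether or not the total is finite.\<close>

lemma ext_integral_separable:
  fixes ct :: "nat \<Rightarrow> real \<Rightarrow> real \<Rightarrow> real"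
  assumes \<gamma>: "prob_space \<gamma>" "sets \<gamma> = sets (RN N \<Otimes>\<^sub>M RN N)"
    and separable: "\<forall>x \<in> space (RN N). \<forall>y \<in> space (RN N). c (x, y) = (\<Sum>t=1..N. ct t (x t) (y t))"
    and k: "\<And>t a b. t \<in> {1..N} \<Longrightarrow> k t \<le> ct t a b"
    and ctm: "\<And>t. t \<in> {1..N} \<Longrightarrow> (\<lambda>p. ct t (fst p) (snd p)) \<in> borel_measurable (borel \<Otimes>\<^sub>M borel)"
  shows "ext_integral \<gamma> c
    = enn2ereal (\<Sum>t=1..N. \<integral>\<^sup>+p. ennreal (ct t (fst p t) (snd p t) - k t) \<partial>\<gamma>) + ereal (\<Sum>t=1..N. k t)"
proof -
  have sp: "space \<gamma> = space (RN N) \<times> space (RN N)"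
    using sets_eq_imp_space_eq[OF \<gamma>(2)] by (simp add: space_pair_measure)
  have m: "(\<lambda>p. ct t (fst p t) (snd p t) - k t) \<in> borel_measurable \<gamma>" if t: "t \<in> {1..N}" for t
  proof -
    have c: "(\<lambda>x. x t) \<in> borel_measurable (RN N)" by (rule measurable_component_singleton[OF t])
    have "(\<lambda>p. (fst p t, snd p t)) \<in> RN N \<Otimes>\<^sub>M RN N \<rightarrow>\<^sub>M borel \<Otimes>\<^sub>M borel"
      by (intro measurable_Pair measurable_compose[OF measurable_fst c] measurable_compose[OF measurable_snd c])
    from measurable_compose[OF this ctm[OF t]]
    have "(\<lambda>p. ct t (fst p t) (snd p t) - k t) \<in> borel_measurable (RN N \<Otimes>\<^sub>M RN N)" by simp
    then show ?thesis by (subst measurable_cong_sets[OF \<gamma>(2) refl])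
  qed
  have "ext_integral \<gamma> c = enn2ereal (\<integral>\<^sup>+p. ennreal (\<Sum>t=1..N. ct t (fst p t) (snd p t) - k t) \<partial>\<gamma>) + ereal (\<Sum>t=1..N. k t)"
  proof (rule ext_integral_shift[OF \<gamma>(1)])
    show "(\<lambda>p. \<Sum>t=1..N. ct t (fst p t) (snd p t) - k t) \<in> borel_measurable \<gamma>"
      by (rule borel_measurable_sum) (rule m)
    show "0 \<le> (\<Sum>t=1..N. ct t (fst p t) (snd p t) - k t)" for p
      by (rule sum_nonneg) (use k in simp)
    show "c p = (\<Sum>t=1..N. ct t (fst p t) (snd p t) - k t) + (\<Sum>t=1..N. k t)" if "p \<in> space \<gamma>" for p
      using separable that unfolding sp by (cases p) (simp add: sum_subtractf)
  qed
  also have "(\<integral>\<^sup>+p. ennreal (\<Sum>t=1..N. ct t (fst p t) (snd p t) - k t) \<partial>\<gamma>)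
      = (\<integral>\<^sup>+p. (\<Sum>t=1..N. ennreal (ct t (fst p t) (snd p t) - k t)) \<partial>\<gamma>)"
    by (intro nn_integral_cong sum_ennreal[symmetric]) (use k in simp)
  also have "\<dots> = (\<Sum>t=1..N. \<integral>\<^sup>+p. ennreal (ct t (fst p t) (snd p t) - k t) \<partial>\<gamma>)"
    by (rule nn_integral_sum) (use m in simp)
  finally show ?thesis .
qed

theorem theorem2p9:
  fixes N :: nat
    and \<mu> \<nu> :: "(nat \<Rightarrow> real) measure"
    and c :: "(nat \<Rightarrow> real) \<times> (nat \<Rightarrow> real) \<Rightarrow> real"
    and ct :: "nat \<Rightarrow> real \<Rightarrow> real \<Rightarrow> real"
  assumes N: "1 \<le> N"
    and mu: "prob_space \<mu>" "sets \<mu> = sets (RN N)"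
    and nu: "prob_space \<nu>" "sets \<nu> = sets (RN N)"
    and lsc: "lower_semicontinuous_map (prod_topology (RN_top N) (RN_top N)) c"
    and bdd: "\<exists>b. \<forall>p \<in> space (RN N \<Otimes>\<^sub>M RN N). b \<le> c p"
    and separable: "\<forall>x \<in> space (RN N). \<forall>y \<in> space (RN N). c (x, y) = (\<Sum>t=1..N. ct t (x t) (y t))"
    and product: "\<mu> = PiM {1..N} (marginal \<mu>)"
  shows "(INF \<gamma>\<in>causal_couplings N \<mu> \<nu>. ext_integral \<gamma> c)
           = (INF \<gamma>\<in>bicausal_couplings N \<mu> \<nu>. ext_integral \<gamma> c)
    \<and> (\<forall>h :: nat \<Rightarrow> real \<Rightarrow> real.
         (\<forall>t\<in>{1..N}. convex_on UNIV (h t) \<and> (\<forall>a b. ct t a b = h t (a - b))) \<longrightarrow>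
           KR_rearrangement N \<mu> \<nu> \<in> causal_couplings N \<mu> \<nu>
         \<and> ext_integral (KR_rearrangement N \<mu> \<nu>) c
             = (INF \<gamma>\<in>causal_couplings N \<mu> \<nu>. ext_integral \<gamma> c)
         \<and> ((\<forall>t\<in>{1..N}. atomless (marginal \<mu> t)) \<longrightarrow>
              KR_rearrangement N \<mu> \<nu> = distr \<mu> (RN N \<Otimes>\<^sub>M RN N) (\<lambda>x. (x, KR_map N \<mu> \<nu> x))))"
proof -
  obtain b where b: "\<And>p. p \<in> space (RN N \<Otimes>\<^sub>M RN N) \<Longrightarrow> b \<le> c p" using bdd by blast
  have "\<forall>t\<in>{1..N}. \<exists>k. (\<forall>a b. k \<le> ct t a b) \<and> (\<lambda>p. ct t (fst p) (snd p)) \<in> borel_measurable (borel \<Otimes>\<^sub>M borel)"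
    using separable_component[OF lsc b separable] by blast
  from bchoice[OF this] obtain k where "\<forall>t\<in>{1..N}. (\<forall>a b. k t \<le> ct t a b)
      \<and> (\<lambda>p. ct t (fst p) (snd p)) \<in> borel_measurable (borel \<Otimes>\<^sub>M borel)" by blast
  then have k: "\<And>t a b. t \<in> {1..N} \<Longrightarrow> k t \<le> ct t a b"
    and ctm: "\<And>t. t \<in> {1..N} \<Longrightarrow> (\<lambda>p. ct t (fst p) (snd p)) \<in> borel_measurable (borel \<Otimes>\<^sub>M borel)"
    by blast+
  define J where "J \<gamma> t = (\<integral>\<^sup>+p. ennreal (ct t (fst p t) (snd p t) - k t) \<partial>\<gamma>)"
    for \<gamma> :: "((nat \<Rightarrow> real) \<times> (nat \<Rightarrow> real)) measure" and t
  have src: "product_source N \<mu> \<nu>" using mu nu product by (rule product_source.intro)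
  interpret S: product_source N \<mu> \<nu> by (rule src)
  have cfp: "causal_from_product N \<mu> \<nu> \<gamma>" if "\<gamma> \<in> causal_couplings N \<mu> \<nu>" for \<gamma>
    using src that by (intro causal_from_product.intro causal_from_product_axioms.intro)
  have cost: "ext_integral \<gamma> c = enn2ereal (\<Sum>t=1..N. J \<gamma> t) + ereal (\<Sum>t=1..N. k t)"
    if "\<gamma> \<in> causal_couplings N \<mu> \<nu>" for \<gamma>
  proof -
    interpret \<gamma>: causal_from_product N \<mu> \<nu> \<gamma> by (rule cfp[OF that])
    show ?thesis
      unfolding J_def by (rule ext_integral_separable[OF \<gamma>.prob_space_\<gamma> \<gamma>.sets_\<gamma> separable k ctm])
  qed
  \<comment> \<open>Presents the cost of one step in the form in which \<open>forward_rule\<close>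
    and \<open>nn_integral_coupling_step\<close> test the law of a step.\<close>
  define f where "f t = (\<lambda>((x, y :: nat \<Rightarrow> real), z). ennreal (ct t x z - k t))" for t
  have fm: "f (Suc t) \<in> borel_measurable ((borel \<Otimes>\<^sub>M RN t) \<Otimes>\<^sub>M borel)" if t: "t < N" for t
  proof -
    have "(\<lambda>p. (fst (fst p), snd p)) \<in> (borel \<Otimes>\<^sub>M RN t) \<Otimes>\<^sub>M borel \<rightarrow>\<^sub>M (borel :: real measure) \<Otimes>\<^sub>M (borel :: real measure)"
      by (intro measurable_Pair measurable_compose[OF measurable_fst measurable_fst] measurable_snd)
    from measurable_compose[OF this ctm[of "Suc t"]] t
    have "(\<lambda>p. ct (Suc t) (fst (fst p)) (snd p) - k (Suc t)) \<in> borel_measurable ((borel \<Otimes>\<^sub>M RN t) \<Otimes>\<^sub>M borel)" by simp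
    from measurable_compose[OF this measurable_ennreal] show ?thesis unfolding f_def split_beta' .
  qed
  have J_f: "J \<gamma> (Suc t) = (\<integral>\<^sup>+p. f (Suc t) ((fst p (Suc t), restrict (snd p) {1..t}), snd p (Suc t)) \<partial>\<gamma>)" for \<gamma> t
    by (simp add: J_def f_def)
  have steps: "t \<in> {1..N} \<Longrightarrow> \<exists>s<N. t = Suc s" for t by (cases t) auto
  have improve: "\<exists>\<gamma>'\<in>bicausal_couplings N \<mu> \<nu>. ext_integral \<gamma>' c \<le> ext_integral \<gamma> c"
    if \<gamma>: "\<gamma> \<in> causal_couplings N \<mu> \<nu>" for \<gamma>
  proof -
    interpret \<gamma>: causal_from_product N \<mu> \<nu> \<gamma> by (rule cfp[OF \<gamma>])
    obtain G where F: "forward_construction N (marginal \<mu>) \<nu> G" and G: "\<forall>t<N. \<gamma>.forward_rule t (G (Suc t))"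
      and bc: "forward_construction.coupling N (marginal \<mu>) G \<in> bicausal_couplings N \<mu> \<nu>"
      using \<gamma>.bicausal_improvement by blast
    interpret F: forward_construction N "marginal \<mu>" \<nu> G by (rule F)
    \<comment> \<open>The construction preserves the law of (x_t, y_1, ..., y_t), so every summand
      keeps its value and the costs are in fact equal.\<close>
    have "J F.coupling t = J \<gamma> t" if tN: "t \<in> {1..N}" for t
    proof -
      obtain s where s: "s < N" "t = Suc s" using steps[OF tN] by blast
      show ?thesis
        unfolding s(2) J_f F.nn_integral_coupling_step[OF s(1) fm[OF s(1)]]
        using G s(1) fm[OF s(1)] unfolding \<gamma>.forward_rule_def by simp
    qed
    moreover have "F.coupling \<in> causal_couplings N \<mu> \<nu>" using bc by (simp add: bicausal_couplings_def)
    ultimately have "ext_integral F.coupling c = ext_integral \<gamma> c" using \<gamma> by (simp add: cost)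
    then show ?thesis using bc by (intro bexI[of _ F.coupling]) simp_all
  qed
  have "(INF \<gamma>\<in>causal_couplings N \<mu> \<nu>. ext_integral \<gamma> c) = (INF \<gamma>\<in>bicausal_couplings N \<mu> \<nu>. ext_integral \<gamma> c)"
  proof (rule antisym)
    show "(INF \<gamma>\<in>causal_couplings N \<mu> \<nu>. ext_integral \<gamma> c) \<le> (INF \<gamma>\<in>bicausal_couplings N \<mu> \<nu>. ext_integral \<gamma> c)"
      by (rule INF_superset_mono) (auto simp: bicausal_couplings_def)
    show "(INF \<gamma>\<in>bicausal_couplings N \<mu> \<nu>. ext_integral \<gamma> c) \<le> (INF \<gamma>\<in>causal_couplings N \<mu> \<nu>. ext_integral \<gamma> c)"
      by (rule INF_mono) (rule improve)
  qed
  moreover have "KR_rearrangement N \<mu> \<nu> \<in> causal_couplings N \<mu> \<nu>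
      \<and> ext_integral (KR_rearrangement N \<mu> \<nu>) c = (INF \<gamma>\<in>causal_couplings N \<mu> \<nu>. ext_integral \<gamma> c)
      \<and> ((\<forall>t\<in>{1..N}. atomless (marginal \<mu> t)) \<longrightarrow>
           KR_rearrangement N \<mu> \<nu> = distr \<mu> (RN N \<Otimes>\<^sub>M RN N) (\<lambda>x. (x, KR_map N \<mu> \<nu> x)))"
    if h: "\<forall>t\<in>{1..N}. convex_on UNIV (h t) \<and> (\<forall>a b. ct t a b = h t (a - b))" for h
  proof (intro conjI impI)
    obtain \<psi> where FK: "forward_construction N (marginal \<mu>) \<nu> (\<lambda>t a y. quantile (cond_coord \<nu> t y) (\<psi> t a))"
      and \<psi>: "\<And>t f. f \<in> borel_measurable (borel \<Otimes>\<^sub>M borel) \<Longrightarrow>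
        (\<integral>\<^sup>+a. f (fst a, \<psi> t a) \<partial>(marginal \<mu> t \<Otimes>\<^sub>M U01)) = (\<integral>\<^sup>+u. f (quantile (marginal \<mu> t) u, u) \<partial>U01)"
      and KR: "KR_rearrangement N \<mu> \<nu> = forward_construction.coupling N (marginal \<mu>) (\<lambda>t a y. quantile (cond_coord \<nu> t y) (\<psi> t a))"
      by (rule S.KR_forward_construction) blast
    interpret K: forward_construction N "marginal \<mu>" \<nu> "\<lambda>t a y. quantile (cond_coord \<nu> t y) (\<psi> t a)" by (rule FK)
    show KR_causal: "KR_rearrangement N \<mu> \<nu> \<in> causal_couplings N \<mu> \<nu>"
      unfolding KR using K.coupling_causal product by simp
    \<comment> \<open>The splitting of the uniform is undone here: given the history, both
      coordinates are quantiles at one and the same level u.\<close>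
    have J_KR: "J (KR_rearrangement N \<mu> \<nu>) (Suc t)
        = (\<integral>\<^sup>+y. \<integral>\<^sup>+u. ennreal (ct (Suc t) (quantile (marginal \<mu> (Suc t)) u) (quantile (cond_coord \<nu> (Suc t) y) u) - k (Suc t)) \<partial>U01 \<partial>hist_law \<nu> t)"
      if t: "t < N" for t
      unfolding KR J_f K.nn_integral_coupling_step[OF t fm[OF t]]
    proof (rule nn_integral_cong)
      fix y assume "y \<in> space (hist_law \<nu> t)"
      then have y: "y \<in> space (RN t)" by simp
      interpret real_distribution "cond_coord \<nu> (Suc t) y"
        by (rule real_distribution_kernel[OF cond_coord_kernel[OF nu t] y])
      have "(\<lambda>p. (fst p, quantile (cond_coord \<nu> (Suc t) y) (snd p))) \<in> borel \<Otimes>\<^sub>M borel \<rightarrow>\<^sub>M (borel :: real measure) \<Otimes>\<^sub>M (borel :: real measure)"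
        by (intro measurable_Pair measurable_fst measurable_compose[OF measurable_snd measurable_quantile])
      from measurable_compose[OF this ctm[of "Suc t"]] t
      have "(\<lambda>p. ct (Suc t) (fst p) (quantile (cond_coord \<nu> (Suc t) y) (snd p)) - k (Suc t)) \<in> borel_measurable (borel \<Otimes>\<^sub>M borel)"
        by simp
      from \<psi>[OF measurable_compose[OF this measurable_ennreal]]
      show "(\<integral>\<^sup>+a. f (Suc t) ((fst a, y), quantile (cond_coord \<nu> (Suc t) y) (\<psi> (Suc t) a)) \<partial>(marginal \<mu> (Suc t) \<Otimes>\<^sub>M U01))
        = (\<integral>\<^sup>+u. ennreal (ct (Suc t) (quantile (marginal \<mu> (Suc t)) u) (quantile (cond_coord \<nu> (Suc t) y) u) - k (Suc t)) \<partial>U01)"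
        by (simp add: f_def)
    qed
    have optimal: "ext_integral (KR_rearrangement N \<mu> \<nu>) c \<le> ext_integral \<gamma> c"
      if \<gamma>: "\<gamma> \<in> causal_couplings N \<mu> \<nu>" for \<gamma>
    proof -
      interpret \<gamma>: causal_from_product N \<mu> \<nu> \<gamma> by (rule cfp[OF \<gamma>])
      obtain G where F: "forward_construction N (marginal \<mu>) \<nu> G" and G: "\<forall>t<N. \<gamma>.forward_rule t (G (Suc t))"
        using \<gamma>.bicausal_improvement by blast
      interpret F: forward_construction N "marginal \<mu>" \<nu> G by (rule F)
      \<comment> \<open>Both costs are integrals over the same law of histories y_1, ..., y_s. For
        almost every fixed history they compare two couplings of the same pair of laws on the line,
        one of them monotone, so one-dimensional optimality applies under the integral.\<close>
      have "J (KR_rearrangement N \<mu> \<nu>) t \<le> J \<gamma> t" if tN: "t \<in> {1..N}" for t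
      proof -
        obtain s where s: "s < N" "t = Suc s" using steps[OF tN] by blast
        let ?R = "marginal \<mu> t \<Otimes>\<^sub>M U01"
        have J_\<gamma>: "J \<gamma> t = (\<integral>\<^sup>+y. \<integral>\<^sup>+a. ennreal (h t (fst a - G t a y) - k t) \<partial>?R \<partial>hist_law \<nu> s)"
        proof -
          have "J \<gamma> t = (\<integral>\<^sup>+y. \<integral>\<^sup>+a. f t ((fst a, y), G t a y) \<partial>?R \<partial>hist_law \<nu> s)"
            using G s(1) fm[OF s(1)] unfolding \<gamma>.forward_rule_def s(2) J_f by blast
          moreover have "f t ((x, y), z) = ennreal (h t (x - z) - k t)" for x y z using h tN by (simp add: f_def)
          ultimately show ?thesis by simp
        qed
        have J_K: "J (KR_rearrangement N \<mu> \<nu>) t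
            = (\<integral>\<^sup>+y. \<integral>\<^sup>+u. ennreal (h t (quantile (marginal \<mu> t) u - quantile (cond_coord \<nu> t y) u) - k t) \<partial>U01 \<partial>hist_law \<nu> s)"
          unfolding s(2) J_KR[OF s(1)] using h tN s(2) by simp
        \<comment> \<open>The second marginal in the one-dimensional comparison is the law produced
          by the rule, whereas the rearrangement uses the fixed version; uniqueness of conditional
          laws matches them.\<close>
        have "AE y in hist_law \<nu> s. cond_coord \<nu> t y = distr ?R borel (\<lambda>a. G t a y)"
          using cond_law_unique[OF nu(1) measurable_restrict_RN[OF nu(2) less_imp_le[OF s(1)]]
              is_cond_law_cond_coord[OF nu s(1)] F.is_cond_law_step[OF s(1)]]
          unfolding hist_law_def[symmetric] s(2) .
        then have "AE y in hist_law \<nu> s.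
            (\<integral>\<^sup>+u. ennreal (h t (quantile (marginal \<mu> t) u - quantile (cond_coord \<nu> t y) u) - k t) \<partial>U01)
              \<le> (\<integral>\<^sup>+a. ennreal (h t (fst a - G t a y) - k t) \<partial>?R)"
          using AE_space
        proof eventually_elim
          case (elim y)
          then have y: "y \<in> space (RN s)" by simp
          have fst_R: "fst \<in> borel_measurable ?R"
            using measurable_fst[of "marginal \<mu> t" U01] by (simp add: measurable_cong_sets[OF refl S.sets_m])
          have "(\<lambda>z. G t (snd z) (fst z)) \<in> borel_measurable (RN s \<Otimes>\<^sub>M ?R)"
            using measurable_compose[OF measurable_pair_swap' F.G[OF s(1)]] by (simp add: split_beta' s(2))
          from measurable_Pair2[OF this y] have G_R: "(\<lambda>a. G t a y) \<in> borel_measurable ?R" by simp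
          have hk: "convex_on UNIV (\<lambda>z. h t z + - k t)"
            using h tN by (intro convex_on_add) (auto simp: convex_on_const)
          \<comment> \<open>Since \<open>ct t z 0 = h t z\<close>, the lower bound of the summand is
            one for the convex function.\<close>
          have h0: "0 \<le> h t z + - k t" for z
            using k[OF tN, of z 0] h tN by simp
          have "distr ?R borel fst = distr ?R (marginal \<mu> t) fst"
            by (rule distr_cong) (simp_all add: S.sets_m)
          also have "\<dots> = marginal \<mu> t"
            by (rule prob_space.distr_pair_fst[OF prob_space_U01])
          finally have d: "distr ?R borel fst = marginal \<mu> t" .
          show ?case
            using monotone_optimal_convex[OF prob_space_pair[OF S.prob_space_m prob_space_U01] fst_R G_R hk h0]
            unfolding monotone_optimal_def d elim(1)[symmetric] by simp
        qed
        then show ?thesis unfolding J_\<gamma> J_K by (rule nn_integral_mono_AE)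
      qed
      then have "(\<Sum>t=1..N. J (KR_rearrangement N \<mu> \<nu>) t) \<le> (\<Sum>t=1..N. J \<gamma> t)" by (rule sum_mono)
      then show ?thesis
        unfolding cost[OF KR_causal] cost[OF \<gamma>] by (intro add_right_mono) (simp add: less_eq_ennreal.rep_eq)
    qed
    show "ext_integral (KR_rearrangement N \<mu> \<nu>) c = (INF \<gamma>\<in>causal_couplings N \<mu> \<nu>. ext_integral \<gamma> c)"
    proof (rule antisym)
      show "ext_integral (KR_rearrangement N \<mu> \<nu>) c \<le> (INF \<gamma>\<in>causal_couplings N \<mu> \<nu>. ext_integral \<gamma> c)"
        by (rule INF_greatest) (rule optimal)
      show "(INF \<gamma>\<in>causal_couplings N \<mu> \<nu>. ext_integral \<gamma> c) \<le> ext_integral (KR_rearrangement N \<mu> \<nu>) c"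
        by (rule INF_lower) (rule KR_causal)
    qed
    assume "\<forall>t\<in>{1..N}. atomless (marginal \<mu> t)"
    then show "KR_rearrangement N \<mu> \<nu> = distr \<mu> (RN N \<Otimes>\<^sub>M RN N) (\<lambda>x. (x, KR_map N \<mu> \<nu> x))"
      by (rule S.KR_rearrangement_eq_map)
  qed
  ultimately show ?thesis by blast
qed

end
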